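(* Let $G=(V_1,V_2,E)$, $\mathbf N$ be as in the context, with the nodes of $\mathbf N$ given an RGB coloring by three circularly contiguous sets $R,G,B$ such that $|R|,|G|,|B|$ satisfy the triangle inequality, and let $\sigma$ be the corresponding tripartite pairing of $\mathbf N$. Let $x,y,w,v$ be four distinct nodes appearing in this cyclic order such that $\{x,y,w,v\}$ contains at least one node of each RGB color. If $x,w\in V_1$ and $y,v\in V_2$, then $$Z^{DD}_{\sigma}(G,\mathbf N)\,Z^{DD}_{\sigma_{xywv}}(G,\mathbf N\setminus\{x,y,w,v\})=Z^{DD}_{\sigma_{xy}}(G,\mathbf N\setminus\{x,y\})\,Z^{DD}_{\sigma_{wv}}(G,\mathbf N\setminus\{w,v\})+Z^{DD}_{\sigma_{xv}}(G,\mathbf N\setminus\{x,v\})\,Z^{DD}_{\sigma_{wy}}(G,\mathbf N\setminus\{w,y\}),$$ where for a set $U\subseteq\{x,y,w,v\}$, $\sigma_U$ denotes the unique planar pairing of $\mathbf N\setminus U$ in which no two nodes of the same RGB color are paired (with the convention that a term is $0$ if the corresponding pairing does not exist).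
   Context: $G=(V_1,V_2,E)$ is a finite edge-weighted planar bipartite graph embedded in the plane; vertices of $V_1$ are called black and those of $V_2$ white. A set $\mathbf N$ of $2n$ vertices on the outer face, called nodes, is labeled $1,\dots,2n$ in counterclockwise order, and contains $n$ black and $n$ white nodes (node colors otherwise arbitrary). For $\mathbf N'\subseteq\mathbf N$, a double-dimer configuration on $(G,\mathbf N')$ is a multiset of edges of $G$ such that each vertex in $\mathbf N'$ is an endpoint of exactly one edge and every other vertex of $G$ (including nodes not in $\mathbf N'$) is an endpoint of exactly two edges; it consists of paths joining the vertices of $\mathbf N'$ in pairs, doubled edges, and cycles of length $>2$ (loops). Its weight is the product of its edge weights (with multiplicity) times $2^{\ell}$, $\ell$ the number of loops. For a pairing $\tau$ of $\mathbf N'$ (a partition of $\mathbf N'$ into 2-element blocks), $Z^{DD}_\tau(G,\mathbf N')$ is the total weight of double-dimer configurations on $(G,\mathbf N')$ whose paths join the nodes exactly according to $\tau$. Two pairs $\{a,c\},\{b,d\}$ cross if $a<b<c<d$; a pairing is planar if no two pairs cross. RGB coloring: the nodes are partitioned into three circularly contiguous (possibly empty) sets colored red, green, blue (independent of the black/white coloring); when $|R|,|G|,|B|$ satisfy the triangle inequality there is a unique planar pairing in which no pair has two nodes of the same RGB color, called the tripartite pairing; removing nodes keeps the induced RGB coloring on the remaining nodes. *)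

theory Defs
  imports "HOL-Analysis.Analysis"
begin

text \<open>Graph: black vertices V1, white vertices V2 (disjoint, finite), edges E \<subseteq> V1 \<times> V2
  stored as (black, white); weights wt.  Nodes are given by labels 1..N via node :: nat \<Rightarrow> 'v.\<close>

text \<open>Planar embedding in the closed unit disk, with the nodes on the boundary circle
  in counterclockwise order of their labels (= embedded in the plane with the nodes on the
  outer face, labelled counterclockwise).\<close>
definition disk_embedding :: "'v set \<Rightarrow> ('v \<times> 'v) set \<Rightarrow> nat \<Rightarrow> (nat \<Rightarrow> 'v) \<Rightarrow> bool" where
  "disk_embedding V E N node \<longleftrightarrow>
     (\<exists>(p::'v \<Rightarrow> complex) (\<gamma>::('v \<times> 'v) \<Rightarrow> real \<Rightarrow> complex) (\<theta>::nat \<Rightarrow> real).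
        inj_on p V \<and>
        (\<forall>i\<in>{1..N}. p (node i) = cis (\<theta> i) \<and> 0 \<le> \<theta> i \<and> \<theta> i < 2 * pi) \<and>
        (\<forall>i\<in>{1..N}. \<forall>j\<in>{1..N}. i < j \<longrightarrow> \<theta> i < \<theta> j) \<and>
        (\<forall>v\<in>V - node ` {1..N}. norm (p v) < 1) \<and>
        (\<forall>e\<in>E. arc (\<gamma> e) \<and> pathstart (\<gamma> e) = p (fst e) \<and> pathfinish (\<gamma> e) = p (snd e) \<and>
                path_image (\<gamma> e) \<subseteq> cball 0 1 \<and>
                path_image (\<gamma> e) \<inter> sphere 0 1 \<subseteq> {p (fst e), p (snd e)}) \<and>
        (\<forall>e\<in>E. \<forall>v\<in>V. p v \<in> path_image (\<gamma> e) \<longrightarrow> v = fst e \<or> v = snd e) \<and>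
        (\<forall>e\<in>E. \<forall>e'\<in>E. e \<noteq> e' \<longrightarrow>
           path_image (\<gamma> e) \<inter> path_image (\<gamma> e') \<subseteq> p ` ({fst e, snd e} \<inter> {fst e', snd e'})))"

text \<open>Double-dimer configurations: multisets of edges, given by multiplicity functions m.\<close>
definition dd_deg :: "('v \<times> 'v) set \<Rightarrow> (('v \<times> 'v) \<Rightarrow> nat) \<Rightarrow> 'v \<Rightarrow> nat" where
  "dd_deg E m v = (\<Sum>e\<in>E. if fst e = v \<or> snd e = v then m e else 0)"

definition dd_config :: "'v set \<Rightarrow> ('v \<times> 'v) set \<Rightarrow> 'v set \<Rightarrow> (('v \<times> 'v) \<Rightarrow> nat) \<Rightarrow> bool" where
  "dd_config V E S m \<longleftrightarrow> (\<forall>e. e \<notin> E \<longrightarrow> m e = 0) \<and>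
      (\<forall>v\<in>V. dd_deg E m v = (if v \<in> S then 1 else 2))"

definition dd_adj :: "('v \<times> 'v) set \<Rightarrow> (('v \<times> 'v) \<Rightarrow> nat) \<Rightarrow> 'v \<Rightarrow> 'v \<Rightarrow> bool" where
  "dd_adj E m u v \<longleftrightarrow> ((u, v) \<in> E \<and> m (u, v) = 1) \<or> ((v, u) \<in> E \<and> m (v, u) = 1)"

definition dd_conn :: "('v \<times> 'v) set \<Rightarrow> (('v \<times> 'v) \<Rightarrow> nat) \<Rightarrow> 'v \<Rightarrow> 'v \<Rightarrow> bool" where
  "dd_conn E m = (dd_adj E m)\<^sup>*\<^sup>*"

definition dd_loops :: "('v \<times> 'v) set \<Rightarrow> 'v set \<Rightarrow> (('v \<times> 'v) \<Rightarrow> nat) \<Rightarrow> nat" where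
  "dd_loops E S m = card {Collect (dd_conn E m u) | u.
        (\<exists>v. dd_adj E m u v) \<and> (\<forall>s\<in>S. \<not> dd_conn E m u s)}"

definition dd_weight :: "('v \<times> 'v) set \<Rightarrow> (('v \<times> 'v) \<Rightarrow> real) \<Rightarrow> 'v set \<Rightarrow> (('v \<times> 'v) \<Rightarrow> nat) \<Rightarrow> real" where
  "dd_weight E wt S m = (\<Prod>e\<in>E. wt e ^ m e) * 2 ^ dd_loops E S m"

definition dd_pairs_as :: "('v \<times> 'v) set \<Rightarrow> (('v \<times> 'v) \<Rightarrow> nat) \<Rightarrow> 'v set \<Rightarrow> 'v set set \<Rightarrow> bool" where
  "dd_pairs_as E m S \<tau> \<longleftrightarrow> (\<forall>a\<in>S. \<forall>b\<in>S. a \<noteq> b \<longrightarrow> (dd_conn E m a b \<longleftrightarrow> {a, b} \<in> \<tau>))"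

definition ZDD :: "'v set \<Rightarrow> 'v set \<Rightarrow> ('v \<times> 'v) set \<Rightarrow> (('v \<times> 'v) \<Rightarrow> real) \<Rightarrow> 'v set \<Rightarrow> 'v set set \<Rightarrow> real" where
  "ZDD V1 V2 E wt S \<tau> =
     (\<Sum>m\<in>{m. dd_config (V1 \<union> V2) E S m \<and> dd_pairs_as E m S \<tau>}. dd_weight E wt S m)"

definition is_pairing :: "nat set \<Rightarrow> nat set set \<Rightarrow> bool" where
  "is_pairing L \<rho> \<longleftrightarrow> (\<forall>p\<in>\<rho>. card p = 2 \<and> p \<subseteq> L) \<and> (\<forall>a\<in>L. \<exists>!p. p \<in> \<rho> \<and> a \<in> p)"

definition planar_pairing :: "nat set set \<Rightarrow> bool" where
  "planar_pairing \<rho> \<longleftrightarrow> \<not> (\<exists>a b c d. {a, c} \<in> \<rho> \<and> {b, d} \<in> \<rho> \<and> a < b \<and> b < c \<and> c < d)"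

datatype rgb = Red | Green | Blue

definition circ_contig :: "nat \<Rightarrow> nat set \<Rightarrow> bool" where
  "circ_contig N S \<longleftrightarrow> (\<exists>a k. k \<le> N \<and> S = {(a + i) mod N + 1 | i. i < k})"

definition tripartite :: "(nat \<Rightarrow> rgb) \<Rightarrow> nat set \<Rightarrow> nat set set \<Rightarrow> bool" where
  "tripartite col L \<rho> \<longleftrightarrow> is_pairing L \<rho> \<and> planar_pairing \<rho> \<and>
      (\<forall>p\<in>\<rho>. \<forall>a\<in>p. \<forall>b\<in>p. a \<noteq> b \<longrightarrow> col a \<noteq> col b)"

text \<open>Z^DD_{sigma_U}(G, N \ U), where L = labels of N \ U; 0 if the tripartite pairing does not exist.\<close>
definition Ztrip :: "'v set \<Rightarrow> 'v set \<Rightarrow> ('v \<times> 'v) set \<Rightarrow> (('v \<times> 'v) \<Rightarrow> real) \<Rightarrow> (nat \<Rightarrow> 'v)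
     \<Rightarrow> (nat \<Rightarrow> rgb) \<Rightarrow> nat set \<Rightarrow> real" where
  "Ztrip V1 V2 E wt node col L =
     (if \<exists>\<rho>. tripartite col L \<rho>
      then ZDD V1 V2 E wt (node ` L) ((\<lambda>p. node ` p) ` (THE \<rho>. tripartite col L \<rho>))
      else 0)"

end

theory Submission
  imports Defs "Jordan_Normal_Form.Determinant"
begin

text \<open>
  For a set \<open>I\<close> of nodes let \<open>\<Delta>\<^sub>I\<close> be the dimer partition function of the graph with the black nodes in \<open>I\<close>
  and the white nodes outside \<open>I\<close> deleted. Superposing two matchings expresses \<open>\<Delta>\<^sub>I \<Delta>\<^sub>J\<close> as the sum of the weights
  of those double-dimer configurations whose paths join \<open>I - J\<close> to \<open>J - I\<close>. As the paths form a planar pairing, the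
  \<open>\<Delta>\<^sub>I\<close> satisfy the Pluecker relations, so up to a constant they are the maximal minors of a matrix with rows
  \<open>m\<^sub>1, ..., m\<^sub>2\<^sub>n\<close> in \<open>\<real>\<^sup>n\<close>.

  Consequently, for vectors \<open>u\<^sub>1, ..., u\<^sub>2\<^sub>n\<close> in the plane, \<open>det (m\<^sub>i \<otimes> u\<^sub>i)\<close> is up to a constant the sum over all
  planar pairings \<open>\<tau>\<close> of \<open>Z\<^sub>\<tau>\<close> times the product of \<open>u\<^sub>i \<and> u\<^sub>j\<close> over the pairs \<open>i < j\<close> of \<open>\<tau>\<close> and a sign. If \<open>u\<^sub>i\<close>
  only depends on the RGB colour of \<open>i\<close>, then only the tripartite pairing survives. Removing a black node and a
  white node \<open>y\<close> from the node set replaces the row of the black node by a second row \<open>m\<^sub>y \<otimes> u'\<close> for \<open>y\<close>, so that the six partition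
  functions of the theorem become six determinants related by the three-term Pluecker relation. The assumption that
  \<open>x, y, w, v\<close> meet all three colours makes the signs agree.
\<close>

section \<open>Determinants of lists of rows\<close>

text \<open>Why removing nodes turns into replacing rows: in a configuration on fewer nodes a
  removed node has degree two, so both superposed matchings cover it. A removed white label then
  lies in both index sets and a removed black label in neither, so the former appears with both
  basis vectors of the plane and the latter drops out. The two rows of a white label matter only up
  to a change of basis of determinant 1, so one of them can be taken to be the row that the label
  had before. The six determinants then have all rows but two in common, as the three-term relation
  requires.

  The obstacle is signs. Colours are arranged on a circle, labels on a line, and a wedge product is
  antisymmetric. Cutting the circle before label 1 may split a colour class; giving its two ends
  opposite vectors makes the wedge equal to 1 for all differently coloured labels in increasing
  order. What is left is one sign for each of the six node sets, depending on block sizes and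
  positions modulo small numbers.

  If all minors vanish, the normalizing constant may be 0, so the final relation is obtained without
  dividing by it.\<close>

definition rows_det :: "nat \<Rightarrow> (nat \<Rightarrow> nat \<Rightarrow> real) \<Rightarrow> real" where
  "rows_det n c = Determinant.det (Matrix.mat n n (\<lambda>(i, j). c i j))"

text \<open>Rows are functions on \<open>nat\<close> of which only the first \<open>n\<close>
  entries count. Keeping them in a list makes deleting, inserting and moving a row list
  operations.\<close>

definition list_det :: "nat \<Rightarrow> (nat \<Rightarrow> real) list \<Rightarrow> real" where
  "list_det n xs = rows_det n (\<lambda>k. xs ! k)"

lemma rows_det_leibniz:
  "rows_det n c = (\<Sum>p | p permutes {0..<n}. signof p * (\<Prod>i = 0..<n. c i (p i)))"
proof -
  have "(\<Prod>i = 0..<n. Matrix.mat n n (\<lambda>(i, j). c i j) $$ (i, p i)) = (\<Prod>i = 0..<n. c i (p i))"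
    if "p permutes {0..<n}" for p
    by (rule prod.cong) (use that permutes_in_image in fastforce)+
  then show ?thesis
    by (simp add: rows_det_def Determinant.det_def)
qed

lemma rows_det_cong:
  assumes "\<And>i j. i < n \<Longrightarrow> j < n \<Longrightarrow> c i j = c' i j"
  shows "rows_det n c = rows_det n c'"
  unfolding rows_det_def by (rule arg_cong[where f = Determinant.det]) (auto intro!: eq_matI simp: assms)

lemma rows_det_linear:
  assumes "k < n"
  shows "rows_det n (c(k := \<lambda>j. s * a j + t * b j)) =
    s * rows_det n (c(k := a)) + t * rows_det n (c(k := b))"
proof -
  have split: "(\<Prod>i = 0..<n. (c(k := d)) i (p i)) = d (p k) * (\<Prod>i\<in>{0..<n} - {k}. c i (p i))" for d p
  proof -
    have "(\<Prod>i = 0..<n. (c(k := d)) i (p i)) = d (p k) * (\<Prod>i\<in>{0..<n} - {k}. (c(k := d)) i (p i))"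
      using assms by (subst prod.remove[of _ k]) auto
    also have "(\<Prod>i\<in>{0..<n} - {k}. (c(k := d)) i (p i)) = (\<Prod>i\<in>{0..<n} - {k}. c i (p i))"
      by (rule prod.cong) auto
    finally show ?thesis .
  qed
  show ?thesis
    unfolding rows_det_leibniz split
    by (simp add: sum_distrib_left sum.distrib[symmetric] algebra_simps)
qed

lemma rows_det_identical:
  assumes "i \<noteq> j" "i < n" "j < n" "\<And>k. k < n \<Longrightarrow> c i k = c j k"
  shows "rows_det n c = 0"
  unfolding rows_det_def
  by (rule Determinant.det_identical_rows[of _ n i j]) (use assms in \<open>auto intro!: eq_vecI\<close>)

text \<open>Cramer's rule: the adjugate \<open>B\<close> satisfies
  \<open>B * A = d \<cdot>\<^sub>m 1\<^sub>m n\<close>, so the coefficient vector is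
  \<open>b\<close> times \<open>B\<close> divided by \<open>d\<close>.\<close>

lemma rows_det_span:
  assumes "rows_det n c \<noteq> 0"
  shows "\<exists>v. \<forall>j<n. b j = (\<Sum>k<n. v k * c k j)"
proof -
  define A where "A = Matrix.mat n n (\<lambda>(i, j). c i j)"
  define B where "B = adj_mat A"
  define d where "d = Determinant.det A"
  have A: "A \<in> carrier_mat n n" by (simp add: A_def)
  have B: "B \<in> carrier_mat n n" and BA: "B * A = d \<cdot>\<^sub>m 1\<^sub>m n"
    using adj_mat[OF A] by (auto simp: B_def d_def)
  have d: "d \<noteq> 0" using assms by (simp add: d_def A_def rows_det_def)
  have e: "(\<Sum>k<n. B $$ (i, k) * c k j) = (if i = j then d else 0)" if "i < n" "j < n" for i j
  proof -
    have "(B * A) $$ (i, j) = (\<Sum>k<n. B $$ (i, k) * c k j)"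
      using that A B by (auto simp: scalar_prod_def A_def atLeast0LessThan intro!: sum.cong)
    with BA that show ?thesis by (auto simp: one_mat_def)
  qed
  show ?thesis
  proof (intro exI[of _ "\<lambda>k. (\<Sum>i<n. b i * B $$ (i, k)) / d"] allI impI)
    fix j assume j: "j < n"
    have "(\<Sum>k<n. (\<Sum>i<n. b i * B $$ (i, k)) / d * c k j) =
        (\<Sum>k<n. \<Sum>i<n. b i * (B $$ (i, k) * c k j) / d)"
      by (simp add: sum_divide_distrib sum_distrib_right mult.assoc)
    also have "\<dots> = (\<Sum>i<n. b i * (\<Sum>k<n. B $$ (i, k) * c k j) / d)"
      by (subst sum.swap) (simp add: sum_divide_distrib sum_distrib_left)
    also have "\<dots> = (\<Sum>i<n. if i = j then b i else 0)"
      by (rule sum.cong) (use e j d in auto)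
    also have "\<dots> = b j" using j by simp
    finally show "b j = (\<Sum>k<n. (\<Sum>i<n. b i * B $$ (i, k)) / d * c k j)" ..
  qed
qed

lemma list_det_update:
  assumes "n = length xs + Suc (length ys)"
  shows "list_det n (xs @ d # ys) = rows_det n ((\<lambda>k. (xs @ e # ys) ! k)(length xs := d))"
  unfolding list_det_def
  by (rule rows_det_cong) (auto simp: nth_append nth_Cons split: nat.splits)

lemma list_det_linear:
  assumes "n = length xs + Suc (length ys)"
  shows "list_det n (xs @ (\<lambda>j. s * a j + t * b j) # ys) =
    s * list_det n (xs @ a # ys) + t * list_det n (xs @ b # ys)"
  unfolding list_det_update[OF assms, where e = a]
  by (rule rows_det_linear) (use assms in simp)

lemma list_det_zero:
  assumes "n = length xs + Suc (length ys)"
  shows "list_det n (xs @ (\<lambda>j. 0) # ys) = 0"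
  using list_det_linear[OF assms, of 0 "\<lambda>j. 0" 0 "\<lambda>j. 0"] by simp

lemma list_det_sum:
  assumes "n = length xs + Suc (length ys)" "finite K"
  shows "list_det n (xs @ (\<lambda>j. \<Sum>k\<in>K. v k * r k j) # ys) = (\<Sum>k\<in>K. v k * list_det n (xs @ r k # ys))"
  using assms(2)
proof (induction K rule: finite_induct)
  case empty
  then show ?case using list_det_zero[OF assms(1)] by simp
next
  case (insert k K)
  have "list_det n (xs @ (\<lambda>j. v k * r k j + 1 * (\<Sum>k\<in>K. v k * r k j)) # ys) =
     v k * list_det n (xs @ r k # ys) + 1 * list_det n (xs @ (\<lambda>j. \<Sum>k\<in>K. v k * r k j) # ys)"
    by (rule list_det_linear[OF assms(1)])
  with insert show ?case by simp
qed

lemma list_det_cong_nth: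
  assumes "length xs = n" "length ys = n" "\<And>i j. i < n \<Longrightarrow> j < n \<Longrightarrow> (xs ! i) j = (ys ! i) j"
  shows "list_det n xs = list_det n ys"
  unfolding list_det_def by (rule rows_det_cong) (use assms in auto)

lemma list_det_cong1:
  assumes "n = length xs + Suc (length ys)" "\<And>j. j < n \<Longrightarrow> a j = b j"
  shows "list_det n (xs @ a # ys) = list_det n (xs @ b # ys)"
  by (rule list_det_cong_nth) (use assms in \<open>auto simp: nth_append nth_Cons split: nat.splits\<close>)

lemma list_det_not_distinct:
  assumes "length xs = n" "\<not> distinct xs"
  shows "list_det n xs = 0"
proof -
  obtain i j where "i \<noteq> j" "i < n" "j < n" "xs ! i = xs ! j"
    using assms by (auto simp: distinct_conv_nth)
  then show ?thesis unfolding list_det_def by (intro rows_det_identical[of i j]) auto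
qed

text \<open>Polarization: the determinant with \<open>a + b\<close> in both places vanishes, and so
  do the two diagonal terms of its expansion.\<close>

lemma list_det_swap:
  assumes "n = length xs + Suc (Suc (length ys))"
  shows "list_det n (xs @ a # b # ys) = - list_det n (xs @ b # a # ys)"
proof -
  let ?s = "\<lambda>j. 1 * a j + 1 * b j"
  have z: "list_det n (xs @ c # c # ys) = 0" for c
    by (rule list_det_not_distinct) (use assms in auto)
  have 1: "list_det n (xs @ c # ?s # ys) = list_det n (xs @ c # a # ys) + list_det n (xs @ c # b # ys)" for c
    using list_det_linear[of n "xs @ [c]" ys 1 a 1 b] assms by simp
  have 2: "list_det n (xs @ ?s # c # ys) = list_det n (xs @ a # c # ys) + list_det n (xs @ b # c # ys)" for c
    using list_det_linear[of n xs "c # ys" 1 a 1 b] assms by simp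
  have "0 = list_det n (xs @ ?s # ?s # ys)" using z by simp
  also have "\<dots> = list_det n (xs @ a # b # ys) + list_det n (xs @ b # a # ys)"
    using z[of a] z[of b] 1[of a] 1[of b] 2[of ?s] by simp
  finally show ?thesis by simp
qed

lemma list_det_move:
  assumes "n = length xs + Suc (length zs + length ys)"
  shows "list_det n (xs @ a # zs @ ys) = (-1) ^ length zs * list_det n (xs @ zs @ a # ys)"
  using assms
proof (induction zs arbitrary: xs)
  case (Cons z zs)
  have "list_det n (xs @ a # z # (zs @ ys)) = - list_det n (xs @ z # a # (zs @ ys))"
    by (rule list_det_swap) (use Cons.prems in simp)
  also have "list_det n (xs @ z # a # (zs @ ys)) = (-1) ^ length zs * list_det n ((xs @ [z]) @ zs @ a # ys)"
    using Cons.IH[of "xs @ [z]"] Cons.prems by simp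
  finally show ?case by simp
qed simp

text \<open>If \<open>\<phi> a c\<close> is nonzero, the rows \<open>C\<close>, \<open>a\<close>,
  \<open>c\<close> form a basis. Expanding \<open>b\<close> in it, the rows of \<open>C\<close>
  contribute nothing and the two remaining coefficients are \<open>\<phi> b c\<close> and
  \<open>\<phi> a b\<close> divided by \<open>\<phi> a c\<close>. Antisymmetry carries this over to
  nonzero \<open>\<phi> b c\<close> or \<open>\<phi> a b\<close>; if all three vanish, so do both
  sides.\<close>

lemma list_det_pluecker:
  assumes n: "n = Suc (Suc (length C))"
  defines "\<phi> \<equiv> \<lambda>p q. list_det n (C @ [p, q])"
  shows "\<phi> a c * \<phi> b d = \<phi> b c * \<phi> a d + \<phi> a b * \<phi> c d"
proof -
  have anti: "\<phi> p q = - \<phi> q p" for p q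
    unfolding \<phi>_def using list_det_swap[of n C "[]" p q] n by simp
  have main: "\<phi> a c * \<phi> b d = \<phi> b c * \<phi> a d + \<phi> a b * \<phi> c d" if nz: "\<phi> a c \<noteq> 0" for a b c d
  proof -
    let ?R = "C @ [a, c]"
    obtain v where v: "\<forall>j<n. b j = (\<Sum>k<n. v k * (?R ! k) j)"
      using rows_det_span[of n "\<lambda>k. ?R ! k" b] nz unfolding \<phi>_def list_det_def by blast
    define r s where "r = v (length C)" and "s = v (Suc (length C))"
    have e: "\<phi> b q = r * \<phi> a q + s * \<phi> c q" for q
    proof -
      have "\<phi> b q = list_det n (C @ (\<lambda>j. \<Sum>k<n. v k * (?R ! k) j) # [q])"
        unfolding \<phi>_def by (rule list_det_cong1) (use n v in auto)
      also have "\<dots> = (\<Sum>k<n. v k * list_det n (C @ (?R ! k) # [q]))"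
        by (rule list_det_sum) (use n in auto)
      also have "\<dots> = (\<Sum>k<length C. v k * list_det n (C @ (?R ! k) # [q])) + r * \<phi> a q + s * \<phi> c q"
        by (simp add: n r_def s_def \<phi>_def nth_append)
      also have "(\<Sum>k<length C. v k * list_det n (C @ (?R ! k) # [q])) = 0"
        by (rule sum.neutral) (auto intro!: list_det_not_distinct simp: n nth_append)
      finally show ?thesis by simp
    qed
    have "\<phi> a a = 0" "\<phi> c c = 0" using anti[of a a] anti[of c c] by auto
    then have "\<phi> b c = r * \<phi> a c" "\<phi> a b = s * \<phi> a c"
      using e[of c] e[of a] anti[of a b] anti[of c a] by auto
    with e[of d] show ?thesis by (simp add: algebra_simps)
  qed
  consider "\<phi> a c \<noteq> 0" | "\<phi> b c \<noteq> 0" | "\<phi> a b \<noteq> 0" | "\<phi> a c = 0" "\<phi> b c = 0" "\<phi> a b = 0" by blast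
  then show ?thesis
  proof cases
    case 1 then show ?thesis by (rule main)
  next
    case 2
    from main[OF 2, of a d] anti[of a b] show ?thesis by (simp add: algebra_simps)
  next
    case 3
    from main[OF 3, of c d] anti[of c b] show ?thesis by (simp add: algebra_simps)
  qed simp
qed

text \<open>As \<open>xs @ ys\<close> is sorted, at most one of the two counted sets is nonempty:
  row \<open>i\<close> moves either left across the end of \<open>xs\<close> or right across the
  beginning of \<open>ys\<close>.\<close>

lemma list_det_insort:
  fixes i :: nat
  assumes n: "n = Suc (length xs + length ys)" and s: "sorted (xs @ ys)" and i: "i \<notin> set (xs @ ys)"
    and d: "distinct (xs @ ys)"
  shows "list_det n (map r (xs @ i # ys)) =
    (-1) ^ (card {z \<in> set xs. i < z} + card {z \<in> set ys. z < i}) * list_det n (map r (insort i (xs @ ys)))"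
proof -
  have ins: "insort i (P @ Q) = P @ i # Q" if "\<forall>z\<in>set P. z < i" "\<forall>z\<in>set Q. i < z" for P Q :: "nat list"
    using that by (induction P) (auto simp: insort_is_Cons order.strict_implies_order)
  show ?thesis
  proof (cases "\<exists>z\<in>set xs. i < z")
    case False
    define P Q where "P = takeWhile (\<lambda>z. z < i) ys" and "Q = dropWhile (\<lambda>z. z < i) ys"
    have ys: "ys = P @ Q" by (simp add: P_def Q_def)
    have P: "\<forall>z\<in>set P. z < i" by (auto simp: P_def dest: set_takeWhileD)
    have Q: "\<forall>z\<in>set Q. i < z"
    proof (cases Q)
      case (Cons q Q')
      have "\<not> q < i" using Cons hd_dropWhile[of "\<lambda>z. z < i" ys] by (auto simp: Q_def)
      moreover have "q \<noteq> i" using i ys Cons by auto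
      moreover have "sorted Q" using s ys by (auto simp: sorted_append)
      ultimately show ?thesis using Cons by auto
    qed simp
    have X: "\<forall>z\<in>set xs. z < i" using False i by (auto simp: not_less intro: le_neq_trans)
    have e: "insort i (xs @ ys) = xs @ P @ i # Q" using ins[of "xs @ P" Q] X P Q ys by auto
    have c: "{z \<in> set ys. z < i} = set P" "card {z \<in> set xs. i < z} = 0" using ys P Q X by auto
    have cP: "card (set P) = length P" using d ys by (simp add: distinct_card)
    show ?thesis
      using list_det_move[of n "map r xs" "map r P" "map r Q" "r i"] n e ys
      unfolding c add_0 cP by simp
  next
    case True
    define P Q where "P = takeWhile (\<lambda>z. z < i) xs" and "Q = dropWhile (\<lambda>z. z < i) xs"
    have xs: "xs = P @ Q" by (simp add: P_def Q_def)
    have P: "\<forall>z\<in>set P. z < i" by (auto simp: P_def dest: set_takeWhileD)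
    have Q: "\<forall>z\<in>set Q. i < z"
    proof (cases Q)
      case (Cons q Q')
      have "\<not> q < i" using Cons hd_dropWhile[of "\<lambda>z. z < i" xs] by (auto simp: Q_def)
      moreover have "q \<noteq> i" using i xs Cons by auto
      moreover have "sorted Q" using s xs by (auto simp: sorted_append)
      ultimately show ?thesis using Cons by auto
    qed simp
    have X: "\<forall>z\<in>set ys. i < z" using True s by (force simp: sorted_append)
    have e: "insort i (xs @ ys) = P @ i # Q @ ys" using ins[of P "Q @ ys"] X P Q xs by auto
    have c: "{z \<in> set xs. i < z} = set Q" "card {z \<in> set ys. z < i} = 0" using xs P Q X by auto
    have cQ: "card (set Q) = length Q" using d xs by (simp add: distinct_card)
    have "list_det n (map r (insort i (xs @ ys))) = (-1) ^ length Q * list_det n (map r (xs @ i # ys))"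
      using list_det_move[of n "map r P" "map r Q" "map r ys" "r i"] n e xs by simp
    then show ?thesis unfolding c cQ by (simp flip: power_add)
  qed
qed

text \<open>\<open>top_vec n m\<close> and \<open>bot_vec n m\<close> are the tensors of
  \<open>m\<close> with the two basis vectors of the plane, written as vectors of length
  \<open>2 * n\<close>.\<close>

definition top_vec :: "nat \<Rightarrow> (nat \<Rightarrow> real) \<Rightarrow> nat \<Rightarrow> real" where
  "top_vec n m j = (if j < n then m j else 0)"

definition bot_vec :: "nat \<Rightarrow> (nat \<Rightarrow> real) \<Rightarrow> nat \<Rightarrow> real" where
  "bot_vec n m j = (if j < n then 0 else m (j - n))"

text \<open>With \<open>n\<close> top rows the matrix is block diagonal. Otherwise a permutation
  with nonzero Leibniz term would inject the top rows into \<open>n\<close> columns and the bottom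
  rows into the other \<open>n\<close>, which the numbers of rows forbid.\<close>

lemma list_det_block:
  assumes "length A + length B = 2 * n"
  shows "list_det (2 * n) (map (top_vec n) A @ map (bot_vec n) B) =
    (if length A = n then list_det n A * list_det n B else 0)"
proof (cases "length A = n")
  case True
  then have B: "length B = n" using assms by simp
  let ?A = "Matrix.mat n n (\<lambda>(i, j). (A ! i) j)" and ?B = "Matrix.mat n n (\<lambda>(i, j). (B ! i) j)"
  have "Matrix.mat (2 * n) (2 * n) (\<lambda>(i, j). ((map (top_vec n) A @ map (bot_vec n) B) ! i) j) =
      four_block_mat ?A (0\<^sub>m n n) (0\<^sub>m n n) ?B"
    by (rule eq_matI) (auto simp: nth_append True B top_vec_def bot_vec_def)
  then have "list_det (2 * n) (map (top_vec n) A @ map (bot_vec n) B) =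
      Determinant.det (four_block_mat ?A (0\<^sub>m n n) (0\<^sub>m n n) ?B)"
    by (simp add: list_det_def rows_det_def)
  also have "\<dots> = Determinant.det ?A * Determinant.det ?B"
    by (rule det_four_block_mat_lower_left_zero[of _ n _ n]) auto
  finally show ?thesis using True by (simp add: list_det_def rows_det_def)
next
  case False
  let ?c = "\<lambda>i. (map (top_vec n) A @ map (bot_vec n) B) ! i"
  have "(\<Prod>i = 0..<2 * n. ?c i (p i)) = 0" if p: "p permutes {0..<2 * n}" for p
  proof (rule ccontr)
    assume "(\<Prod>i = 0..<2 * n. ?c i (p i)) \<noteq> 0"
    then have nz: "?c i (p i) \<noteq> 0" if "i < 2 * n" for i using that by simp
    have inj: "inj_on p X" for X using permutes_inj_on[OF p] .
    have lt: "p i < 2 * n" if "i < 2 * n" for i using permutes_in_image[OF p, of i] that by simp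
    have 1: "p ` {..<length A} \<subseteq> {..<n}"
    proof
      fix z assume "z \<in> p ` {..<length A}"
      then obtain i where i: "i < length A" "z = p i" by auto
      with nz[of i] assms show "z \<in> {..<n}" by (auto simp: nth_append top_vec_def split: if_splits)
    qed
    have 2: "p ` {length A..<2 * n} \<subseteq> {n..<2 * n}"
    proof
      fix z assume "z \<in> p ` {length A..<2 * n}"
      then obtain i where i: "i \<ge> length A" "i < 2 * n" "z = p i" by auto
      with nz[of i] assms lt[of i] show "z \<in> {n..<2 * n}"
        by (auto simp: nth_append bot_vec_def split: if_splits)
    qed
    have "length A \<le> n" using card_mono[OF _ 1] card_image[OF inj, of "{..<length A}"] by simp
    moreover have "2 * n - length A \<le> n"
      using card_mono[OF _ 2] card_image[OF inj, of "{length A..<2 * n}"] by simp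
    ultimately show False using False assms by simp
  qed
  then have "list_det (2 * n) (map (top_vec n) A @ map (bot_vec n) B) = 0"
    unfolding list_det_def rows_det_leibniz by (intro sum.neutral) (metis (lifting) mem_Collect_eq mult_zero_right)
  then show ?thesis using False by simp
qed

section \<open>Paths and cycles in superpositions of matchings\<close>

text \<open>Joining each \<open>e\<close> to \<open>f e\<close> and \<open>g e\<close> gives paths
  and cycles whose links alternate between \<open>f\<close> and \<open>g\<close>; such cycles are
  even, so two colours suffice. The induction cuts out one \<open>f\<close>-link and splices
  \<open>g\<close> across the gap.\<close>

lemma two_involutions_coloring:
  assumes "finite P"
    and "\<And>e. e \<in> P \<Longrightarrow> f e \<in> P \<and> f (f e) = e"
    and "\<And>e. e \<in> P \<Longrightarrow> g e \<in> P \<and> g (g e) = e"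
  shows "\<exists>X\<subseteq>P. \<forall>e\<in>P. (f e \<noteq> e \<longrightarrow> (f e \<in> X \<longleftrightarrow> e \<notin> X)) \<and> (g e \<noteq> e \<longrightarrow> (g e \<in> X \<longleftrightarrow> e \<notin> X))"
  using assms
proof (induction "card P" arbitrary: P g rule: less_induct)
  case less
  note f = less.prems(2) and g = less.prems(3)
  show ?case
  proof (cases "P = {}")
    case False
    then obtain e where e: "e \<in> P" by blast
    define e' where "e' = f e"
    have e': "e' \<in> P" "f e' = e" using f[OF e] by (auto simp: e'_def)
    define P' where "P' = P - {e, e'}"
    \<comment> \<open>The \<open>g\<close>-neighbours of \<open>e\<close> and \<open>e'\<close>
      become partners of each other. They were three links apart, so opposite colours for them are
      consistent with colouring \<open>e\<close> and \<open>e'\<close> afterwards. A neighbour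
      without a counterpart becomes a fixed point.\<close>
    define g' where "g' z = (if g z \<in> P' then g z
       else if g z = e \<and> g e' \<in> P' then g e' else if g z = e' \<and> g e \<in> P' then g e else z)" for z
    have "card P' < card P" unfolding P'_def using e less.prems(1) by (intro psubset_card_mono) auto
    moreover have "finite P'" using less.prems(1) by (simp add: P'_def)
    moreover have "f z \<in> P' \<and> f (f z) = z" if "z \<in> P'" for z
      using f[of z] f[OF e] that by (auto simp: P'_def e'_def)
    moreover have "g' z \<in> P' \<and> g' (g' z) = z" if z: "z \<in> P'" for z
    proof -
      have zP: "z \<in> P" "z \<noteq> e" "z \<noteq> e'" using z by (auto simp: P'_def)
      note gz = g[OF zP(1)] and ge = g[OF e] and ge' = g[OF e'(1)]
      consider "g z \<in> P'" | "g z = e" "e \<noteq> e'" | "g z = e'" "e \<noteq> e'" | "g z = e" "e = e'"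
        using gz by (auto simp: P'_def)
      then show ?thesis
      proof cases
        case 1 then show ?thesis using gz z by (simp add: g'_def)
      next
        case 2
        then have "g e = z" using gz by auto
        then show ?thesis using 2 z ge ge' e e' zP by (auto simp: g'_def P'_def)
      next
        case 3
        then have "g e' = z" using gz by auto
        then show ?thesis using 3 z ge ge' e e' zP by (auto simp: g'_def P'_def)
      next
        case 4
        then have "g e = z" using gz by auto
        then show ?thesis using 4 z ge zP by (auto simp: g'_def P'_def)
      qed
    qed
    ultimately have "\<exists>X\<subseteq>P'. \<forall>e\<in>P'. (f e \<noteq> e \<longrightarrow> (f e \<in> X \<longleftrightarrow> e \<notin> X)) \<and>
        (g' e \<noteq> e \<longrightarrow> (g' e \<in> X \<longleftrightarrow> e \<notin> X))"
      by (rule less.hyps)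
    then obtain X where X: "X \<subseteq> P'" and Xf: "\<And>z. z \<in> P' \<Longrightarrow> f z \<noteq> z \<Longrightarrow> f z \<in> X \<longleftrightarrow> z \<notin> X"
      and Xg: "\<And>z. z \<in> P' \<Longrightarrow> g' z \<noteq> z \<Longrightarrow> g' z \<in> X \<longleftrightarrow> z \<notin> X"
      by blast
    \<comment> \<open>The colour of \<open>e\<close>: opposite to \<open>g e\<close> if that
      survives, else equal to the colour of \<open>g e'\<close>, which is two links away, else
      arbitrary.\<close>
    define b where "b = (if g e \<in> P' then g e \<notin> X else if g e' \<in> P' \<and> e \<noteq> e' then g e' \<in> X else True)"
    define Y where "Y = X \<union> (if b then {e} else {}) \<union> (if e \<noteq> e' \<and> \<not> b then {e'} else {})"
    have Ye: "e \<in> Y \<longleftrightarrow> b" and Ye': "e \<noteq> e' \<Longrightarrow> e' \<in> Y \<longleftrightarrow> \<not> b"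
      and YX: "\<And>z. z \<in> P' \<Longrightarrow> z \<in> Y \<longleftrightarrow> z \<in> X"
      using X by (auto simp: Y_def P'_def)
    have ge: "g e \<in> Y \<longleftrightarrow> e \<notin> Y" if "g e \<noteq> e"
    proof (cases "g e = e'")
      case True
      then show ?thesis using Ye Ye' that by auto
    next
      case False
      then have "g e \<in> P'" using g[OF e] that by (auto simp: P'_def)
      then show ?thesis using Ye YX by (auto simp: b_def)
    qed
    have ge': "g e' \<in> Y \<longleftrightarrow> e' \<notin> Y" if "g e' \<noteq> e'" "e \<noteq> e'"
    proof (cases "g e' = e")
      case True
      then show ?thesis using Ye Ye' that by auto
    next
      case False
      then have h: "g e' \<in> P'" using g[OF e'(1)] that by (auto simp: P'_def)
      show ?thesis
      proof (cases "g e \<in> P'")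
        case True
        have ne: "g e \<noteq> g e'" using g[OF e] g[OF e'(1)] that by metis
        have "g' (g e) = g e'" using True h g[OF e] that by (auto simp: g'_def P'_def)
        then have "g e' \<in> X \<longleftrightarrow> g e \<notin> X" using Xg[OF True] ne by auto
        then show ?thesis using Ye' YX h True that by (auto simp: b_def)
      next
        case False
        then show ?thesis using Ye' YX h that by (auto simp: b_def)
      qed
    qed
    show ?thesis
    proof (intro exI[of _ Y] conjI ballI)
      show "Y \<subseteq> P" using X e e' by (auto simp: Y_def P'_def)
    next
      fix z assume z: "z \<in> P"
      consider "z = e" | "z = e'" "e \<noteq> e'" | "z \<in> P'" using z by (auto simp: P'_def)
      then have "(f z \<noteq> z \<longrightarrow> (f z \<in> Y \<longleftrightarrow> z \<notin> Y)) \<and> (g z \<noteq> z \<longrightarrow> (g z \<in> Y \<longleftrightarrow> z \<notin> Y))"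
      proof cases
        case 1 then show ?thesis using ge Ye Ye' e'_def by auto
      next
        case 2 then show ?thesis using ge' Ye Ye' e' by auto
      next
        case 3
        have fz: "f z \<in> P'" using f[OF z] f[OF e] 3 by (auto simp: P'_def e'_def)
        have "g z \<in> Y \<longleftrightarrow> z \<notin> Y" if ne: "g z \<noteq> z"
        proof -
          consider "g z \<in> P'" | "g z = e" | "g z = e'" "e \<noteq> e'" using g[OF z] by (auto simp: P'_def)
          then show ?thesis
          proof cases
            case 1
            then show ?thesis using Xg[of z] YX[of z] YX[of "g z"] 3 ne by (auto simp: g'_def)
          next
            case 2
            then have "g e = z" using g[OF z] by auto
            then show ?thesis using ge 2 ne by auto
          next
            case 3
            then have "g e' = z" using g[OF z] by auto
            then show ?thesis using ge' 3 ne by auto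
          qed
        qed
        then show ?thesis using Xf[of z] YX[of z] YX[OF fz] 3 by auto
      qed
      then show "f z \<noteq> z \<longrightarrow> (f z \<in> Y \<longleftrightarrow> z \<notin> Y)" "g z \<noteq> z \<longrightarrow> (g z \<in> Y \<longleftrightarrow> z \<notin> Y)" by blast+
    qed
  qed auto
qed

definition star :: "('v \<times> 'v) set \<Rightarrow> 'v \<Rightarrow> ('v \<times> 'v) set" where
  "star M v = {e \<in> M. fst e = v \<or> snd e = v}"

definition edge_conn :: "('v \<times> 'v) set \<Rightarrow> 'v \<Rightarrow> 'v \<Rightarrow> bool" where
  "edge_conn H = (\<lambda>u v. (u, v) \<in> H \<or> (v, u) \<in> H)\<^sup>*\<^sup>*"

lemma edge_conn_refl [simp]: "edge_conn H u u"
  by (simp add: edge_conn_def)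

lemma edge_conn_sym: "edge_conn H u v \<Longrightarrow> edge_conn H v u"
  unfolding edge_conn_def by (rule sympD[OF symp_rtranclp]) (auto simp: symp_def)

lemma edge_conn_trans: "edge_conn H u v \<Longrightarrow> edge_conn H v w \<Longrightarrow> edge_conn H u w"
  unfolding edge_conn_def by (rule rtranclp_trans)

lemma edge_conn_edge: "e \<in> H \<Longrightarrow> edge_conn H (fst e) (snd e)"
  unfolding edge_conn_def by (rule r_into_rtranclp) auto

lemma edge_conn_fst_iff_snd: "e \<in> H \<Longrightarrow> edge_conn H u (fst e) \<longleftrightarrow> edge_conn H u (snd e)"
  using edge_conn_edge edge_conn_sym edge_conn_trans by metis

lemma edge_conn_closed:
  assumes "edge_conn H u v" "u \<in> C" "\<And>e. e \<in> H \<Longrightarrow> fst e \<in> C \<longleftrightarrow> snd e \<in> C"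
  shows "v \<in> C"
  using assms(1,2) unfolding edge_conn_def
  by (induction rule: rtranclp_induct) (use assms(3) in auto)

lemma edge_conn_end:
  assumes "edge_conn H u v" "u \<noteq> v"
  shows "\<exists>e\<in>H. fst e = v \<or> snd e = v"
  using assms unfolding edge_conn_def by (cases rule: rtranclp.cases) force+

text \<open>Breadth-first tree: every vertex other than \<open>a\<close> chooses an edge to a vertex
  closer to \<open>a\<close>. The choice is injective, since two vertices sharing an edge would each
  be closer than the other.\<close>

lemma card_component_le:
  assumes "finite H"
  shows "finite {v. edge_conn H a v} \<and>
    card {v. edge_conn H a v} \<le> Suc (card {e \<in> H. edge_conn H a (fst e)})"
proof -
  let ?adj = "\<lambda>u v. (u, v) \<in> H \<or> (v, u) \<in> H"
  let ?C = "{v. edge_conn H a v}"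
  define d where "d v = (LEAST k. (?adj ^^ k) a v)" for v
  have "\<exists>u. ?adj u v \<and> edge_conn H a u \<and> d u < d v" if v: "v \<in> ?C - {a}" for v
  proof -
    have "\<exists>k. (?adj ^^ k) a v" using v unfolding edge_conn_def by (auto simp: rtranclp_power)
    then have k: "(?adj ^^ d v) a v" unfolding d_def by (rule LeastI_ex)
    have "d v \<noteq> 0" using k v by (auto intro!: Nat.gr0I)
    then obtain k' where k': "d v = Suc k'" by (cases "d v") auto
    then obtain u where u: "(?adj ^^ k') a u" "?adj u v" using k by auto
    moreover have "d u \<le> k'" unfolding d_def using u(1) by (rule Least_le)
    moreover have "edge_conn H a u" unfolding edge_conn_def using u(1) by (rule relpowp_imp_rtranclp)
    ultimately show ?thesis using k' by (intro exI[of _ u]) auto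
  qed
  then obtain p where p: "\<And>v. v \<in> ?C - {a} \<Longrightarrow> ?adj (p v) v \<and> edge_conn H a (p v) \<and> d (p v) < d v" by metis
  define e where "e v = (if (p v, v) \<in> H then (p v, v) else (v, p v))" for v
  have eH: "e ` (?C - {a}) \<subseteq> {e \<in> H. edge_conn H a (fst e)}" using p by (auto simp: e_def)
  have inj: "inj_on e (?C - {a})"
  proof (rule inj_onI)
    fix v w assume v: "v \<in> ?C - {a}" and w: "w \<in> ?C - {a}" and eq: "e v = e w"
    show "v = w"
    proof (rule ccontr)
      assume "v \<noteq> w"
      then have "p v = w" "p w = v" using eq by (auto simp: e_def split: if_splits)
      then show False using p[OF v] p[OF w] by auto
    qed
  qed
  have fin: "finite {e \<in> H. edge_conn H a (fst e)}" using assms by simp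
  have f: "finite (?C - {a})" using finite_imageD[OF finite_subset[OF eH fin] inj] .
  have "card (?C - {a}) \<le> card {e \<in> H. edge_conn H a (fst e)}"
    using card_inj_on_le[OF inj eH fin] .
  moreover have C: "?C = insert a (?C - {a})" by auto
  moreover have "finite ?C" by (subst C) (use f in simp)
  moreover have "card ?C = Suc (card (?C - {a}))" by (subst C, rule card_insert_disjoint) (use f in auto)
  ultimately show ?thesis by linarith
qed

lemma star_subset: "M \<subseteq> M' \<Longrightarrow> star M v \<subseteq> star M' v"
  by (auto simp: star_def)

lemma star_subset_self: "star M v \<subseteq> M"
  by (auto simp: star_def)

locale bipartite_graph =
  fixes V1 V2 :: "'v set" and E :: "('v \<times> 'v) set"
  assumes fin1: "finite V1" and fin2: "finite V2" and disj: "V1 \<inter> V2 = {}" and EV: "E \<subseteq> V1 \<times> V2"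
begin

lemma finE: "finite E"
  by (rule finite_subset[OF EV]) (simp add: fin1 fin2)

lemma fin_sub: "H \<subseteq> E \<Longrightarrow> finite H"
  by (rule finite_subset[OF _ finE])

lemma fin_star: "H \<subseteq> E \<Longrightarrow> finite (star H v)"
  by (rule finite_subset[OF star_subset_self]) (rule fin_sub)

lemma edge_ends:
  assumes "e \<in> E"
  shows "fst e \<in> V1" "snd e \<in> V2" "fst e \<notin> V2" "snd e \<notin> V1"
proof -
  have "e \<in> V1 \<times> V2" using EV assms by (rule subsetD)
  then show "fst e \<in> V1" "snd e \<in> V2" by (auto simp: mem_Times_iff)
  then show "fst e \<notin> V2" "snd e \<notin> V1" using disj by (metis IntI empty_iff)+
qed

lemma star_V1:
  assumes "Y \<subseteq> E" "v \<in> V1"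
  shows "star Y v = {e \<in> Y. fst e = v}"
proof -
  have "snd e \<noteq> v" if "e \<in> Y" for e using edge_ends(4)[of e] that assms by (metis subsetD)
  then show ?thesis by (auto simp: star_def)
qed

lemma star_V2:
  assumes "Y \<subseteq> E" "v \<in> V2"
  shows "star Y v = {e \<in> Y. snd e = v}"
proof -
  have "fst e \<noteq> v" if "e \<in> Y" for e using edge_ends(3)[of e] that assms by (metis subsetD)
  then show ?thesis by (auto simp: star_def)
qed

lemma star_outside:
  assumes "Y \<subseteq> E" "v \<notin> V1 \<union> V2"
  shows "star Y v = {}"
proof -
  have "fst e \<noteq> v \<and> snd e \<noteq> v" if "e \<in> Y" for e
    using edge_ends(1,2)[of e] that assms by (metis UnCI subsetD)
  then show ?thesis by (auto simp: star_def)
qed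

lemma sum_star_V1:
  assumes Y: "Y \<subseteq> E"
  shows "(\<Sum>v\<in>C \<inter> V1. card (star Y v)) = card {e \<in> Y. fst e \<in> C}"
proof -
  have "fst e \<in> V1" if "e \<in> Y" for e using edge_ends(1) subsetD[OF Y that] by blast
  then have "{e \<in> Y. fst e \<in> C} = (\<Union>v\<in>C \<inter> V1. {e \<in> Y. fst e = v})" by blast
  then have "card {e \<in> Y. fst e \<in> C} = card (\<Union>v\<in>C \<inter> V1. {e \<in> Y. fst e = v})"
    by (rule arg_cong[where f = card])
  also have "\<dots> = (\<Sum>v\<in>C \<inter> V1. card {e \<in> Y. fst e = v})"
    by (rule card_UN_disjoint) (use fin1 fin_sub[OF Y] in auto)
  also have "\<dots> = (\<Sum>v\<in>C \<inter> V1. card (star Y v))"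
    by (rule sum.cong) (use star_V1[OF Y] in auto)
  finally show ?thesis ..
qed

lemma sum_star_V2:
  assumes Y: "Y \<subseteq> E"
  shows "(\<Sum>v\<in>C \<inter> V2. card (star Y v)) = card {e \<in> Y. snd e \<in> C}"
proof -
  have "snd e \<in> V2" if "e \<in> Y" for e using edge_ends(2) subsetD[OF Y that] by blast
  then have "{e \<in> Y. snd e \<in> C} = (\<Union>v\<in>C \<inter> V2. {e \<in> Y. snd e = v})" by blast
  then have "card {e \<in> Y. snd e \<in> C} = card (\<Union>v\<in>C \<inter> V2. {e \<in> Y. snd e = v})"
    by (rule arg_cong[where f = card])
  also have "\<dots> = (\<Sum>v\<in>C \<inter> V2. card {e \<in> Y. snd e = v})"
    by (rule card_UN_disjoint) (use fin2 fin_sub[OF Y] in auto)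
  also have "\<dots> = (\<Sum>v\<in>C \<inter> V2. card (star Y v))"
    by (rule sum.cong) (use star_V2[OF Y] in auto)
  finally show ?thesis ..
qed

lemma sum_star_component:
  assumes "Y \<subseteq> H" "H \<subseteq> E" "\<And>e. e \<in> H \<Longrightarrow> fst e \<in> C \<longleftrightarrow> snd e \<in> C"
  shows "(\<Sum>v\<in>C \<inter> V1. card (star Y v)) = (\<Sum>v\<in>C \<inter> V2. card (star Y v))"
proof -
  have "{e \<in> Y. fst e \<in> C} = {e \<in> Y. snd e \<in> C}" using assms(1,3) by auto
  with assms(1,2) show ?thesis by (simp add: sum_star_V1 sum_star_V2)
qed

text \<open>
  A connected component with \<open>v\<close> vertices has at least \<open>v - 1\<close> edges, so at most two of its vertices have degree one;
  bipartiteness makes their number even.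
\<close>
lemma component_two_ends:
  assumes H: "H \<subseteq> E" and le2: "\<And>v. card (star H v) \<le> 2" and a: "card (star H a) = 1"
  shows "\<exists>b. b \<noteq> a \<and> {v. edge_conn H a v \<and> card (star H v) = 1} = {a, b}"
proof -
  define C where "C = {v. edge_conn H a v}"
  define S where "S = {v \<in> C. card (star H v) = 1}"
  have finC: "finite C" and cardC: "card C \<le> Suc (card {e \<in> H. fst e \<in> C})"
    using card_component_le[OF fin_sub[OF H], of a] by (simp_all add: C_def)
  have closed: "fst e \<in> C \<longleftrightarrow> snd e \<in> C" if "e \<in> H" for e
    using edge_conn_fst_iff_snd[OF that] by (simp add: C_def)
  have pos: "card (star H v) = 1 \<or> card (star H v) = 2" if "v \<in> C" for v
  proof (cases "v = a")
    case False
    then have "star H v \<noteq> {}" using edge_conn_end[of H a v] that unfolding C_def star_def by blast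
    then have "card (star H v) \<noteq> 0" using fin_star[OF H] by auto
    then show ?thesis using le2[of v] by linarith
  qed (use a in simp)
  have CV: "C \<subseteq> V1 \<union> V2" using pos star_outside[OF H] by fastforce
  have count: "(\<Sum>v\<in>C \<inter> W. card (star H v)) + card (S \<inter> W) = 2 * card (C \<inter> W)" for W
  proof -
    have "card (S \<inter> W) = (\<Sum>v\<in>C \<inter> W. if card (star H v) = 1 then 1 else 0)"
      using finC by (auto simp: S_def sum.If_cases intro!: arg_cong[where f = card])
    then have "(\<Sum>v\<in>C \<inter> W. card (star H v)) + card (S \<inter> W) =
        (\<Sum>v\<in>C \<inter> W. card (star H v) + (if card (star H v) = 1 then 1 else 0))"
      by (simp add: sum.distrib)
    also have "\<dots> = (\<Sum>v\<in>C \<inter> W. 2)" by (rule sum.cong) (use pos in auto)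
    finally show ?thesis by simp
  qed
  have e1: "(\<Sum>v\<in>C \<inter> V1. card (star H v)) = card {e \<in> H. fst e \<in> C}"
    using sum_star_V1[OF H] .
  have e2: "(\<Sum>v\<in>C \<inter> V2. card (star H v)) = card {e \<in> H. fst e \<in> C}"
    using sum_star_component[of H H C] H closed e1 by simp
  have cC: "card C = card (C \<inter> V1) + card (C \<inter> V2)"
    using CV disj finC by (subst card_Un_disjoint[symmetric]) (auto intro: arg_cong[where f = card])
  have "S \<subseteq> V1 \<union> V2" using CV by (auto simp: S_def)
  then have cS: "card S = card (S \<inter> V1) + card (S \<inter> V2)"
    using disj finC by (subst card_Un_disjoint[symmetric]) (auto simp: S_def intro: arg_cong[where f = card])
  have aS: "a \<in> S" using a by (simp add: S_def C_def)
  have "card S \<noteq> 0" using aS finC by (auto simp: S_def)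
  moreover have "2 * card {e \<in> H. fst e \<in> C} + card S = 2 * card C"
    using count[of V1] count[of V2] e1 e2 cC cS by linarith
  ultimately have "card S = 2"
    using cardC by presburger
  then obtain b where "b \<noteq> a" "S = {a, b}" using aS
    by (metis card_2_iff insertE insert_commute singletonD)
  then show ?thesis by (auto simp: S_def C_def)
qed

text \<open>When all degrees are at most two, \<open>X\<close> and \<open>H - X\<close> alternate
  along every path and cycle of \<open>H\<close>.\<close>

definition two_coloring :: "('v \<times> 'v) set \<Rightarrow> ('v \<times> 'v) set \<Rightarrow> bool" where
  "two_coloring H X \<longleftrightarrow> X \<subseteq> H \<and> (\<forall>v. card (star H v) = 2 \<longrightarrow> card (star X v) = 1)"

text \<open>The two involutions on edges exchange the edges at a common black vertex and at a common
  white vertex; an edge that is alone at its vertex is fixed.\<close>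

lemma two_coloring_exists:
  assumes H: "H \<subseteq> E" and le2: "\<And>v. card (star H v) \<le> 2"
  shows "\<exists>X. two_coloring H X"
proof -
  have other: "\<exists>f. \<forall>e\<in>H. f e \<in> H \<and> f (f e) = e \<and> p (f e) = p e \<and> (\<forall>e'\<in>H. p e' = p e \<longrightarrow> e' \<noteq> e \<longrightarrow> f e = e')"
    if p: "\<And>e. e \<in> H \<Longrightarrow> {e' \<in> H. p e' = p e} = star H (p e)" for p :: "'v \<times> 'v \<Rightarrow> 'v"
  proof -
    define f where "f e = (if \<exists>e'\<in>H. e' \<noteq> e \<and> p e' = p e then SOME e'. e' \<in> H \<and> e' \<noteq> e \<and> p e' = p e else e)" for e
    have uniq: "e1 = e2" if "e \<in> H" "e1 \<in> H" "e2 \<in> H" "p e1 = p e" "p e2 = p e" "e1 \<noteq> e" "e2 \<noteq> e" for e e1 e2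
    proof (rule ccontr)
      assume "e1 \<noteq> e2"
      then have "card {e, e1, e2} = 3" using that by auto
      moreover have "card {e, e1, e2} \<le> card (star H (p e))"
        unfolding p[OF that(1), symmetric]
        by (rule card_mono) (use fin_sub[OF H] that in auto)
      ultimately show False using le2[of "p e"] by simp
    qed
    have f1: "f e \<in> H \<and> p (f e) = p e \<and> f e \<noteq> e" if "e' \<in> H" "e' \<noteq> e" "p e' = p e" for e e'
    proof -
      have "\<exists>e'\<in>H. e' \<noteq> e \<and> p e' = p e" using that by blast
      moreover from this have "\<exists>e'. e' \<in> H \<and> e' \<noteq> e \<and> p e' = p e" by blast
      from someI_ex[OF this] have "(SOME e'. e' \<in> H \<and> e' \<noteq> e \<and> p e' = p e) \<in> H \<and>
        (SOME e'. e' \<in> H \<and> e' \<noteq> e \<and> p e' = p e) \<noteq> e \<and> p (SOME e'. e' \<in> H \<and> e' \<noteq> e \<and> p e' = p e) = p e" .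
      ultimately show ?thesis by (simp add: f_def)
    qed
    have f2: "f e = e" if "\<not> (\<exists>e'\<in>H. e' \<noteq> e \<and> p e' = p e)" for e
      using that by (auto simp: f_def)
    show ?thesis
    proof (intro exI[of _ f] ballI)
      fix e assume e: "e \<in> H"
      show "f e \<in> H \<and> f (f e) = e \<and> p (f e) = p e \<and> (\<forall>e'\<in>H. p e' = p e \<longrightarrow> e' \<noteq> e \<longrightarrow> f e = e')"
      proof (cases "\<exists>e'\<in>H. e' \<noteq> e \<and> p e' = p e")
        case True
        then obtain e' where e': "e' \<in> H" "e' \<noteq> e" "p e' = p e" by blast
        have a: "f e \<in> H" "p (f e) = p e" "f e \<noteq> e" using f1[OF e'] by auto
        have b: "f (f e) \<in> H" "p (f (f e)) = p (f e)" "f (f e) \<noteq> f e" using f1[of e "f e"] a e by auto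
        have "f (f e) = e" by (rule uniq[OF a(1) b(1) e b(2) a(2)[symmetric] b(3) a(3)[symmetric]])
        moreover have "f e = e1" if "e1 \<in> H" "p e1 = p e" "e1 \<noteq> e" for e1
          by (rule uniq[OF e a(1) that(1) a(2) that(2) a(3) that(3)])
        ultimately show ?thesis using a by blast
      next
        case False
        then show ?thesis using e f2[OF False] by auto
      qed
    qed
  qed
  have 1: "{e' \<in> H. fst e' = fst e} = star H (fst e)" if "e \<in> H" for e
    using star_V1[OF H, of "fst e"] edge_ends(1)[of e] that H by auto
  have 2: "{e' \<in> H. snd e' = snd e} = star H (snd e)" if "e \<in> H" for e
    using star_V2[OF H, of "snd e"] edge_ends(2)[of e] that H by auto
  obtain f where f: "\<And>e. e \<in> H \<Longrightarrow> f e \<in> H \<and> f (f e) = e"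
    "\<And>e e'. e \<in> H \<Longrightarrow> e' \<in> H \<Longrightarrow> fst e' = fst e \<Longrightarrow> e' \<noteq> e \<Longrightarrow> f e = e'"
    using other[of fst, OF 1] by metis
  obtain g where g: "\<And>e. e \<in> H \<Longrightarrow> g e \<in> H \<and> g (g e) = e"
    "\<And>e e'. e \<in> H \<Longrightarrow> e' \<in> H \<Longrightarrow> snd e' = snd e \<Longrightarrow> e' \<noteq> e \<Longrightarrow> g e = e'"
    using other[of snd, OF 2] by metis
  obtain X where X: "X \<subseteq> H" "\<And>e. e \<in> H \<Longrightarrow> (f e \<noteq> e \<longrightarrow> (f e \<in> X \<longleftrightarrow> e \<notin> X)) \<and> (g e \<noteq> e \<longrightarrow> (g e \<in> X \<longleftrightarrow> e \<notin> X))"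
    using two_involutions_coloring[OF fin_sub[OF H] f(1) g(1)] by metis
  have "card (star X v) = 1" if v: "card (star H v) = 2" for v
  proof -
    obtain e e' where ee: "star H v = {e, e'}" "e \<noteq> e'" using v by (auto simp: card_2_iff)
    then have eH: "e \<in> H" "e' \<in> H" by (auto simp: star_def)
    have "v \<in> V1 \<union> V2" using v star_outside[OF H, of v] by (metis card.empty zero_neq_numeral)
    then have "e' \<in> X \<longleftrightarrow> e \<notin> X"
    proof
      assume "v \<in> V1"
      then have "fst e = v" "fst e' = v" using ee star_V1[OF H, of v] by auto
      then show ?thesis using f(2)[OF eH] X(2)[OF eH(1)] ee by auto
    next
      assume "v \<in> V2"
      then have "snd e = v" "snd e' = v" using ee star_V2[OF H, of v] by auto
      then show ?thesis using g(2)[OF eH] X(2)[OF eH(1)] ee by auto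
    qed
    moreover have "star X v = star H v \<inter> X" using X(1) by (auto simp: star_def)
    ultimately have "star X v = (if e \<in> X then {e} else {e'})" using ee by auto
    then show ?thesis by simp
  qed
  then show ?thesis using X(1) unfolding two_coloring_def by blast
qed

text \<open>Every edge has one black and one white end, so within a component the sum of
  \<open>d\<close>, the degree in \<open>X\<close> minus the degree in \<open>H - X\<close>, is the
  same over black and over white vertices. Inner vertices of the path contribute 0 and its ends
  contribute 1 or -1.\<close>

lemma two_coloring_ends:
  assumes H: "H \<subseteq> E" and le2: "\<And>v. card (star H v) \<le> 2" and X: "two_coloring H X"
    and ab: "a \<noteq> b" "edge_conn H a b" "card (star H a) = 1" "card (star H b) = 1"
  shows "(card (star X a) = 1 \<longleftrightarrow> a \<in> V2) \<noteq> (card (star X b) = 1 \<longleftrightarrow> b \<in> V2)"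
proof -
  define C where "C = {v. edge_conn H a v}"
  define Y where "Y = H - X"
  have XH: "X \<subseteq> H" and X1: "\<And>v. card (star H v) = 2 \<Longrightarrow> card (star X v) = 1"
    using X by (auto simp: two_coloring_def)
  have finC: "finite C" using card_component_le[OF fin_sub[OF H], of a] by (simp add: C_def)
  have closed: "fst e \<in> C \<longleftrightarrow> snd e \<in> C" if "e \<in> H" for e
    using edge_conn_fst_iff_snd[OF that] by (simp add: C_def)
  obtain b' where "b' \<noteq> a" and b': "{v. edge_conn H a v \<and> card (star H v) = 1} = {a, b'}"
    using component_two_ends[OF H le2 ab(3)] by blast
  have "b' = b" using b' ab by auto
  then have ends: "{v \<in> C. card (star H v) = 1} = {a, b}" using b' by (simp add: C_def)
  have sp: "card (star H v) = card (star X v) + card (star Y v)" for v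
  proof -
    have "star H v = star X v \<union> star Y v" using XH by (auto simp: star_def Y_def)
    moreover have "star X v \<inter> star Y v = {}" by (auto simp: star_def Y_def)
    ultimately show ?thesis using fin_star[of X] fin_star[of Y] XH H by (metis Y_def Diff_subset card_Un_disjoint subset_trans)
  qed
  define d where "d v = int (card (star X v)) - int (card (star Y v))" for v
  have d0: "d v = 0" if "v \<in> C" "v \<notin> {a, b}" for v
  proof -
    have "card (star H v) \<noteq> 1" using that ends by blast
    then have "card (star H v) = 0 \<or> card (star H v) = 2" using le2[of v] by linarith
    then show ?thesis using sp[of v] X1[of v] by (auto simp: d_def)
  qed
  have d1: "d v = (if card (star X v) = 1 then 1 else -1)" if "v \<in> {a, b}" for v
    using sp[of v] that ab by (auto simp: d_def)
  have eq: "(\<Sum>v\<in>C \<inter> V1. d v) = (\<Sum>v\<in>C \<inter> V2. d v)"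
    using sum_star_component[of X H C] sum_star_component[of Y H C] XH H closed
    unfolding d_def sum_subtractf of_nat_sum[symmetric] by (auto simp: Y_def)
  have abC: "a \<in> C" "b \<in> C" using ends by auto
  have "v \<in> V1 \<union> V2" if "v \<in> {a, b}" for v
    using star_outside[OF H, of v] that ab by force
  then have abV: "a \<in> V1 \<union> V2" "b \<in> V1 \<union> V2" by auto
  have red: "(\<Sum>v\<in>C \<inter> W. d v) = (if a \<in> W then d a else 0) + (if b \<in> W then d b else 0)" for W
  proof -
    have "(\<Sum>v\<in>C \<inter> W. d v) = (\<Sum>v\<in>{a, b} \<inter> W. d v)"
      by (rule sum.mono_neutral_right) (use finC abC d0 in auto)
    then show ?thesis using ab(1) by (auto simp: Int_insert_left)
  qed
  have "a \<in> V2 \<longleftrightarrow> a \<notin> V1" "b \<in> V2 \<longleftrightarrow> b \<notin> V1" using abV disj by auto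
  then show ?thesis using eq d1[of a] d1[of b] unfolding red
    by (cases "a \<in> V1"; cases "b \<in> V1"; cases "card (star X a) = 1"; cases "card (star X b) = 1") simp_all
qed

end

lemma edge_conn_component_eq: "edge_conn H u v \<Longrightarrow> Collect (edge_conn H u) = Collect (edge_conn H v)"
  by (rule Set.set_eqI) (metis edge_conn_sym edge_conn_trans mem_Collect_eq)

context bipartite_graph
begin

text \<open>For a node, \<open>a \<in> U \<longleftrightarrow> a \<in> V2\<close> expresses that its
  label belongs to the index set when \<open>U\<close> is the set of vertices covered by the first
  matching. So each path must lead from the index set to its complement.\<close>

definition compatible :: "('v \<times> 'v) set \<Rightarrow> 'v set \<Rightarrow> bool" where
  "compatible H U \<longleftrightarrow> (\<forall>a b. a \<noteq> b \<and> edge_conn H a b \<and> card (star H a) = 1 \<and> card (star H b) = 1 \<longrightarrow>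
     (a \<in> U \<longleftrightarrow> a \<in> V2) \<noteq> (b \<in> U \<longleftrightarrow> b \<in> V2))"

text \<open>The possible intersections of \<open>H\<close> with the first of two superposed
  matchings, where \<open>U\<close> is the set of vertices it covers.\<close>

definition splittings :: "('v \<times> 'v) set \<Rightarrow> 'v set \<Rightarrow> ('v \<times> 'v) set set" where
  "splittings H U = {X. two_coloring H X \<and> (\<forall>v. card (star H v) = 1 \<longrightarrow> (card (star X v) = 1 \<longleftrightarrow> v \<in> U))}"

definition loops :: "('v \<times> 'v) set \<Rightarrow> 'v set set" where
  "loops H = {Collect (edge_conn H u) | u. (\<exists>v. (u, v) \<in> H \<or> (v, u) \<in> H) \<and>
     (\<forall>s. card (star H s) = 1 \<longrightarrow> \<not> edge_conn H u s)}"

text \<open>Exchanges the two matchings on the components inside \<open>B\<close>; it is used for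
  unions \<open>B\<close> of components, where testing one end of an edge is enough.\<close>

definition flip_on :: "('v \<times> 'v) set \<Rightarrow> 'v set \<Rightarrow> ('v \<times> 'v) set \<Rightarrow> ('v \<times> 'v) set" where
  "flip_on H B X = {e \<in> H. (e \<in> X) \<noteq> (fst e \<in> B)}"

lemma star_flip_on:
  assumes "X \<subseteq> H" "\<And>e. e \<in> H \<Longrightarrow> fst e \<in> B \<longleftrightarrow> snd e \<in> B"
  shows "star (flip_on H B X) v = (if v \<in> B then star H v - star X v else star X v)"
  using assms by (auto simp: star_def flip_on_def)

lemma card_star_flip_on:
  assumes H: "H \<subseteq> E" and X: "X \<subseteq> H" "\<And>e. e \<in> H \<Longrightarrow> fst e \<in> B \<longleftrightarrow> snd e \<in> B"
  shows "card (star (flip_on H B X) v) =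
    (if v \<in> B then card (star H v) - card (star X v) else card (star X v))"
proof -
  have "star (flip_on H B X) v = (if v \<in> B then star H v - star X v else star X v)"
    by (rule star_flip_on) (use X in auto)
  then show ?thesis
    using card_Diff_subset[OF finite_subset[OF star_subset[OF X(1)] fin_star[OF H]] star_subset[OF X(1)]] by simp
qed

lemma card_star_mono:
  assumes "H \<subseteq> E" "X \<subseteq> H"
  shows "card (star X v) \<le> card (star H v)"
  by (rule card_mono[OF fin_star[OF assms(1)] star_subset[OF assms(2)]])

lemma flip_on_two_coloring:
  assumes H: "H \<subseteq> E" and X: "two_coloring H X" and B: "\<And>e. e \<in> H \<Longrightarrow> fst e \<in> B \<longleftrightarrow> snd e \<in> B"
  shows "two_coloring H (flip_on H B X)"
    and "card (star H v) = 1 \<Longrightarrow> card (star (flip_on H B X) v) = 1 \<longleftrightarrow> (card (star X v) = 1) \<noteq> (v \<in> B)"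
proof -
  have XH: "X \<subseteq> H" using X by (simp add: two_coloring_def)
  have c: "card (star (flip_on H B X) v) = (if v \<in> B then card (star H v) - card (star X v) else card (star X v))" for v
    by (rule card_star_flip_on) (use H XH B in auto)
  have "flip_on H B X \<subseteq> H" by (auto simp: flip_on_def)
  then show "two_coloring H (flip_on H B X)"
    using X unfolding two_coloring_def c by simp
  show "card (star (flip_on H B X) v) = 1 \<longleftrightarrow> (card (star X v) = 1) \<noteq> (v \<in> B)" if "card (star H v) = 1"
    using card_star_mono[OF H XH, of v] that unfolding c by auto
qed

text \<open>Start from any alternating colouring and flip it on the components having an end that
  disagrees with \<open>U\<close>. By \<open>two_coloring_ends\<close> and compatibility the two
  ends of a path disagree together, so one flip repairs both.\<close>

lemma splittings_nonempty:
  assumes H: "H \<subseteq> E" and le2: "\<And>v. card (star H v) \<le> 2" and c: "compatible H U"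
  shows "splittings H U \<noteq> {}"
proof -
  obtain X where X: "two_coloring H X" using two_coloring_exists[OF H le2] by blast
  define B where "B = {v. \<exists>s. edge_conn H s v \<and> card (star H s) = 1 \<and> (card (star X s) = 1) \<noteq> (s \<in> U)}"
  have cl: "fst e \<in> B \<longleftrightarrow> snd e \<in> B" if "e \<in> H" for e
    unfolding B_def using edge_conn_fst_iff_snd[OF that] by auto
  have B: "v \<in> B \<longleftrightarrow> (card (star X v) = 1) \<noteq> (v \<in> U)" if v: "card (star H v) = 1" for v
  proof
    assume "v \<in> B"
    then obtain s where s: "edge_conn H s v" "card (star H s) = 1" "(card (star X s) = 1) \<noteq> (s \<in> U)"
      by (auto simp: B_def)
    show "(card (star X v) = 1) \<noteq> (v \<in> U)"
    proof (cases "s = v")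
      case False
      have "(s \<in> U \<longleftrightarrow> s \<in> V2) \<noteq> (v \<in> U \<longleftrightarrow> v \<in> V2)"
        using c False s v unfolding compatible_def by blast
      with two_coloring_ends[OF H le2 X False s(1,2) v] s(3) show ?thesis by blast
    qed (use s in simp)
  next
    assume "(card (star X v) = 1) \<noteq> (v \<in> U)"
    then show "v \<in> B" using v unfolding B_def by (auto intro!: exI[of _ v])
  qed
  have "flip_on H B X \<in> splittings H U"
    unfolding splittings_def using flip_on_two_coloring[OF H X cl] B by blast
  then show ?thesis by blast
qed

lemma splittings_imp_compatible:
  assumes H: "H \<subseteq> E" and le2: "\<And>v. card (star H v) \<le> 2" and X: "X \<in> splittings H U"
  shows "compatible H U"
  unfolding compatible_def
proof (intro allI impI, elim conjE)
  fix a b assume ab: "a \<noteq> b" "edge_conn H a b" "card (star H a) = 1" "card (star H b) = 1"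
  have X': "two_coloring H X" "card (star X a) = 1 \<longleftrightarrow> a \<in> U" "card (star X b) = 1 \<longleftrightarrow> b \<in> U"
    using X ab unfolding splittings_def by auto
  show "(a \<in> U \<longleftrightarrow> a \<in> V2) \<noteq> (b \<in> U \<longleftrightarrow> b \<in> V2)"
    using two_coloring_ends[OF H le2 X'(1) ab] X'(2,3) by simp
qed

text \<open>At a vertex of degree two each splitting contains exactly one of the two edges, so a
  difference at one edge forces a difference at the other and spreads through the whole
  component.\<close>

lemma splittings_difference_closed:
  assumes H: "H \<subseteq> E" and le2: "\<And>v. card (star H v) \<le> 2"
    and X: "X \<in> splittings H U" and Z: "Z \<in> splittings H U"
    and e: "e \<in> H" "(e \<in> X) \<noteq> (e \<in> Z)" and e': "e' \<in> H" and u: "edge_conn H (fst e) u" "fst e' = u \<or> snd e' = u"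
  shows "(e' \<in> X) \<noteq> (e' \<in> Z)"
proof -
  have XH: "X \<subseteq> H" "Z \<subseteq> H" using X Z by (auto simp: splittings_def two_coloring_def)
  have one: "card (star X v) = 1" "card (star Z v) = 1" if "card (star H v) = 2" for v
    using X Z that by (auto simp: splittings_def two_coloring_def)
  have step: "(c' \<in> X) \<noteq> (c' \<in> Z)"
    if c: "c \<in> H" "(c \<in> X) \<noteq> (c \<in> Z)" "fst c = v \<or> snd c = v" and c': "c' \<in> H" "fst c' = v \<or> snd c' = v" for c c' v
  proof (cases "c = c'")
    case False
    have sub: "{c, c'} \<subseteq> star H v" using c c' by (auto simp: star_def)
    have "card {c, c'} = 2" using False by simp
    then have eq: "star H v = {c, c'}"
      using card_seteq[OF fin_star[OF H] sub] le2[of v] by simp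
    then have "card (star H v) = 2" using False by simp
    from one[OF this] have "card (star X v) = 1" "card (star Z v) = 1" by auto
    moreover have "star X v = {c, c'} \<inter> X" "star Z v = {c, c'} \<inter> Z"
      using XH eq by (auto simp: star_def)
    ultimately show ?thesis using False c by (auto simp: card_1_singleton_iff Int_insert_left split: if_splits)
  qed (use c in simp)
  let ?C = "{u. \<forall>e'\<in>H. (fst e' = u \<or> snd e' = u) \<longrightarrow> (e' \<in> X) \<noteq> (e' \<in> Z)}"
  have "u \<in> ?C"
  proof (rule edge_conn_closed[OF u(1)])
    show "fst e \<in> ?C" using step[OF e, of "fst e"] by blast
    show "fst c \<in> ?C \<longleftrightarrow> snd c \<in> ?C" if "c \<in> H" for c
    proof
      assume "fst c \<in> ?C"
      then have "(c \<in> X) \<noteq> (c \<in> Z)" using that by blast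
      then show "snd c \<in> ?C" using step[OF that, of "snd c"] by blast
    next
      assume "snd c \<in> ?C"
      then have "(c \<in> X) \<noteq> (c \<in> Z)" using that by blast
      then show "fst c \<in> ?C" using step[OF that, of "fst c"] by blast
    qed
  qed
  then show ?thesis using e' u(2) by blast
qed

text \<open>Two splittings differ by a union of cycles, so their number is a power of two as soon as one exists.\<close>
lemma card_splittings:
  assumes H: "H \<subseteq> E" and le2: "\<And>v. card (star H v) \<le> 2"
  shows "card (splittings H U) = (if compatible H U then 2 ^ card (loops H) else 0)"
proof (cases "compatible H U")
  case False
  then have "splittings H U = {}" using splittings_imp_compatible[OF H le2] by blast
  then show ?thesis using False by simp
next
  case True
  then obtain X where X: "X \<in> splittings H U" using splittings_nonempty[OF H le2] by blast
  then have X2: "two_coloring H X" and XH: "X \<subseteq> H" by (auto simp: splittings_def two_coloring_def)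
  define f where "f \<C> = flip_on H (\<Union>\<C>) X" for \<C>
  define g where "g Z = {C \<in> loops H. \<exists>e\<in>H. fst e \<in> C \<and> (e \<in> X) \<noteq> (e \<in> Z)}" for Z
  have comp: "C = Collect (edge_conn H u)" if "C \<in> loops H" "u \<in> C" for C u
    using that edge_conn_component_eq by (fastforce simp: loops_def)
  have cl: "fst e \<in> \<Union>\<C> \<longleftrightarrow> snd e \<in> \<Union>\<C>" if "e \<in> H" "\<C> \<subseteq> loops H" for e \<C>
  proof -
    have "fst e \<in> C \<longleftrightarrow> snd e \<in> C" if "C \<in> \<C>" for C
    proof -
      have "C \<in> loops H" using that \<open>\<C> \<subseteq> loops H\<close> by blast
      then obtain u where "C = Collect (edge_conn H u)" by (auto simp: loops_def)
      then show ?thesis using edge_conn_fst_iff_snd[OF \<open>e \<in> H\<close>, of u] by simp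
    qed
    then show ?thesis by blast
  qed
  have "bij_betw f (Pow (loops H)) (splittings H U)"
  proof (rule bij_betwI[of _ _ _ g])
    show "f \<in> Pow (loops H) \<rightarrow> splittings H U"
    proof
      fix \<C> assume "\<C> \<in> Pow (loops H)"
      then have C: "\<C> \<subseteq> loops H" by simp
      have no: "v \<notin> \<Union>\<C>" if "card (star H v) = 1" for v
      proof
        assume "v \<in> \<Union>\<C>"
        then obtain D where "D \<in> loops H" "v \<in> D" using C by blast
        then show False using that by (auto simp: loops_def)
      qed
      show "f \<C> \<in> splittings H U"
        using X no flip_on_two_coloring[OF H X2 cl[OF _ C]] unfolding splittings_def f_def by simp
    qed
    show "g \<in> splittings H U \<rightarrow> Pow (loops H)" by (auto simp: g_def)
    show "g (f \<C>) = \<C>" if "\<C> \<in> Pow (loops H)" for \<C>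
    proof -
      have C: "\<C> \<subseteq> loops H" using that by simp
      have f: "(e \<in> X) \<noteq> (e \<in> f \<C>) \<longleftrightarrow> fst e \<in> \<Union>\<C>" if "e \<in> H" for e
        using that by (auto simp: f_def flip_on_def)
      have in_iff: "C \<in> \<C> \<longleftrightarrow> (\<exists>e\<in>H. fst e \<in> C \<and> fst e \<in> \<Union>\<C>)" if CL: "C \<in> loops H" for C
      proof
        assume CC: "C \<in> \<C>"
        obtain u v where u: "C = Collect (edge_conn H u)" "(u, v) \<in> H \<or> (v, u) \<in> H"
          using CL by (auto simp: loops_def)
        from u(2) obtain e where e: "e \<in> H" "fst e = u \<or> snd e = u" by force
        then have "fst e \<in> C" using u(1) edge_conn_fst_iff_snd[OF e(1), of u] by auto
        then show "\<exists>e\<in>H. fst e \<in> C \<and> fst e \<in> \<Union>\<C>" using e CC by blast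
      next
        assume "\<exists>e\<in>H. fst e \<in> C \<and> fst e \<in> \<Union>\<C>"
        then obtain e where "e \<in> H" "fst e \<in> C" "fst e \<in> \<Union>\<C>" by blast
        then obtain D where "fst e \<in> C" "fst e \<in> D" "D \<in> \<C>" by blast
        moreover from this have "D \<in> loops H" using C by blast
        ultimately show "C \<in> \<C>" using comp[OF CL] comp[of D] by metis
      qed
      have "(\<exists>e\<in>H. fst e \<in> C \<and> (e \<in> X) \<noteq> (e \<in> f \<C>)) \<longleftrightarrow> (\<exists>e\<in>H. fst e \<in> C \<and> fst e \<in> \<Union>\<C>)" for C
        by (rule bex_cong[OF refl]) (simp only: f)
      then have "D \<in> g (f \<C>) \<longleftrightarrow> D \<in> loops H \<and> (\<exists>e\<in>H. fst e \<in> D \<and> fst e \<in> \<Union>\<C>)" for D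
        by (simp only: g_def mem_Collect_eq)
      then have "D \<in> g (f \<C>) \<longleftrightarrow> D \<in> loops H \<and> D \<in> \<C>" for D
        using in_iff[of D] by (cases "D \<in> loops H") simp_all
      then show ?thesis using C by blast
    qed
    show "f (g Z) = Z" if Z: "Z \<in> splittings H U" for Z
    proof -
      have ZH: "Z \<subseteq> H" using Z by (auto simp: splittings_def two_coloring_def)
      have flipped: "fst e \<in> \<Union>(g Z) \<longleftrightarrow> (e \<in> X) \<noteq> (e \<in> Z)" if e: "e \<in> H" for e
      proof
        assume "fst e \<in> \<Union>(g Z)"
        then obtain C e' where C: "C \<in> loops H" "fst e \<in> C" "e' \<in> H" "fst e' \<in> C" "(e' \<in> X) \<noteq> (e' \<in> Z)"
          by (auto simp: g_def)
        have "edge_conn H (fst e') (fst e)" using comp[OF C(1,4)] C(2) by auto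
        then show "(e \<in> X) \<noteq> (e \<in> Z)"
          using splittings_difference_closed[OF H le2 X Z C(3,5) e] by blast
      next
        assume d: "(e \<in> X) \<noteq> (e \<in> Z)"
        \<comment> \<open>A difference cannot live on a path: it would reach the edge at an end,
          whose membership in a splitting is prescribed by \<open>U\<close>.\<close>
        have ns: "\<not> edge_conn H (fst e) s" if s: "card (star H s) = 1" for s
        proof
          assume c: "edge_conn H (fst e) s"
          obtain e' where e': "star H s = {e'}" using s by (auto simp: card_1_singleton_iff)
          then have "e' \<in> H" "fst e' = s \<or> snd e' = s" by (auto simp: star_def)
          then have "(e' \<in> X) \<noteq> (e' \<in> Z)"
            using splittings_difference_closed[OF H le2 X Z e d _ c] by blast
          moreover have "star X s = {e'} \<inter> X" "star Z s = {e'} \<inter> Z"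
            using e' XH ZH by (auto simp: star_def)
          moreover have "card (star X s) = 1 \<longleftrightarrow> card (star Z s) = 1"
            using X Z s by (simp add: splittings_def)
          ultimately show False by (auto simp: Int_insert_left split: if_splits)
        qed
        have "Collect (edge_conn H (fst e)) \<in> loops H"
          unfolding loops_def mem_Collect_eq
          by (intro exI[of _ "fst e"] conjI refl exI[of _ "snd e"] disjI1 allI impI) (use e ns in auto)
        then have "Collect (edge_conn H (fst e)) \<in> g Z"
          unfolding g_def mem_Collect_eq by (intro conjI bexI[of _ e] edge_conn_refl d e)
        then show "fst e \<in> \<Union>(g Z)" by (rule UnionI) simp
      qed
      have "e \<in> f (g Z) \<longleftrightarrow> e \<in> Z" for e
      proof (cases "e \<in> H")
        case True
        then show ?thesis unfolding f_def flip_on_def mem_Collect_eq flipped[OF True] by blast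
      next
        case False
        then show ?thesis using ZH unfolding f_def flip_on_def mem_Collect_eq by blast
      qed
      then show ?thesis by (rule Set.set_eqI)
    qed
  qed
  then have "card (splittings H U) = card (Pow (loops H))" by (simp add: bij_betw_same_card)
  moreover have "finite (loops H)"
  proof (rule finite_subset)
    show "loops H \<subseteq> (\<lambda>u. Collect (edge_conn H u)) ` (fst ` H \<union> snd ` H)" by (force simp: loops_def)
  qed (use fin_sub[OF H] in simp)
  ultimately show ?thesis using True by (simp add: card_Pow)
qed

end

text \<open>To be read at one vertex: \<open>h\<close> single and \<open>k\<close> doubled edges,
  while \<open>P\<close> and \<open>Q\<close> tell whether the two matchings cover it.\<close>

lemma add_twice_eq_of_bools:
  fixes h k :: nat
  assumes "h + 2 * k = of_bool P + of_bool Q"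
  shows "h = 1 \<longleftrightarrow> P \<noteq> Q" and "h = 2 \<Longrightarrow> P \<and> Q \<and> k = 0" and "h = 1 \<Longrightarrow> k = 0" and "h = 0 \<Longrightarrow> P \<longleftrightarrow> Q"
    and "h = 0 \<Longrightarrow> k = of_bool P"
proof -
  have "(h = 1 \<longleftrightarrow> P \<noteq> Q) \<and> (h = 2 \<longrightarrow> P \<and> Q \<and> k = 0) \<and> (h = 1 \<longrightarrow> k = 0) \<and>
      (h = 0 \<longrightarrow> (P \<longleftrightarrow> Q) \<and> k = of_bool P)"
    using assms by (cases P; cases Q; simp; presburger)
  then show "h = 1 \<longleftrightarrow> P \<noteq> Q" and "h = 2 \<Longrightarrow> P \<and> Q \<and> k = 0" and "h = 1 \<Longrightarrow> k = 0"
    and "h = 0 \<Longrightarrow> P \<longleftrightarrow> Q" and "h = 0 \<Longrightarrow> k = of_bool P"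
    by blast+
qed

section \<open>Superpositions of two matchings as double-dimer configurations\<close>

definition singles :: "('v \<times> 'v) set \<Rightarrow> (('v \<times> 'v) \<Rightarrow> nat) \<Rightarrow> ('v \<times> 'v) set" where
  "singles E m = {e \<in> E. m e = 1}"

definition doubles :: "('v \<times> 'v) set \<Rightarrow> (('v \<times> 'v) \<Rightarrow> nat) \<Rightarrow> ('v \<times> 'v) set" where
  "doubles E m = {e \<in> E. m e = 2}"

lemma dd_adj_eq: "dd_adj E m = (\<lambda>u v. (u, v) \<in> singles E m \<or> (v, u) \<in> singles E m)"
  by (auto simp: dd_adj_def singles_def fun_eq_iff)

lemma dd_conn_eq: "dd_conn E m = edge_conn (singles E m)"
  by (simp add: dd_conn_def edge_conn_def dd_adj_eq)

lemma (in bipartite_graph) dd_loops_eq: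
  assumes "\<And>s. card (star (singles E m) s) = 1 \<longleftrightarrow> s \<in> S"
  shows "dd_loops E S m = card (loops (singles E m))"
  unfolding dd_loops_def loops_def dd_conn_eq dd_adj_eq assms Ball_def ..

context bipartite_graph
begin

definition matchings :: "'v set \<Rightarrow> ('v \<times> 'v) set set" where
  "matchings U = {M. M \<subseteq> E \<and> (\<forall>v\<in>V1 \<union> V2. card (star M v) = of_bool (v \<in> U))}"

definition dimer_sum :: "(('v \<times> 'v) \<Rightarrow> real) \<Rightarrow> 'v set \<Rightarrow> real" where
  "dimer_sum wt U = (\<Sum>M\<in>matchings U. \<Prod>e\<in>M. wt e)"

definition configs :: "('v \<Rightarrow> nat) \<Rightarrow> (('v \<times> 'v) \<Rightarrow> nat) set" where
  "configs d = {m. (\<forall>e. e \<notin> E \<longrightarrow> m e = 0) \<and> (\<forall>v\<in>V1 \<union> V2. dd_deg E m v = d v)}"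

lemma dd_deg_star: "dd_deg E m v = (\<Sum>e\<in>star E v. m e)"
  unfolding dd_deg_def star_def using finE by (simp add: sum.If_cases Int_def)

lemma card_star_sum: "M \<subseteq> E \<Longrightarrow> card (star M v) = (\<Sum>e\<in>star E v. of_bool (e \<in> M))"
  using fin_star[of E v]
  by (subst sum.mono_neutral_cong_right[of "star E v" "star M v" _ "\<lambda>_. 1"]) (auto simp: star_def)

lemma config_zero: "m \<in> configs d \<Longrightarrow> e \<notin> E \<Longrightarrow> m e = 0"
  by (simp add: configs_def del: split_paired_All)

lemma config_le2:
  assumes "m \<in> configs d" "\<And>v. d v \<le> 2"
  shows "m e \<le> 2"
proof (cases "e \<in> E")
  case True
  have "m e \<le> (\<Sum>e\<in>star E (fst e). m e)"
    by (rule member_le_sum) (use True fin_star[of E "fst e"] in \<open>auto simp: star_def\<close>)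
  also have "\<dots> = d (fst e)"
    using assms(1) edge_ends(1)[OF True] by (auto simp: configs_def dd_deg_star[symmetric])
  finally show ?thesis using assms(2)[of "fst e"] by simp
next
  case False
  then show ?thesis using config_zero[OF assms(1)] by simp
qed

lemma config_star:
  assumes "m \<in> configs d" "\<And>v. d v \<le> 2" "v \<in> V1 \<union> V2"
  shows "card (star (singles E m) v) + 2 * card (star (doubles E m) v) = d v"
proof -
  have "m e = of_bool (e \<in> singles E m) + 2 * of_bool (e \<in> doubles E m)" if "e \<in> star E v" for e
    using config_le2[OF assms(1,2), of e] that by (auto simp: singles_def doubles_def star_def)
  then have "dd_deg E m v = (\<Sum>e\<in>star E v. of_bool (e \<in> singles E m) + 2 * of_bool (e \<in> doubles E m))"
    unfolding dd_deg_star by simp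
  also have "\<dots> = card (star (singles E m) v) + 2 * card (star (doubles E m) v)"
    by (subst (1 2) card_star_sum) (auto simp: singles_def doubles_def sum.distrib sum_distrib_left)
  finally show ?thesis using assms by (auto simp: configs_def)
qed

lemma singles_star_le2:
  assumes "m \<in> configs d" "\<And>v. d v \<le> 2"
  shows "card (star (singles E m) v) \<le> 2"
proof (cases "v \<in> V1 \<union> V2")
  case True
  then show ?thesis using config_star[OF assms True] assms(2)[of v] by linarith
next
  case False
  then show ?thesis using star_outside[of "singles E m" v] by (simp add: singles_def)
qed

lemma finite_configs:
  assumes "\<And>v. d v \<le> 2"
  shows "finite (configs d)"
proof (rule finite_subset)
  show "configs d \<subseteq> {m. \<forall>e. (e \<in> E \<longrightarrow> m e \<in> {..2}) \<and> (e \<notin> E \<longrightarrow> m e = 0)}"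
    using config_le2[of _ d, OF _ assms] config_zero[of _ d] by blast
qed (rule finite_set_of_finite_funs[OF finE], simp)

lemma finite_matchings: "finite (matchings U)"
  by (rule finite_subset[of _ "Pow E"]) (auto simp: matchings_def finE)

text \<open>Doubled edges lie in both matchings and single edges in exactly one, so a pair with
  superposition \<open>m\<close> is determined by the set of single edges in its first
  matching.\<close>

lemma card_matching_pairs:
  fixes U1 U2 :: "'v set"
  defines "d \<equiv> \<lambda>v. of_bool (v \<in> U1) + of_bool (v \<in> U2)"
  assumes m: "m \<in> configs d"
  shows "card {p \<in> matchings U1 \<times> matchings U2. (\<lambda>e. of_bool (e \<in> fst p) + of_bool (e \<in> snd p)) = m} =
    card (splittings (singles E m) U1)"
proof -
  define H D where "H = singles E m" and "D = doubles E m"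
  have d2: "d v \<le> 2" for v by (simp add: d_def)
  have HE: "H \<subseteq> E" and DE: "D \<subseteq> E" and HD: "H \<inter> D = {}" by (auto simp: H_def D_def singles_def doubles_def)
  have deg: "card (star H v) + 2 * card (star D v) = d v" if "v \<in> V1 \<union> V2" for v
    unfolding H_def D_def by (rule config_star[OF m d2 that])
  have m012: "m e = of_bool (e \<in> H) + 2 * of_bool (e \<in> D)" for e
    using config_le2[OF m d2, of e] config_zero[OF m, of e]
    by (cases "e \<in> E") (auto simp: H_def D_def singles_def doubles_def)
  have un: "card (star (X \<union> D) v) = card (star X v) + card (star D v)" if "X \<subseteq> H" for X v
  proof -
    have "star (X \<union> D) v = star X v \<union> star D v" "star X v \<inter> star D v = {}"
      using that HD by (auto simp: star_def)
    then show ?thesis using fin_star[of X v] fin_star[of D v] that HE DE by (simp add: card_Un_disjoint)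
  qed
  have df: "card (star (H - X) v) = card (star H v) - card (star X v)" if "X \<subseteq> H" for X v
  proof -
    have "star (H - X) v = star H v - star X v" by (auto simp: star_def)
    then show ?thesis
      using card_Diff_subset[OF finite_subset[OF star_subset[OF that] fin_star[OF HE]] star_subset[OF that]] by simp
  qed
  have out: "v \<in> V1 \<union> V2" if "card (star H v) \<noteq> 0" for v
    using star_outside[OF HE, of v] that by (metis card.empty)
  have "bij_betw (\<lambda>p. fst p \<inter> H)
      {p \<in> matchings U1 \<times> matchings U2. (\<lambda>e. of_bool (e \<in> fst p) + of_bool (e \<in> snd p)) = m} (splittings H U1)"
  proof (rule bij_betwI[of _ _ _ "\<lambda>X. (X \<union> D, (H - X) \<union> D)"])
    let ?P = "{p \<in> matchings U1 \<times> matchings U2. (\<lambda>e. of_bool (e \<in> fst p) + of_bool (e \<in> snd p)) = m}"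
    have pP: "fst p = (fst p \<inter> H) \<union> D \<and> snd p = (H - fst p) \<union> D" if "p \<in> ?P" for p
    proof -
      have e: "of_bool (e \<in> fst p) + of_bool (e \<in> snd p) = m e" for e using that by (auto dest: fun_cong)
      have "(e \<in> fst p \<longleftrightarrow> e \<in> H \<and> e \<in> fst p \<or> e \<in> D) \<and> (e \<in> snd p \<longleftrightarrow> e \<in> H \<and> e \<notin> fst p \<or> e \<in> D)" for e
        using e[of e] HD unfolding m012[of e] by (auto split: if_splits simp: of_bool_def)
      then show ?thesis by blast
    qed
    show "(\<lambda>p. fst p \<inter> H) \<in> ?P \<rightarrow> splittings H U1"
    proof
      fix p assume p: "p \<in> ?P"
      have M: "card (star (fst p) v) = of_bool (v \<in> U1)" if "v \<in> V1 \<union> V2" for v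
        using p that by (auto simp: matchings_def)
      have c: "card (star (fst p) v) = card (star (fst p \<inter> H) v) + card (star D v)" for v
        using un[of "fst p \<inter> H" v] pP[OF p] by simp
      have "card (star (fst p \<inter> H) v) = 1" if "card (star H v) = 2" for v
        using add_twice_eq_of_bools(2)[OF deg[OF out, of v, unfolded d_def]] M[OF out, of v] c[of v] that by simp
      moreover have "card (star (fst p \<inter> H) v) = 1 \<longleftrightarrow> v \<in> U1" if "card (star H v) = 1" for v
        using add_twice_eq_of_bools(3)[OF deg[OF out, of v, unfolded d_def]] M[OF out, of v] c[of v] that by simp
      ultimately show "fst p \<inter> H \<in> splittings H U1"
        unfolding splittings_def two_coloring_def by blast
    qed
    show "(\<lambda>X. (X \<union> D, (H - X) \<union> D)) \<in> splittings H U1 \<rightarrow> ?P"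
    proof
      fix X assume X: "X \<in> splittings H U1"
      then have XH: "X \<subseteq> H" and X2: "\<And>v. card (star H v) = 2 \<Longrightarrow> card (star X v) = 1"
        and X1: "\<And>v. card (star H v) = 1 \<Longrightarrow> card (star X v) = 1 \<longleftrightarrow> v \<in> U1"
        by (auto simp: splittings_def two_coloring_def)
      have "card (star (X \<union> D) v) = of_bool (v \<in> U1) \<and> card (star ((H - X) \<union> D) v) = of_bool (v \<in> U2)"
        if v: "v \<in> V1 \<union> V2" for v
      proof -
        note b = add_twice_eq_of_bools[OF deg[OF v, unfolded d_def]]
        note eqs = un[OF XH] un[of "H - X"] df[OF XH] card_star_mono[OF HE XH, of v]
        have "card (star H v) \<le> 2" using deg[OF v] d2[of v] by linarith
        then consider "card (star H v) = 2" | "card (star H v) = 1" | "card (star H v) = 0" by linarith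
        then show ?thesis
        proof cases
          case 1
          then show ?thesis using eqs X2[OF 1] b(2) by simp
        next
          case 2
          then show ?thesis using eqs X1[OF 2] b(1,3) by (cases "v \<in> U1") auto
        next
          case 3
          then show ?thesis using eqs b(4,5) by simp
        qed
      qed
      then have "X \<union> D \<in> matchings U1" "(H - X) \<union> D \<in> matchings U2"
        using XH HE DE unfolding matchings_def by auto
      moreover have "(\<lambda>e. of_bool (e \<in> X \<union> D) + of_bool (e \<in> (H - X) \<union> D)) = m"
        using XH HD m012 by (auto simp: fun_eq_iff)
      ultimately show "(X \<union> D, (H - X) \<union> D) \<in> ?P" by simp
    qed
    show "(fst p \<inter> H \<union> D, H - fst p \<inter> H \<union> D) = p" if "p \<in> ?P" for p
    proof -
      have "H - fst p \<inter> H = H - fst p" by blast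
      then show ?thesis using pP[OF that] by (metis prod.collapse)
    qed
    show "fst (X \<union> D, H - X \<union> D) \<inter> H = X" if "X \<in> splittings H U1" for X
      using that HD by (auto simp: splittings_def two_coloring_def)
  qed
  then show ?thesis unfolding H_def by (rule bij_betw_same_card)
qed

lemma singles_star_one:
  fixes U1 U2 :: "'v set"
  assumes m: "m \<in> configs (\<lambda>v. of_bool (v \<in> U1) + of_bool (v \<in> U2))"
  shows "card (star (singles E m) s) = 1 \<longleftrightarrow> s \<in> V1 \<union> V2 \<and> (s \<in> U1) \<noteq> (s \<in> U2)"
proof (cases "s \<in> V1 \<union> V2")
  case True
  then show ?thesis using add_twice_eq_of_bools(1)[OF config_star[OF m _ True]] by simp
next
  case False
  then show ?thesis using star_outside[of "singles E m" s] by (simp add: singles_def)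
qed

text \<open>Group the pairs of matchings by their superposition. A compatible configuration arises
  from \<open>2 ^ card (loops H)\<close> pairs, which is exactly the loop factor of
  \<open>dd_weight\<close>; an incompatible one does not arise.\<close>

theorem dimer_sum_mult:
  fixes U1 U2 :: "'v set"
  defines "d \<equiv> \<lambda>v. of_bool (v \<in> U1) + of_bool (v \<in> U2)"
  assumes S: "S = {v \<in> V1 \<union> V2. (v \<in> U1) \<noteq> (v \<in> U2)}"
  shows "dimer_sum wt U1 * dimer_sum wt U2 =
    (\<Sum>m\<in>configs d. if compatible (singles E m) U1 then dd_weight E wt S m else 0)"
proof -
  have d2: "d v \<le> 2" for v by (simp add: d_def)
  define P where "P = matchings U1 \<times> matchings U2"
  define g where "g p = (\<lambda>e. of_bool (e \<in> fst p) + of_bool (e \<in> snd p) :: nat)" for p :: "('v \<times> 'v) set \<times> ('v \<times> 'v) set"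
  define h where "h p = (\<Prod>e\<in>fst p. wt e) * (\<Prod>e\<in>snd p. wt e)" for p
  have fP: "finite P" by (simp add: P_def finite_matchings)
  have gP: "g ` P \<subseteq> configs d"
  proof
    fix m assume "m \<in> g ` P"
    then obtain p where p: "p \<in> P" "m = g p" by auto
    then have sub: "fst p \<subseteq> E" "snd p \<subseteq> E"
      and c: "\<And>v. v \<in> V1 \<union> V2 \<Longrightarrow> card (star (fst p) v) = of_bool (v \<in> U1)"
        "\<And>v. v \<in> V1 \<union> V2 \<Longrightarrow> card (star (snd p) v) = of_bool (v \<in> U2)"
      by (auto simp: P_def matchings_def)
    have "dd_deg E m v = card (star (fst p) v) + card (star (snd p) v)" for v
      unfolding dd_deg_star card_star_sum[OF sub(1)] card_star_sum[OF sub(2)] p(2) g_def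
      by (rule sum.distrib)
    then show "m \<in> configs d" using c sub p(2) by (auto simp: configs_def d_def g_def)
  qed
  have hg: "h p = (\<Prod>e\<in>E. wt e ^ m e)" if "p \<in> {p \<in> P. g p = m}" for p m
  proof -
    have sub: "fst p \<subseteq> E" "snd p \<subseteq> E" using that by (auto simp: P_def matchings_def)
    have "(\<Prod>e\<in>M. wt e) = (\<Prod>e\<in>E. wt e ^ of_bool (e \<in> M))" if "M \<subseteq> E" for M
      using that finE by (intro prod.mono_neutral_cong_left) auto
    then have "h p = (\<Prod>e\<in>E. wt e ^ g p e)" using sub by (simp add: h_def g_def power_add prod.distrib)
    then show ?thesis using that by simp
  qed
  have "dimer_sum wt U1 * dimer_sum wt U2 = (\<Sum>p\<in>P. h p)"
    unfolding dimer_sum_def P_def h_def by (simp add: sum_product sum.cartesian_product case_prod_unfold)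
  also have "\<dots> = (\<Sum>m\<in>configs d. \<Sum>p\<in>{p \<in> P. g p = m}. h p)"
    by (rule sum.group[symmetric, OF fP finite_configs[OF d2] gP])
  also have "\<dots> = (\<Sum>m\<in>configs d. real (card {p \<in> P. g p = m}) * (\<Prod>e\<in>E. wt e ^ m e))"
  proof (rule sum.cong[OF refl])
    fix m
    have "(\<Sum>p\<in>{p \<in> P. g p = m}. h p) = (\<Sum>p\<in>{p \<in> P. g p = m}. \<Prod>e\<in>E. wt e ^ m e)"
      by (rule sum.cong[OF refl hg])
    then show "(\<Sum>p\<in>{p \<in> P. g p = m}. h p) = real (card {p \<in> P. g p = m}) * (\<Prod>e\<in>E. wt e ^ m e)"
      by simp
  qed
  also have "\<dots> = (\<Sum>m\<in>configs d. if compatible (singles E m) U1 then dd_weight E wt S m else 0)"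
  proof (rule sum.cong[OF refl])
    fix m assume m: "m \<in> configs d"
    let ?H = "singles E m"
    have H: "?H \<subseteq> E" by (auto simp: singles_def)
    have "card (star ?H s) = 1 \<longleftrightarrow> s \<in> S" for s
      using singles_star_one[of m U1 U2 s] m by (simp add: S d_def)
    then have "dd_loops E S m = card (loops ?H)" by (rule dd_loops_eq)
    moreover have "card {p \<in> P. g p = m} = (if compatible ?H U1 then 2 ^ card (loops ?H) else 0)"
      using card_matching_pairs[of m U1 U2] m card_splittings[OF H singles_star_le2[OF m d2], of U1]
      unfolding P_def g_def d_def by simp
    ultimately show "real (card {p \<in> P. g p = m}) * (\<Prod>e\<in>E. wt e ^ m e) =
        (if compatible ?H U1 then dd_weight E wt S m else 0)"
      by (simp add: dd_weight_def)
  qed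
  finally show ?thesis .
qed

end

section \<open>Planarity\<close>

text \<open>The Cayley transform from the unit disk to the upper half-plane that sends the boundary
  point \<open>cis \<phi>\<close> to infinity.\<close>

definition half_plane_map :: "real \<Rightarrow> complex \<Rightarrow> complex" where
  "half_plane_map \<phi> z = \<i> * (cis \<phi> + z) / (cis \<phi> - z)"

lemma half_plane_map_inj:
  assumes "z \<noteq> cis \<phi>" "w \<noteq> cis \<phi>" "half_plane_map \<phi> z = half_plane_map \<phi> w"
  shows "z = w"
proof -
  have "(cis \<phi> + z) * (cis \<phi> - w) = (cis \<phi> + w) * (cis \<phi> - z)"
    using assms by (simp add: half_plane_map_def field_simps)
  then have "2 * cis \<phi> * (z - w) = 0" by (simp add: algebra_simps)
  then show ?thesis by simp
qed

text \<open>Multiply numerator and denominator by the conjugate of the denominator; the sign of the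
  imaginary part becomes visible.\<close>

lemma half_plane_map_expand:
  assumes "z \<noteq> cis \<phi>"
  shows "half_plane_map \<phi> z = Complex (- 2 * Im (z * cis (- \<phi>))) (1 - (norm z)\<^sup>2) / of_real ((norm (cis \<phi> - z))\<^sup>2)"
proof -
  have nz: "cis \<phi> - z \<noteq> 0" using assms by simp
  have n: "of_real ((norm (cis \<phi> - z))\<^sup>2) = (cis \<phi> - z) * cnj (cis \<phi> - z)"
    by (rule complex_norm_square)
  have "\<i> * (cis \<phi> + z) * cnj (cis \<phi> - z) = Complex (- 2 * Im (z * cis (- \<phi>))) (1 - (norm z)\<^sup>2)"
  proof (rule complex_eqI)
    have sc: "(sin \<phi>)\<^sup>2 + (cos \<phi>)\<^sup>2 = 1" by simp
    show "Re (\<i> * (cis \<phi> + z) * cnj (cis \<phi> - z)) = Re (Complex (- 2 * Im (z * cis (- \<phi>))) (1 - (norm z)\<^sup>2))"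
      by (simp add: algebra_simps)
    have "Im (\<i> * (cis \<phi> + z) * cnj (cis \<phi> - z)) = (sin \<phi>)\<^sup>2 + (cos \<phi>)\<^sup>2 - ((Re z)\<^sup>2 + (Im z)\<^sup>2)"
      by (simp add: algebra_simps power2_eq_square)
    then show "Im (\<i> * (cis \<phi> + z) * cnj (cis \<phi> - z)) = Im (Complex (- 2 * Im (z * cis (- \<phi>))) (1 - (norm z)\<^sup>2))"
      by (simp add: cmod_power2)
  qed
  moreover have "half_plane_map \<phi> z = \<i> * (cis \<phi> + z) * cnj (cis \<phi> - z) / ((cis \<phi> - z) * cnj (cis \<phi> - z))"
    using nz unfolding half_plane_map_def by (subst mult_divide_mult_cancel_right) (auto simp del: complex_cnj_diff)
  ultimately show ?thesis unfolding n by simp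
qed

lemma half_plane_map_upper:
  assumes "z \<noteq> cis \<phi>" "norm z \<le> 1"
  shows "0 \<le> Im (half_plane_map \<phi> z)"
  unfolding half_plane_map_expand[OF assms(1)] using assms(2)
  by (simp add: Im_divide_of_real power_le_one)

lemma cis_eq_cis_iff:
  assumes "0 \<le> a" "a < 2 * pi" "0 \<le> b" "b < 2 * pi" "cis a = cis b"
  shows "a = b"
proof -
  have "sin a = sin b \<and> cos a = cos b" using assms(5) by (simp add: complex_eq_iff)
  then obtain n :: int where n: "a = b + 2 * pi * n" by (auto simp: sin_cos_eq_iff)
  have "2 * pi * real_of_int n < 2 * pi * 1" "2 * pi * (-1) < 2 * pi * real_of_int n"
    using assms(1-4) n by linarith+
  then have "real_of_int n < 1" "- 1 < real_of_int n"
    by (subst (asm) (1 2) mult_less_cancel_left_pos; simp)+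
  then have "n = 0" by linarith
  then show ?thesis using n by simp
qed

text \<open>With \<open>cot_strict_antimono\<close> this shows that the order of angles below
  \<open>\<phi>\<close> becomes the order of the images on the real line.\<close>

lemma half_plane_map_circle:
  assumes "0 \<le> t" "t < \<phi>" "\<phi> < 2 * pi"
  shows "half_plane_map \<phi> (cis t) = of_real (cot ((\<phi> - t) / 2))"
proof -
  define a where "a = (\<phi> - t) / 2"
  have a2: "2 * a = \<phi> - t" by (simp add: a_def)
  have s: "sin a \<noteq> 0" using sin_gt_zero[of a] assms by (simp add: a_def)
  have ne: "cis t \<noteq> cis \<phi>"
  proof
    assume "cis t = cis \<phi>"
    then have "cos (\<phi> - t) = 1"
      by (metis Re_complex_of_real cis.simps(1) cis_divide cis_neq_zero divide_self_if of_real_1)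
    then have "1 - 2 * (sin a)\<^sup>2 = 1" using cos_double_sin[of a] by (simp add: a2)
    then show False using s by simp
  qed
  have m: "cis t * cis (- \<phi>) = cis (- (2 * a))" by (simp add: cis_mult a2)
  have n: "(norm (cis \<phi> - cis t))\<^sup>2 = 4 * (sin a)\<^sup>2"
  proof -
    have "(norm (cis \<phi> - cis t))\<^sup>2 = (cos \<phi> - cos t)\<^sup>2 + (sin \<phi> - sin t)\<^sup>2" by (simp add: cmod_power2)
    also have "\<dots> = ((sin \<phi>)\<^sup>2 + (cos \<phi>)\<^sup>2) + ((sin t)\<^sup>2 + (cos t)\<^sup>2) - 2 * (cos \<phi> * cos t + sin \<phi> * sin t)"
      by (simp add: power2_eq_square algebra_simps)
    also have "\<dots> = 2 - 2 * cos (\<phi> - t)" by (simp add: cos_diff)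
    also have "cos (\<phi> - t) = 1 - 2 * (sin a)\<^sup>2" using cos_double_sin[of a] by (simp add: a2)
    finally show ?thesis by simp
  qed
  have "half_plane_map \<phi> (cis t) = Complex (2 * sin (2 * a)) 0 / of_real (4 * (sin a)\<^sup>2)"
    unfolding half_plane_map_expand[OF ne] m n by simp
  also have "\<dots> = of_real (2 * sin (2 * a) / (4 * (sin a)\<^sup>2))"
    by (rule complex_eqI) (simp_all add: Re_divide_of_real Im_divide_of_real del: of_real_mult of_real_power of_real_divide)
  also have "2 * sin (2 * a) / (4 * (sin a)\<^sup>2) = cot a"
    using s by (simp add: sin_double cot_def power2_eq_square)
  finally show ?thesis by (simp add: a_def)
qed

lemma cot_strict_antimono:
  assumes "0 < a" "a < b" "b < pi"
  shows "cot b < cot a"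
proof -
  have "0 < sin (b - a)" using assms by (intro sin_gt_zero) auto
  then have "cos b * sin a < cos a * sin b" by (simp add: sin_diff algebra_simps)
  moreover have "0 < sin a" "0 < sin b" using assms by (auto intro!: sin_gt_zero)
  ultimately show ?thesis by (simp add: cot_def divide_simps)
qed

text \<open>After sending \<open>cis \<phi>\<close> to infinity, the four end points alternate on
  the bottom edge of a box containing both paths, and \<open>fashoda_interlace\<close> gives a
  common point. Injectivity of the map brings it back to the disk.\<close>

lemma disk_paths_meet:
  fixes g h :: "real \<Rightarrow> complex"
  assumes g: "path g" "path_image g \<subseteq> cball 0 1" "pathstart g = cis t1" "pathfinish g = cis t3"
    and h: "path h" "path_image h \<subseteq> cball 0 1" "pathstart h = cis t2" "pathfinish h = cis t4"
    and t: "0 \<le> t1" "t1 < t2" "t2 < t3" "t3 < t4" "t4 < \<phi>" "\<phi> < 2 * pi"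
    and avoid: "cis \<phi> \<notin> path_image g" "cis \<phi> \<notin> path_image h"
  shows "path_image g \<inter> path_image h \<noteq> {}"
proof -
  define f where "f = half_plane_map \<phi>"
  define F :: "complex \<Rightarrow> real^2" where "F z = Re (f z) *\<^sub>R axis 1 1 + Im (f z) *\<^sub>R axis 2 1" for z
  have F1: "F z $ 1 = Re (f z)" and F2: "F z $ 2 = Im (f z)" for z
    by (simp_all add: F_def axis_def)
  have cont: "continuous_on (- {cis \<phi>}) F"
    unfolding F_def f_def half_plane_map_def by (intro continuous_intros) auto
  have sub: "path_image g \<subseteq> - {cis \<phi>}" "path_image h \<subseteq> - {cis \<phi>}" using avoid by auto
  have pg: "path (F \<circ> g)" and ph: "path (F \<circ> h)"
    using g(1) h(1) continuous_on_subset[OF cont sub(1)] continuous_on_subset[OF cont sub(2)]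
    by (auto intro: path_continuous_image)
  have "bounded (path_image (F \<circ> g) \<union> path_image (F \<circ> h))"
    using pg ph by (simp add: bounded_path_image)
  then obtain R where R: "\<And>x. x \<in> path_image (F \<circ> g) \<union> path_image (F \<circ> h) \<Longrightarrow> norm x \<le> R"
    by (auto simp: bounded_iff)
  \<comment> \<open>Corners of the box from \<open>- R\<close> to \<open>R\<close> horizontally and
    from 0 to \<open>R\<close> vertically; its bottom edge lies on the real line.\<close>
  define A B :: "real^2" where "A = (- R) *\<^sub>R axis 1 1" and "B = R *\<^sub>R axis 1 1 + R *\<^sub>R axis 2 1"
  have AB: "A $ 1 = - R" "A $ 2 = 0" "B $ 1 = R" "B $ 2 = R" by (simp_all add: A_def B_def axis_def)
  have box: "path_image (F \<circ> k) \<subseteq> cbox A B"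
    if k: "path_image (F \<circ> k) \<subseteq> path_image (F \<circ> g) \<union> path_image (F \<circ> h)"
      "path_image k \<subseteq> cball 0 1" "path_image k \<subseteq> - {cis \<phi>}" for k
  proof
    fix x assume x: "x \<in> path_image (F \<circ> k)"
    then obtain z where z: "z \<in> path_image k" "x = F z" by (auto simp: path_image_compose)
    have "norm x \<le> R" using R x k(1) by blast
    then have "\<bar>x $ 1\<bar> \<le> R" "\<bar>x $ 2\<bar> \<le> R" using component_le_norm_cart[of x] order_trans by blast+
    moreover have "0 \<le> x $ 2"
      unfolding z(2) F2 f_def by (rule half_plane_map_upper) (use z(1) k(2,3) in auto)
    ultimately show "x \<in> cbox A B" by (auto simp: mem_box_cart forall_2 AB)
  qed
  have val: "F (cis t) $ 1 = cot ((\<phi> - t) / 2)" "F (cis t) $ 2 = 0" if "0 \<le> t" "t < \<phi>" for t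
    unfolding F1 F2 f_def using half_plane_map_circle[OF that t(6)] by auto
  have mono: "F (cis s) $ 1 < F (cis t') $ 1" if "0 \<le> s" "s < t'" "t' < \<phi>" for s t'
    using that t(6) by (simp add: val) (rule cot_strict_antimono, auto)
  obtain x where x: "x \<in> path_image (F \<circ> g)" "x \<in> path_image (F \<circ> h)"
  proof (rule fashoda_interlace[of "F \<circ> g" "F \<circ> h" A B])
    show "path_image (F \<circ> g) \<subseteq> cbox A B" "path_image (F \<circ> h) \<subseteq> cbox A B"
      using box[of g] box[of h] g(2) h(2) sub by auto
    show "pathstart (F \<circ> g) $ 1 < pathstart (F \<circ> h) $ 1" "pathstart (F \<circ> h) $ 1 < pathfinish (F \<circ> g) $ 1"
      "pathfinish (F \<circ> g) $ 1 < pathfinish (F \<circ> h) $ 1"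
      unfolding pathstart_compose pathfinish_compose g(3,4) h(3,4) using t by (auto intro!: mono)
  qed (use pg ph t g(3,4) h(3,4) in \<open>auto simp: pathstart_compose pathfinish_compose val AB\<close>)
  then obtain z w where zw: "z \<in> path_image g" "x = F z" "w \<in> path_image h" "x = F w"
    by (auto simp: path_image_compose)
  then have "F z = F w" by simp
  then have "f z = f w" using F1[of z] F1[of w] F2[of z] F2[of w] by (simp add: complex_eq_iff)
  then have "z = w" using half_plane_map_inj[of z \<phi> w] zw(1,3) sub unfolding f_def by blast
  then show ?thesis using zw by blast
qed

text \<open>The drawings of two different components are disjoint, since edges meet only in common
  end points. But a path from node \<open>i\<close> to node \<open>k\<close> inside one drawing must
  meet a path from \<open>j\<close> to \<open>l\<close> inside the other.\<close>

theorem disk_embedding_noncrossing: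
  assumes emb: "disk_embedding V E N node" and EV: "E \<subseteq> V \<times> V" and nV: "node ` {1..N} \<subseteq> V" and H: "H \<subseteq> E"
    and ord: "1 \<le> i" "i < j" "j < k" "k < l" "l \<le> N"
    and c1: "edge_conn H (node i) (node k)" and c2: "edge_conn H (node j) (node l)"
  shows "edge_conn H (node i) (node j)"
proof (rule ccontr)
  assume nc: "\<not> edge_conn H (node i) (node j)"
  obtain p \<gamma> \<theta> where inj: "inj_on p V"
    and th': "\<forall>i\<in>{1..N}. p (node i) = cis (\<theta> i) \<and> 0 \<le> \<theta> i \<and> \<theta> i < 2 * pi"
    and mono': "\<forall>i\<in>{1..N}. \<forall>j\<in>{1..N}. i < j \<longrightarrow> \<theta> i < \<theta> j"
    and inner': "\<forall>v\<in>V - node ` {1..N}. norm (p v) < 1"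
    and arcs': "\<forall>e\<in>E. arc (\<gamma> e) \<and> pathstart (\<gamma> e) = p (fst e) \<and> pathfinish (\<gamma> e) = p (snd e) \<and>
      path_image (\<gamma> e) \<subseteq> cball 0 1 \<and> path_image (\<gamma> e) \<inter> sphere 0 1 \<subseteq> {p (fst e), p (snd e)}"
    and avoid': "\<forall>e\<in>E. \<forall>v\<in>V. p v \<in> path_image (\<gamma> e) \<longrightarrow> v = fst e \<or> v = snd e"
    and cross': "\<forall>e\<in>E. \<forall>e'\<in>E. e \<noteq> e' \<longrightarrow>
      path_image (\<gamma> e) \<inter> path_image (\<gamma> e') \<subseteq> p ` ({fst e, snd e} \<inter> {fst e', snd e'})"
    using emb unfolding disk_embedding_def by (elim exE conjE) (rule that)
  note th = bspec[OF th'] and mono = mono'[rule_format] and inner = bspec[OF inner']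
    and arcs = bspec[OF arcs'] and avoid = avoid'[rule_format] and cross = cross'[rule_format]
  define K where "K a = insert (p a) (\<Union>e\<in>{e \<in> H. edge_conn H a (fst e)}. path_image (\<gamma> e))" for a
  have ends: "fst e \<in> V" "snd e \<in> V" if "e \<in> H" for e
    using subsetD[OF EV] subsetD[OF H that] by (auto simp: mem_Times_iff)
  have path_ex: "\<exists>g. path g \<and> pathstart g = p a \<and> pathfinish g = p b \<and> path_image g \<subseteq> K a"
    if "edge_conn H a b" for a b
    using that[unfolded edge_conn_def]
  proof (induction rule: rtranclp_induct)
    case base
    show ?case by (rule exI[of _ "\<lambda>_. p a"]) (auto simp: K_def path_def pathstart_def pathfinish_def path_image_def)
  next
    case (step b c)
    then obtain g where g: "path g" "pathstart g = p a" "pathfinish g = p b" "path_image g \<subseteq> K a" by blast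
    have ab: "edge_conn H a b" using step(1) by (simp add: edge_conn_def)
    have "\<exists>k. path k \<and> pathstart k = p b \<and> pathfinish k = p c \<and> path_image k \<subseteq> K a"
      using step(2)
    proof
      assume e: "(b, c) \<in> H"
      then have "path_image (\<gamma> (b, c)) \<subseteq> K a" using ab unfolding K_def by force
      then show ?thesis using arcs[OF subsetD[OF H e]] by (auto simp: arc_imp_path intro!: exI[of _ "\<gamma> (b, c)"])
    next
      assume e: "(c, b) \<in> H"
      then have "path_image (\<gamma> (c, b)) \<subseteq> K a"
        using ab edge_conn_fst_iff_snd[OF e, of a] unfolding K_def by force
      then show ?thesis using arcs[OF subsetD[OF H e]]
        by (auto simp: arc_imp_path intro!: exI[of _ "reversepath (\<gamma> (c, b))"])
    qed
    then obtain k where k: "path k" "pathstart k = p b" "pathfinish k = p c" "path_image k \<subseteq> K a" by blast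
    then show ?case using g
      by (intro exI[of _ "g +++ k"]) (auto simp: path_image_join)
  qed
  have nodeV: "node q \<in> V" if "q \<in> {1..N}" for q using nV that by blast
  have Kball: "K a \<subseteq> cball 0 1" if "p a \<in> cball 0 1" for a
  proof -
    have "path_image (\<gamma> e) \<subseteq> cball 0 1" if "e \<in> H" for e using arcs[OF subsetD[OF H that]] by blast
    then show ?thesis using that unfolding K_def by blast
  qed
  have disjK: "K a \<inter> K b = {}" if ab: "a \<in> V" "b \<in> V" "\<not> edge_conn H a b" for a b
  proof -
    have neq: "p a \<noteq> p b" using inj ab by (metis edge_conn_refl inj_onD)
    have share: False if "e \<in> H" "e' \<in> H" "edge_conn H a (fst e)" "edge_conn H b (fst e')"
        "u = fst e \<or> u = snd e" "u = fst e' \<or> u = snd e'" for e e' u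
    proof -
      have "edge_conn H a u" "edge_conn H b u"
        using that edge_conn_fst_iff_snd[of e H a] edge_conn_fst_iff_snd[of e' H b] by auto
      then show False using ab(3) edge_conn_sym edge_conn_trans by metis
    qed
    have 1: "p u \<notin> path_image (\<gamma> e)" if "u \<in> V" "e \<in> H" "edge_conn H c (fst e)" "\<not> edge_conn H c u" for u e c
      using avoid[of e u] that H edge_conn_fst_iff_snd[of e H c] by auto
    have 2: False if "z \<in> path_image (\<gamma> e)" "z \<in> path_image (\<gamma> e')"
        "e \<in> H" "e' \<in> H" "edge_conn H a (fst e)" "edge_conn H b (fst e')" for z e e'
    proof (cases "e = e'")
      case True
      then show False using share[of e e' "fst e"] that by blast
    next
      case False
      have "z \<in> p ` ({fst e, snd e} \<inter> {fst e', snd e'})"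
        using cross[of e e'] False that H by blast
      then show False using share[of e e'] that by blast
    qed
    have "\<not> edge_conn H b a" using ab(3) edge_conn_sym by metis
    then show ?thesis using neq 1[of b _ a] 1[of a _ b] 2 ab unfolding K_def by blast
  qed
  \<comment> \<open>An angle after the last node and before a full turn. Edges touch the circle only
    in their end points, so \<open>cis \<phi>\<close> lies on no drawing.\<close>
  define \<phi> where "\<phi> = (\<theta> N + 2 * pi) / 2"
  have N: "N \<in> {1..N}" using ord by auto
  have phi: "\<theta> N < \<phi>" "\<phi> < 2 * pi" using th[OF N] by (auto simp: \<phi>_def)
  have thle: "\<theta> q < \<phi>" if "q \<in> {1..N}" for q
    using mono[of q N] that N phi(1) by (cases "q = N") auto
  have nphi: "p u \<noteq> cis \<phi>" if "u \<in> V" for u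
  proof (cases "u \<in> node ` {1..N}")
    case True
    then obtain q where q: "q \<in> {1..N}" "u = node q" by blast
    show ?thesis
    proof
      assume "p u = cis \<phi>"
      then have "\<theta> q = \<phi>" using cis_eq_cis_iff[of "\<theta> q" \<phi>] th[OF q(1)] thle[OF q(1)] q phi by auto
      then show False using thle[OF q(1)] by simp
    qed
  next
    case False
    then have "norm (p u) < 1" using inner that by blast
    then show ?thesis by auto
  qed
  have avK: "cis \<phi> \<notin> K a" if aV: "a \<in> V" for a
  proof
    assume "cis \<phi> \<in> K a"
    then obtain e where e: "e \<in> H" "cis \<phi> \<in> path_image (\<gamma> e)" using nphi[OF aV] by (auto simp: K_def)
    then have "cis \<phi> \<in> {p (fst e), p (snd e)}" using arcs[OF subsetD[OF H e(1)]] by auto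
    then show False using nphi[of "fst e"] nphi[of "snd e"] ends[OF e(1)] by auto
  qed
  have I: "i \<in> {1..N}" "j \<in> {1..N}" "k \<in> {1..N}" "l \<in> {1..N}" using ord by auto
  obtain g where g: "path g" "pathstart g = p (node i)" "pathfinish g = p (node k)" "path_image g \<subseteq> K (node i)"
    using path_ex[OF c1] by blast
  obtain h where h: "path h" "pathstart h = p (node j)" "pathfinish h = p (node l)" "path_image h \<subseteq> K (node j)"
    using path_ex[OF c2] by blast
  have "path_image g \<inter> path_image h \<noteq> {}"
  proof (rule disk_paths_meet[of g "\<theta> i" "\<theta> k" h "\<theta> j" "\<theta> l" \<phi>])
    show "path_image g \<subseteq> cball 0 1" using g(4) Kball[of "node i"] th[OF I(1)] by auto
    show "path_image h \<subseteq> cball 0 1" using h(4) Kball[of "node j"] th[OF I(2)] by auto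
    show "cis \<phi> \<notin> path_image g" using avK[OF nodeV[OF I(1)]] g(4) by blast
    show "cis \<phi> \<notin> path_image h" using avK[OF nodeV[OF I(2)]] h(4) by blast
  qed (use g h th[OF I(1)] th[OF I(2)] th[OF I(3)] th[OF I(4)] mono I ord thle phi in auto)
  then show False using disjK[OF nodeV[OF I(1)] nodeV[OF I(2)] nc] g(4) h(4) by blast
qed

section \<open>Planar pairings\<close>

definition between :: "nat set \<Rightarrow> nat \<Rightarrow> nat \<Rightarrow> nat set" where
  "between L a c = {z \<in> L. min a c < z \<and> z < max a c}"

definition below :: "nat set \<Rightarrow> nat \<Rightarrow> nat set" where
  "below L i = {z \<in> L. z < i}"

definition separates :: "nat set \<Rightarrow> nat set set \<Rightarrow> bool" where
  "separates A \<rho> \<longleftrightarrow> (\<forall>a b. a \<noteq> b \<longrightarrow> {a, b} \<in> \<rho> \<longrightarrow> (a \<in> A) \<noteq> (b \<in> A))"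

lemma pairing_subset: "is_pairing L \<rho> \<Longrightarrow> p \<in> \<rho> \<Longrightarrow> p \<subseteq> L"
  by (simp add: is_pairing_def)

lemma pairing_pair:
  assumes "is_pairing L \<rho>" "p \<in> \<rho>"
  obtains a b where "p = {a, b}" "a < b" "a \<in> L" "b \<in> L"
proof -
  have "card p = 2" "p \<subseteq> L" using assms by (auto simp: is_pairing_def)
  then obtain x y where xy: "p = {x, y}" "x \<noteq> y" "x \<in> L" "y \<in> L" by (auto simp: card_2_iff)
  show thesis
  proof (cases "x < y")
    case True
    then show thesis using that[of x y] xy by simp
  next
    case False
    then show thesis using that[of y x] xy by (simp add: insert_commute)
  qed
qed

lemma pairing_disjoint:
  assumes "is_pairing L \<rho>" "p \<in> \<rho>" "q \<in> \<rho>" "a \<in> p" "a \<in> q"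
  shows "p = q"
proof -
  have "a \<in> L" using assms by (auto simp: is_pairing_def)
  then have "\<exists>!p. p \<in> \<rho> \<and> a \<in> p" using assms(1) by (simp add: is_pairing_def)
  then show ?thesis using assms(2-5) by blast
qed

lemma pairing_partner:
  assumes "is_pairing L \<rho>"
  obtains \<pi> where "\<And>a. a \<in> L \<Longrightarrow> \<pi> a \<in> L \<and> \<pi> a \<noteq> a \<and> \<pi> (\<pi> a) = a"
    "\<And>a b. a \<in> L \<Longrightarrow> a \<noteq> b \<Longrightarrow> {a, b} \<in> \<rho> \<longleftrightarrow> b = \<pi> a"
proof -
  have ex: "\<exists>b. b \<in> L \<and> b \<noteq> a \<and> {a, b} \<in> \<rho>" if "a \<in> L" for a
  proof -
    have "\<exists>!p. p \<in> \<rho> \<and> a \<in> p" using assms that by (simp add: is_pairing_def)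
    then obtain p where p: "p \<in> \<rho>" "a \<in> p" by (elim ex1E conjE)
    obtain x y where xy: "p = {x, y}" "x < y" "x \<in> L" "y \<in> L" using pairing_pair[OF assms p(1)] .
    have "{y, x} \<in> \<rho>" using p(1) xy(1) by (simp add: insert_commute)
    moreover have "a = x \<or> a = y" using p(2) xy(1) by blast
    ultimately show ?thesis using xy p(1) by (metis less_irrefl)
  qed
  then have "\<forall>a\<in>L. \<exists>b. b \<in> L \<and> b \<noteq> a \<and> {a, b} \<in> \<rho>" by blast
  from bchoice[OF this] obtain \<pi> where "\<forall>a\<in>L. \<pi> a \<in> L \<and> \<pi> a \<noteq> a \<and> {a, \<pi> a} \<in> \<rho>" ..
  then have pi: "\<And>a. a \<in> L \<Longrightarrow> \<pi> a \<in> L \<and> \<pi> a \<noteq> a \<and> {a, \<pi> a} \<in> \<rho>" by blast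
  have uniq: "b = \<pi> a" if "a \<in> L" "a \<noteq> b" "{a, b} \<in> \<rho>" for a b
  proof -
    have "{a, b} = {a, \<pi> a}" using pairing_disjoint[OF assms that(3), of "{a, \<pi> a}" a] pi[OF that(1)] by simp
    then show ?thesis using that(2) by (auto simp: doubleton_eq_iff)
  qed
  have "\<pi> (\<pi> a) = a" if "a \<in> L" for a
    using uniq[of "\<pi> a" a] pi[OF that] by (simp add: insert_commute)
  then show thesis using that[of \<pi>] pi uniq by blast
qed

lemma pairing_Union: "is_pairing L \<rho> \<Longrightarrow> \<Union>\<rho> = L"
  unfolding is_pairing_def by blast

lemma pairing_finite: "is_pairing L \<rho> \<Longrightarrow> finite L \<Longrightarrow> finite \<rho>"
  by (rule finite_subset[of _ "Pow L"]) (auto simp: is_pairing_def)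

lemma pairing_card_even:
  assumes "is_pairing L \<rho>" "finite L"
  shows "even (card L)"
proof -
  have "card (\<Union>\<rho>) = (\<Sum>p\<in>\<rho>. card p)"
  proof (rule card_Union_disjoint)
    show "pairwise disjnt \<rho>" using pairing_disjoint[OF assms(1)] by (auto simp: pairwise_def disjnt_def)
    show "finite p" if "p \<in> \<rho>" for p using assms that by (auto simp: is_pairing_def intro: finite_subset)
  qed
  also have "\<dots> = (\<Sum>p\<in>\<rho>. 2)" by (rule sum.cong) (use assms(1) in \<open>auto simp: is_pairing_def\<close>)
  finally show ?thesis by (simp add: pairing_Union[OF assms(1)])
qed

lemma planar_partner_between:
  assumes \<rho>: "is_pairing L \<rho>" "planar_pairing \<rho>" and ac: "{a, c} \<in> \<rho>" "a < c"
    and z: "z \<in> L" "a < z" "z < c" and zz: "{z, z'} \<in> \<rho>" "z \<noteq> z'"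
  shows "a < z' \<and> z' < c"
proof -
  have "z' \<noteq> a" "z' \<noteq> c"
    using pairing_disjoint[OF \<rho>(1) ac(1) zz(1)] z by (auto simp: doubleton_eq_iff)
  moreover have "\<not> z' < a"
  proof
    assume "z' < a"
    moreover have "{z', z} \<in> \<rho>" using zz(1) by (simp add: insert_commute)
    ultimately show False using \<rho>(2) ac z unfolding planar_pairing_def by blast
  qed
  moreover have "\<not> c < z'" using \<rho>(2) ac z zz(1) unfolding planar_pairing_def by blast
  ultimately show ?thesis by linarith
qed

text \<open>By planarity the partner of a label in between also lies in between, so the pairing
  restricts to these labels.\<close>

lemma planar_even_between:
  assumes \<rho>: "is_pairing L \<rho>" "planar_pairing \<rho>" "finite L" and ac: "{a, c} \<in> \<rho>" "a \<noteq> c"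
  shows "even (card (between L a c))"
proof -
  have main: "even (card (between L a c))" if ac: "{a, c} \<in> \<rho>" "a < c" for a c
  proof -
    let ?B = "between L a c"
    obtain \<pi> where pi: "\<And>a. a \<in> L \<Longrightarrow> \<pi> a \<in> L \<and> \<pi> a \<noteq> a \<and> \<pi> (\<pi> a) = a"
      "\<And>a b. a \<in> L \<Longrightarrow> a \<noteq> b \<Longrightarrow> {a, b} \<in> \<rho> \<longleftrightarrow> b = \<pi> a"
      by (rule pairing_partner[OF \<rho>(1)]) (rule that)
    have cl: "\<pi> z \<in> ?B" if "z \<in> ?B" for z
      using planar_partner_between[OF \<rho>(1,2) ac, of z "\<pi> z"] pi(1)[of z] pi(2)[of z "\<pi> z"] that ac
      by (auto simp: between_def)
    have "is_pairing ?B {p \<in> \<rho>. p \<subseteq> ?B}"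
      unfolding is_pairing_def
    proof (intro conjI ballI)
      fix p assume "p \<in> {p \<in> \<rho>. p \<subseteq> ?B}"
      then show "card p = 2" "p \<subseteq> ?B" using \<rho>(1) by (auto simp: is_pairing_def)
    next
      fix z assume z: "z \<in> ?B"
      then have zL: "z \<in> L" by (simp add: between_def)
      have "{z, \<pi> z} \<in> {p \<in> \<rho>. p \<subseteq> ?B}" using pi(1)[OF zL] pi(2)[OF zL, of "\<pi> z"] cl[OF z] z by auto
      then show "\<exists>!p. p \<in> {p \<in> \<rho>. p \<subseteq> ?B} \<and> z \<in> p"
        by (intro ex1I[of _ "{z, \<pi> z}"]) (use pairing_disjoint[OF \<rho>(1)] in auto)
    qed
    then show ?thesis by (rule pairing_card_even) (use \<rho>(3) in \<open>simp add: between_def\<close>)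
  qed
  show ?thesis
  proof (cases "a < c")
    case False
    then have "even (card (between L c a))" using main[of c a] ac by (simp add: insert_commute)
    then show ?thesis by (simp add: between_def min.commute max.commute)
  qed (use main ac in blast)
qed

lemma card_below_parity:
  assumes "finite L" "i \<in> L" "i < j"
  shows "card (below L j) = Suc (card (below L i) + card (between L i j))"
proof -
  have "below L j = insert i (below L i \<union> between L i j)"
    using assms by (auto simp: below_def between_def)
  moreover have "i \<notin> below L i \<union> between L i j" "below L i \<inter> between L i j = {}"
    using assms by (auto simp: below_def between_def)
  ultimately show ?thesis using assms(1) by (simp add: card_Un_disjoint below_def between_def)
qed

text \<open>
  If \<open>A\<close> separates \<open>\<rho>\<close>, only the partner of \<open>j\<close> contributes to the right-hand side; otherwise the contributions
  come from the two elements of a pair and cancel by planarity.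
\<close>
lemma separates_exchange:
  assumes \<rho>: "is_pairing L \<rho>" "planar_pairing \<rho>" "finite L" and A: "A \<subseteq> L" and j: "j \<in> L - A"
  shows "(of_bool (separates A \<rho>) :: real) =
    (\<Sum>i\<in>A. (-1) ^ card (between L i j) * of_bool (separates (insert j (A - {i})) \<rho>))"
proof -
  obtain \<pi> where pi: "\<And>a. a \<in> L \<Longrightarrow> \<pi> a \<in> L \<and> \<pi> a \<noteq> a \<and> \<pi> (\<pi> a) = a"
    "\<And>a b. a \<in> L \<Longrightarrow> a \<noteq> b \<Longrightarrow> {a, b} \<in> \<rho> \<longleftrightarrow> b = \<pi> a"
    by (rule pairing_partner[OF \<rho>(1)]) (rule that)
  have sep: "separates B \<rho> \<longleftrightarrow> (\<forall>a\<in>L. (a \<in> B) \<noteq> (\<pi> a \<in> B))" for B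
  proof
    assume "separates B \<rho>"
    then show "\<forall>a\<in>L. (a \<in> B) \<noteq> (\<pi> a \<in> B)" using pi unfolding separates_def by metis
  next
    assume r: "\<forall>a\<in>L. (a \<in> B) \<noteq> (\<pi> a \<in> B)"
    show "separates B \<rho>" unfolding separates_def
    proof (intro allI impI)
      fix a b assume ab: "a \<noteq> b" "{a, b} \<in> \<rho>"
      then have "a \<in> L" using \<rho>(1) by (auto simp: is_pairing_def)
      then show "(a \<in> B) \<noteq> (b \<in> B)" using r pi(2)[of a b] ab by simp
    qed
  qed
  define k where "k = \<pi> j"
  have jk: "j \<in> L" "k \<in> L" "k \<noteq> j" "\<pi> k = j" "{k, j} \<in> \<rho>" "j \<notin> A"
    using pi[of j] pi(2)[of j k] j by (auto simp: k_def insert_commute)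
  have finA: "finite A" using A \<rho>(3) finite_subset by blast
  define B where "B = {i \<in> A. separates (insert j (A - {i})) \<rho>}"
  have rhs: "(\<Sum>i\<in>A. (-1) ^ card (between L i j) * of_bool (separates (insert j (A - {i})) \<rho>)) =
      (\<Sum>i\<in>B. (-1 :: real) ^ card (between L i j))"
    using finA by (simp add: B_def sum.If_cases Int_def of_bool_def if_distrib cong: if_cong)
  show ?thesis
  proof (cases "k \<in> A")
    case True
    have Bk: "B \<subseteq> {k}"
    proof
      fix i assume "i \<in> B"
      then have "\<forall>a\<in>L. (a \<in> insert j (A - {i})) \<noteq> (\<pi> a \<in> insert j (A - {i}))"
        unfolding B_def sep by blast
      from bspec[OF this jk(1)] have "k \<notin> insert j (A - {i})" unfolding k_def by simp
      then show "i \<in> {k}" using True by blast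
    qed
    have "k \<in> B \<longleftrightarrow> separates A \<rho>"
    proof -
      have "(a \<in> insert j (A - {k})) \<noteq> (\<pi> a \<in> insert j (A - {k})) \<longleftrightarrow> (a \<in> A) \<noteq> (\<pi> a \<in> A)" if "a \<in> L" for a
      proof (cases "a = j \<or> a = k")
        case True
        then show ?thesis using jk \<open>k \<in> A\<close> k_def by auto
      next
        case False
        then have "\<pi> a \<noteq> j" "\<pi> a \<noteq> k" using pi(1)[OF that] jk k_def by metis+
        then show ?thesis using False by auto
      qed
      then show ?thesis using True unfolding B_def sep by blast
    qed
    then have "B = (if separates A \<rho> then {k} else {})" using Bk by auto
    moreover have "even (card (between L k j))" by (rule planar_even_between[OF \<rho> jk(5,3)])
    ultimately show ?thesis unfolding rhs by simp
  next
    case False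
    then have nsep: "\<not> separates A \<rho>" using jk k_def unfolding sep by blast
    show ?thesis
    proof (cases "B = {}")
      case True
      then show ?thesis using nsep unfolding rhs by simp
    next
      case False
      then obtain i where i: "i \<in> A" "separates (insert j (A - {i})) \<rho>" by (auto simp: B_def)
      define l where "l = \<pi> i"
      have iL: "i \<in> L" using i A by blast
      have ij: "i \<noteq> j" "i \<noteq> k" using i jk \<open>k \<notin> A\<close> by auto
      have "i \<notin> insert j (A - {i})" using ij by simp
      then have "l \<in> insert j (A - {i})" using i(2) iL unfolding sep l_def by blast
      moreover have "l \<noteq> j" using ij jk pi(1)[OF iL] by (metis k_def l_def)
      ultimately have l: "l \<in> A" "l \<noteq> i" "l \<noteq> j" by auto
      have lL: "l \<in> L" "\<pi> l = i" using l A pi(1)[OF iL] by (auto simp: l_def)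
      have il: "{i, l} \<in> \<rho>" using pi(2)[OF iL, of l] l by (auto simp: l_def)
      have lk: "l \<noteq> k" using l \<open>k \<notin> A\<close> by auto
      have "separates (insert j (A - {l})) \<rho>"
        unfolding sep
      proof
        fix a assume a: "a \<in> L"
        have s: "(a \<in> insert j (A - {i})) \<noteq> (\<pi> a \<in> insert j (A - {i}))" using i(2) a unfolding sep by blast
        show "(a \<in> insert j (A - {l})) \<noteq> (\<pi> a \<in> insert j (A - {l}))"
        proof (cases "a = i \<or> a = l")
          case True
          then show ?thesis using i(1) l lL l_def ij by auto
        next
          case False
          then have "\<pi> a \<noteq> i" "\<pi> a \<noteq> l" using pi(1)[OF a] lL l_def by metis+
          then show ?thesis using False s by auto
        qed
      qed
      then have sub: "{i, l} \<subseteq> B" using i l by (auto simp: B_def)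
      moreover have "B \<subseteq> {i, l}"
      proof
        fix i2 assume i2: "i2 \<in> B"
        show "i2 \<in> {i, l}"
        proof (rule ccontr)
          assume "i2 \<notin> {i, l}"
          then have "i \<in> insert j (A - {i2})" "l \<in> insert j (A - {i2})" using i l by auto
          then show False using i2 iL unfolding B_def sep l_def by blast
        qed
      qed
      ultimately have B: "B = {i, l}" by blast
      \<comment> \<open>Partners have an even number of labels between them, hence ranks of
        different parity, hence distances of different parity from \<open>j\<close>. So the two
        contributions cancel.\<close>
      have "odd (card (between L i j) + card (between L l j))"
      proof -
        have key: "odd (card (between L i j) + card (between L l j))"
          if il: "i < l" "{i, l} \<in> \<rho>" "i \<in> L" "l \<in> L" "i \<noteq> j" "l \<noteq> j" for i l
        proof -
          have ev: "even (card (between L i l))" using planar_even_between[OF \<rho> il(2)] il(1) by simp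
          have c: "between L a b = between L b a" for a b by (simp add: between_def min.commute max.commute)
          consider "j < i" | "i < j" "j < l" | "l < j" using il by linarith
          then show ?thesis
          proof cases
            case 1
            then show ?thesis
              using card_below_parity[OF \<rho>(3), of j i] card_below_parity[OF \<rho>(3), of j l]
                card_below_parity[OF \<rho>(3), of i l] jk(1) il ev c[of i j] c[of l j] by (simp; presburger)
          next
            case 2
            then show ?thesis
              using card_below_parity[OF \<rho>(3), of i j] card_below_parity[OF \<rho>(3), of j l]
                card_below_parity[OF \<rho>(3), of i l] jk(1) il ev c[of l j] by (simp; presburger)
          next
            case 3
            then show ?thesis
              using card_below_parity[OF \<rho>(3), of i j] card_below_parity[OF \<rho>(3), of l j]
                card_below_parity[OF \<rho>(3), of i l] jk(1) il ev by (simp; presburger)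
          qed
        qed
        show ?thesis
        proof (cases "i < l")
          case True
          then show ?thesis using key[of i l] il iL lL ij l by simp
        next
          case False
          then show ?thesis using key[of l i] il iL lL ij l by (simp add: insert_commute add.commute)
        qed
      qed
      then have "(-1 :: real) ^ card (between L i j) + (-1) ^ card (between L l j) = 0"
        by (cases "even (card (between L i j))") auto
      then show ?thesis using nsep l unfolding rhs B by simp
    qed
  qed
qed

text \<open>The wedge of a separated pair is 1 or -1 according to whether its smaller or larger
  element lies in \<open>T\<close>. Partners have ranks of opposite parity, so the factor of a pair
  is always the rank sign of its element in \<open>T\<close>. An unseparated pair has two equal
  vectors and wedge 0.\<close>

lemma prod_wedge_basis:
  fixes u :: "nat \<Rightarrow> real \<times> real"
  assumes \<rho>: "is_pairing L \<rho>" "planar_pairing \<rho>" "finite L" and T: "T \<subseteq> L"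
    and u: "\<And>i. i \<in> L \<Longrightarrow> u i = (if i \<in> T then (1, 0) else (0, 1))"
  shows "(\<Prod>p\<in>\<rho>. (-1) ^ card (below L (Min p)) *
      (fst (u (Min p)) * snd (u (Max p)) - snd (u (Min p)) * fst (u (Max p)))) =
    of_bool (separates T \<rho>) * (\<Prod>i\<in>T. (-1) ^ card (below L i))"
proof (cases "separates T \<rho>")
  case True
  have "(\<Prod>p\<in>\<rho>. (-1) ^ card (below L (Min p)) *
      (fst (u (Min p)) * snd (u (Max p)) - snd (u (Min p)) * fst (u (Max p)))) =
      (\<Prod>p\<in>\<rho>. \<Prod>i\<in>p \<inter> T. (-1) ^ card (below L i))"
  proof (rule prod.cong[OF refl])
    fix p assume p: "p \<in> \<rho>"
    obtain a b where ab: "p = {a, b}" "a < b" "a \<in> L" "b \<in> L" using pairing_pair[OF \<rho>(1) p] .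
    have "even (card (between L a b))" using planar_even_between[OF \<rho>, of a b] p ab by simp
    then have par: "(-1 :: real) ^ card (below L b) = - ((-1) ^ card (below L a))"
      using card_below_parity[OF \<rho>(3) ab(3,2)] by (simp add: minus_one_power_iff)
    have mm: "Min p = a" "Max p = b" using ab by auto
    have "(a \<in> T) \<noteq> (b \<in> T)" using True p ab unfolding separates_def by auto
    then show "(-1) ^ card (below L (Min p)) *
      (fst (u (Min p)) * snd (u (Max p)) - snd (u (Min p)) * fst (u (Max p))) =
      (\<Prod>i\<in>p \<inter> T. (-1) ^ card (below L i))"
      unfolding mm using u ab par by (cases "a \<in> T") (auto simp: Int_insert_left)
  qed
  also have "\<dots> = (\<Prod>i\<in>(\<Union>p\<in>\<rho>. p \<inter> T). (-1) ^ card (below L i))"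
    by (subst prod.UNION_disjoint)
      (use pairing_finite[OF \<rho>(1,3)] pairing_disjoint[OF \<rho>(1)] finite_subset[OF T \<rho>(3)] in auto)
  also have "(\<Union>p\<in>\<rho>. p \<inter> T) = T" using pairing_Union[OF \<rho>(1)] T by auto
  finally show ?thesis using True by simp
next
  case False
  then obtain a b where ab: "a \<noteq> b" "{a, b} \<in> \<rho>" "(a \<in> T) = (b \<in> T)" by (auto simp: separates_def)
  have abL: "a \<in> L" "b \<in> L" using \<rho>(1) ab(2) by (auto simp: is_pairing_def)
  have "Min {a, b} \<in> {a, b}" "Max {a, b} \<in> {a, b}" by (auto simp: min_def max_def)
  then have "u (Min {a, b}) = u (Max {a, b})" using u abL ab(3) by auto
  then have "\<exists>p\<in>\<rho>. (-1) ^ card (below L (Min p)) *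
      (fst (u (Min p)) * snd (u (Max p)) - snd (u (Min p)) * fst (u (Max p))) = 0"
    using ab(2) by (intro bexI[of _ "{a, b}"]) auto
  then show ?thesis using False pairing_finite[OF \<rho>(1,3)] by (simp add: prod_zero_iff)
qed

lemma pairing_remove:
  assumes "is_pairing L \<rho>" "p \<in> \<rho>"
  shows "is_pairing (L - p) (\<rho> - {p})"
  unfolding is_pairing_def
proof (intro conjI ballI)
  fix q assume q: "q \<in> \<rho> - {p}"
  then show "card q = 2" using assms(1) by (auto simp: is_pairing_def)
  have "q \<subseteq> L" using q assms(1) by (auto simp: is_pairing_def)
  moreover have "q \<inter> p = {}" using pairing_disjoint[OF assms(1) _ assms(2), of q] q by blast
  ultimately show "q \<subseteq> L - p" by blast
next
  fix a assume a: "a \<in> L - p"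
  then have "\<exists>!q. q \<in> \<rho> \<and> a \<in> q" using assms(1) by (simp add: is_pairing_def)
  then obtain q where q: "q \<in> \<rho>" "a \<in> q" by (elim ex1E conjE)
  show "\<exists>!q. q \<in> \<rho> - {p} \<and> a \<in> q"
    by (rule ex1I[of _ q]) (use q a pairing_disjoint[OF assms(1)] in auto)
qed

lemma planar_subset: "planar_pairing \<rho> \<Longrightarrow> \<rho>' \<subseteq> \<rho> \<Longrightarrow> planar_pairing \<rho>'"
  unfolding planar_pairing_def by blast

text \<open>Any label strictly inside a pair has its partner inside as well, so one can descend to
  an innermost pair.\<close>

lemma planar_ear:
  assumes \<rho>: "is_pairing L \<rho>" "planar_pairing \<rho>" "finite L" and ac: "{a, c} \<in> \<rho>" "a < c"
  shows "\<exists>i j. {i, j} \<in> \<rho> \<and> a \<le> i \<and> i < j \<and> j \<le> c \<and> between L i j = {}"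
  using ac
proof (induction "c - a" arbitrary: a c rule: less_induct)
  case less
  show ?case
  proof (cases "between L a c = {}")
    case True
    then show ?thesis using less.prems by blast
  next
    case False
    then obtain z where z: "z \<in> L" "a < z" "z < c" using less.prems by (auto simp: between_def)
    obtain \<pi> where pi: "\<And>a. a \<in> L \<Longrightarrow> \<pi> a \<in> L \<and> \<pi> a \<noteq> a \<and> \<pi> (\<pi> a) = a"
      "\<And>a b. a \<in> L \<Longrightarrow> a \<noteq> b \<Longrightarrow> {a, b} \<in> \<rho> \<longleftrightarrow> b = \<pi> a"
      by (rule pairing_partner[OF \<rho>(1)]) (rule that)
    have zz: "{z, \<pi> z} \<in> \<rho>" "\<pi> z \<noteq> z" using pi(1)[OF z(1)] pi(2)[OF z(1), of "\<pi> z"] by auto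
    have zb: "a < \<pi> z" "\<pi> z < c"
      using planar_partner_between[OF \<rho>(1,2) less.prems z zz(1)] zz(2) by auto
    define i j where "i = min z (\<pi> z)" and "j = max z (\<pi> z)"
    have ij: "i < j" "a < i" "j < c" using zz(2) z zb by (auto simp: i_def j_def min_def max_def)
    have "{i, j} = {z, \<pi> z}" by (auto simp: i_def j_def min_def max_def)
    then have "{i, j} \<in> \<rho>" using zz(1) by simp
    moreover have "j - i < c - a" using ij by linarith
    ultimately obtain i' j' where "{i', j'} \<in> \<rho>" "i \<le> i'" "i' < j'" "j' \<le> j" "between L i' j' = {}"
      using less.hyps[of j i] ij(1) by blast
    then show ?thesis using ij by (intro exI[of _ i'] exI[of _ j']) auto
  qed
qed

section \<open>Parity of tripartite pairings in terms of colour blocks\<close>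

definition contrasting :: "nat \<Rightarrow> nat \<Rightarrow> bool" where
  "contrasting p q \<longleftrightarrow> p \<noteq> q \<and> {p, q} \<noteq> {1, 4}"

definition contrasts :: "(nat \<Rightarrow> nat) \<Rightarrow> nat set set \<Rightarrow> bool" where
  "contrasts k \<rho> \<longleftrightarrow> (\<forall>a b. {a, b} \<in> \<rho> \<longrightarrow> a \<noteq> b \<longrightarrow> contrasting (k a) (k b))"

definition block_count :: "(nat \<Rightarrow> nat) \<Rightarrow> nat set \<Rightarrow> nat \<Rightarrow> int" where
  "block_count k L q = int (card {i \<in> L. k i = q})"

text \<open>
  Blocks \<open>1\<close> and \<open>4\<close> carry the same colour: they are the two ends of a circularly contiguous colour class that
  is cut at the label \<open>1\<close>. For a tripartite pairing of \<open>m\<close> pairs with \<open>c\<^sub>q\<close> nodes in block \<open>q\<close>, the number of pairs whose smaller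
  node has odd rank (counted from \<open>0\<close>) is congruent to \<open>tri_exponent\<close> modulo \<open>2\<close>. For \<open>c\<^sub>4 = 0\<close> the three quotients
  come from the classes of sizes \<open>c\<^sub>1\<close> and \<open>c\<^sub>3\<close> and from the \<open>m - c\<^sub>2\<close> pairs joining blocks \<open>1\<close> and \<open>3\<close>; rotating one
  node from the end to the front changes the count by \<open>m - 1\<close>.
\<close>
definition tri_exponent :: "int \<Rightarrow> int \<Rightarrow> int \<Rightarrow> int \<Rightarrow> int" where
  "tri_exponent c1 c2 c3 c4 = (let m = (c1 + c2 + c3 + c4) div 2 in
     (c1 + c4) div 2 + c3 div 2 + (m - c2) div 2 + c4 * (m - 1))"

definition block_exponent :: "(nat \<Rightarrow> nat) \<Rightarrow> nat set \<Rightarrow> int" where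
  "block_exponent k L = tri_exponent (block_count k L 1) (block_count k L 2) (block_count k L 3) (block_count k L 4)"

lemma contrasting_cases:
  assumes "p \<in> {1..4}" "q \<in> {1..4}" "p < q" "contrasting p q"
  shows "(p, q) \<in> {(1, 2), (1, 3), (2, 3), (2, 4), (3, 4)}"
proof -
  have "p \<in> {1, 2, 3, 4}" "q \<in> {1, 2, 3, 4}" using assms by auto
  then show ?thesis using assms by (auto simp: contrasting_def)
qed

text \<open>The five possible ears join blocks 1-2, 1-3, 2-3, 2-4 and 3-4. The summand in front of
  \<open>tri_exponent\<close> is the rank of the smaller node, which is the last one of its block.
  An ear that skips a block requires it to be empty, and then the remaining colours balance.\<close>

lemma tri_exponent_remove:
  fixes x1 x2 x3 x4 :: int
  assumes ev: "even (x1 + x2 + x3 + x4)"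
  shows "even (x1 - 1 + tri_exponent (x1 - 1) (x2 - 1) x3 x4) \<longleftrightarrow> even (tri_exponent x1 x2 x3 x4)"
    and "x2 = 0 \<Longrightarrow> x3 = x1 + x4 \<Longrightarrow> even (x1 - 1 + tri_exponent (x1 - 1) x2 (x3 - 1) x4) \<longleftrightarrow> even (tri_exponent x1 x2 x3 x4)"
    and "even (x1 + x2 - 1 + tri_exponent x1 (x2 - 1) (x3 - 1) x4) \<longleftrightarrow> even (tri_exponent x1 x2 x3 x4)"
    and "x3 = 0 \<Longrightarrow> x2 = x1 + x4 \<Longrightarrow> even (x1 + x2 - 1 + tri_exponent x1 (x2 - 1) x3 (x4 - 1)) \<longleftrightarrow> even (tri_exponent x1 x2 x3 x4)"
    and "even (x1 + x2 + x3 - 1 + tri_exponent x1 x2 (x3 - 1) (x4 - 1)) \<longleftrightarrow> even (tri_exponent x1 x2 x3 x4)"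
proof -
  obtain m where m: "x1 + x2 + x3 + x4 = 2 * m" using ev by (elim evenE)
  have T: "tri_exponent y1 y2 y3 y4 = (y1 + y4) div 2 + y3 div 2 + (m - 1 - y2) div 2 + y4 * (m - 2)"
    if "y1 + y2 + y3 + y4 + 2 = x1 + x2 + x3 + x4" for y1 y2 y3 y4
  proof -
    have "(y1 + y2 + y3 + y4) div 2 = m - 1" using that m by linarith
    then show ?thesis by (simp add: tri_exponent_def Let_def)
  qed
  have T0: "tri_exponent x1 x2 x3 x4 = (x1 + x4) div 2 + x3 div 2 + (m - x2) div 2 + x4 * (m - 1)"
    using m by (simp add: tri_exponent_def Let_def)
  have half: "(x - 1) div 2 = x div 2 - of_bool (even x)" for x :: int
    by (cases "even x") (auto elim!: evenE oddE)
  have h: "(x1 - 1 + x4) div 2 = (x1 + x4) div 2 - of_bool (even (x1 + x4))"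
    "(x1 + (x4 - 1)) div 2 = (x1 + x4) div 2 - of_bool (even (x1 + x4))"
    "(m - 1 - x2) div 2 = (m - x2) div 2 - of_bool (even (m - x2))"
    "m - 1 - (x2 - 1) = m - x2"
    using half[of "x1 + x4"] half[of "m - x2"] by (simp_all add: algebra_simps)
  have n: "x4 * (m - 2) = x4 * (m - 1) - x4" "(x4 - 1) * (m - 2) = x4 * (m - 1) - x4 - m + 2"
    by (simp_all add: algebra_simps)
  have evI: "even a \<longleftrightarrow> even b" if "a = b + d" "even d" for a b d :: int using that by simp
  \<comment> \<open>Replaces \<open>of_bool (even z)\<close> by an arbitrary integer of the parity
    of \<open>z + 1\<close>, so that the corrections from halving become linear conditions modulo
    2.\<close>
  have par: "even (f (of_bool (even (x1 + x4))) (of_bool (even x3)) (of_bool (even (m - x2))))"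
    if "\<And>p q r. even (x1 + x4 + p + 1) \<Longrightarrow> even (x3 + q + 1) \<Longrightarrow> even (m - x2 + r + 1) \<Longrightarrow> even (f p q r)"
    for f :: "int \<Rightarrow> int \<Rightarrow> int \<Rightarrow> int"
    by (rule that) auto
  show "even (x1 - 1 + tri_exponent (x1 - 1) (x2 - 1) x3 x4) \<longleftrightarrow> even (tri_exponent x1 x2 x3 x4)"
  proof (rule evI)
    have "tri_exponent (x1 - 1) (x2 - 1) x3 x4 = (x1 - 1 + x4) div 2 + x3 div 2 + (m - 1 - (x2 - 1)) div 2 + x4 * (m - 2)"
      by (subst T) simp_all
    then show "x1 - 1 + tri_exponent (x1 - 1) (x2 - 1) x3 x4 = tri_exponent x1 x2 x3 x4 + (x1 - 1 - of_bool (even (x1 + x4)) - x4)"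
      unfolding T0 h n half by linarith
    show "even (x1 - 1 - of_bool (even (x1 + x4)) - x4)"
      by (rule par[of "\<lambda>p q r. x1 - 1 - p - x4"]) (use ev in auto)
  qed
  show "even (x1 - 1 + tri_exponent (x1 - 1) x2 (x3 - 1) x4) \<longleftrightarrow> even (tri_exponent x1 x2 x3 x4)" if c: "x2 = 0" "x3 = x1 + x4"
  proof (rule evI)
    have mc: "m = x1 + x4" using m c by linarith
    have "tri_exponent (x1 - 1) x2 (x3 - 1) x4 = (x1 - 1 + x4) div 2 + (x3 - 1) div 2 + (m - 1 - x2) div 2 + x4 * (m - 2)"
      by (subst T) simp_all
    then show "x1 - 1 + tri_exponent (x1 - 1) x2 (x3 - 1) x4 = tri_exponent x1 x2 x3 x4 + (x1 - 1 - of_bool (even (x1 + x4)) - of_bool (even x3) - of_bool (even (m - x2)) - x4)"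
      unfolding T0 h n half by linarith
    show "even (x1 - 1 - of_bool (even (x1 + x4)) - of_bool (even x3) - of_bool (even (m - x2)) - x4)"
      by (rule par[of "\<lambda>p q r. x1 - 1 - p - q - r - x4"]) (use mc in \<open>auto simp: c\<close>)
  qed
  show "even (x1 + x2 - 1 + tri_exponent x1 (x2 - 1) (x3 - 1) x4) \<longleftrightarrow> even (tri_exponent x1 x2 x3 x4)"
  proof (rule evI)
    have "tri_exponent x1 (x2 - 1) (x3 - 1) x4 = (x1 + x4) div 2 + (x3 - 1) div 2 + (m - 1 - (x2 - 1)) div 2 + x4 * (m - 2)"
      by (subst T) simp_all
    then show "x1 + x2 - 1 + tri_exponent x1 (x2 - 1) (x3 - 1) x4 = tri_exponent x1 x2 x3 x4 + (x1 + x2 - 1 - of_bool (even x3) - x4)"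
      unfolding T0 h n half by linarith
    show "even (x1 + x2 - 1 - of_bool (even x3) - x4)"
      by (rule par[of "\<lambda>p q r. x1 + x2 - 1 - q - x4"]) (use ev in auto)
  qed
  show "even (x1 + x2 - 1 + tri_exponent x1 (x2 - 1) x3 (x4 - 1)) \<longleftrightarrow> even (tri_exponent x1 x2 x3 x4)" if c: "x3 = 0" "x2 = x1 + x4"
  proof (rule evI)
    have mc: "m = x1 + x4" using m c by linarith
    have "tri_exponent x1 (x2 - 1) x3 (x4 - 1) = (x1 + (x4 - 1)) div 2 + x3 div 2 + (m - 1 - (x2 - 1)) div 2 + (x4 - 1) * (m - 2)"
      by (subst T) simp_all
    then show "x1 + x2 - 1 + tri_exponent x1 (x2 - 1) x3 (x4 - 1) = tri_exponent x1 x2 x3 x4 + (x1 + x2 - 1 - of_bool (even (x1 + x4)) - x4 - m + 2)"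
      unfolding T0 h n half by linarith
    show "even (x1 + x2 - 1 - of_bool (even (x1 + x4)) - x4 - m + 2)"
      by (rule par[of "\<lambda>p q r. x1 + x2 - 1 - p - x4 - m + 2"]) (use mc in \<open>auto simp: c\<close>)
  qed
  show "even (x1 + x2 + x3 - 1 + tri_exponent x1 x2 (x3 - 1) (x4 - 1)) \<longleftrightarrow> even (tri_exponent x1 x2 x3 x4)"
  proof (rule evI)
    have "tri_exponent x1 x2 (x3 - 1) (x4 - 1) = (x1 + (x4 - 1)) div 2 + (x3 - 1) div 2 + (m - 1 - x2) div 2 + (x4 - 1) * (m - 2)"
      by (subst T) simp_all
    then show "x1 + x2 + x3 - 1 + tri_exponent x1 x2 (x3 - 1) (x4 - 1) = tri_exponent x1 x2 x3 x4 + (x1 + x2 + x3 - 1 - of_bool (even (x1 + x4)) - of_bool (even x3) - of_bool (even (m - x2)) - x4 - m + 2)"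
      unfolding T0 h n half by linarith
    show "even (x1 + x2 + x3 - 1 - of_bool (even (x1 + x4)) - of_bool (even x3) - of_bool (even (m - x2)) - x4 - m + 2)"
      by (rule par[of "\<lambda>p q r. x1 + x2 + x3 - 1 - p - q - r - x4 - m + 2"]) (use ev in auto)
  qed
qed

text \<open>Uniform version of the five cases: \<open>b\<close> is the rank of the smaller node of
  an ear between blocks \<open>p\<close> and \<open>q\<close>, and \<open>c'\<close> holds the block
  sizes after its removal.\<close>

lemma tri_exponent_ear:
  fixes c :: "nat \<Rightarrow> int"
  assumes ev: "even (c 1 + c 2 + c 3 + c 4)"
    and pq: "(p, q) \<in> {(1, 2), (1, 3), (2, 3), (2, 4), (3, 4)}"
    and z: "\<And>r. p < r \<Longrightarrow> r < q \<Longrightarrow> c r = 0"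
    and bal: "c 2 = 0 \<Longrightarrow> c 3 = c 1 + c 4" "c 3 = 0 \<Longrightarrow> c 2 = c 1 + c 4"
    and b: "int b + 1 = (\<Sum>r\<in>{1..p}. c r)"
    and c': "\<And>r. c' r = c r - of_bool (r = p) - of_bool (r = q)"
  shows "even (int b + tri_exponent (c' 1) (c' 2) (c' 3) (c' 4)) \<longleftrightarrow> even (tri_exponent (c 1) (c 2) (c 3) (c 4))"
proof -
  note R = tri_exponent_remove[OF ev]
  have s: "(\<Sum>r\<in>{1..1}. c r) = c 1" "(\<Sum>r\<in>{1..2}. c r) = c 1 + c 2" "(\<Sum>r\<in>{1..3}. c r) = c 1 + c 2 + c 3"
    by (simp_all add: numeral_eq_Suc)
  have z2: "p = 1 \<Longrightarrow> q = 3 \<Longrightarrow> c 2 = 0" and z3: "p = 2 \<Longrightarrow> q = 4 \<Longrightarrow> c 3 = 0" using z by auto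
  consider "p = 1" "q = 2" | "p = 1" "q = 3" | "p = 2" "q = 3" | "p = 2" "q = 4" | "p = 3" "q = 4"
    using pq by auto
  then show ?thesis
  proof cases
    case 1
    then have "int b = c 1 - 1" "c' 1 = c 1 - 1" "c' 2 = c 2 - 1" "c' 3 = c 3" "c' 4 = c 4" using b s by (auto simp: c')
    then show ?thesis using R(1) by (simp only:)
  next
    case 2
    then have "int b = c 1 - 1" "c' 1 = c 1 - 1" "c' 2 = c 2" "c' 3 = c 3 - 1" "c' 4 = c 4" using b s by (auto simp: c')
    then show ?thesis using R(2)[OF z2[OF 2] bal(1)[OF z2[OF 2]]] by (simp only:)
  next
    case 3
    then have "int b = c 1 + c 2 - 1" "c' 1 = c 1" "c' 2 = c 2 - 1" "c' 3 = c 3 - 1" "c' 4 = c 4" using b s by (auto simp: c')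
    then show ?thesis using R(3) by (simp only:)
  next
    case 4
    then have "int b = c 1 + c 2 - 1" "c' 1 = c 1" "c' 2 = c 2 - 1" "c' 3 = c 3" "c' 4 = c 4 - 1" using b s by (auto simp: c')
    then show ?thesis using R(4)[OF z3[OF 4] bal(2)[OF z3[OF 4]]] by (simp only:)
  next
    case 5
    then have "int b = c 1 + c 2 + c 3 - 1" "c' 1 = c 1" "c' 2 = c 2" "c' 3 = c 3 - 1" "c' 4 = c 4 - 1" using b s by (auto simp: c')
    then show ?thesis using R(5) by (simp only:)
  qed
qed

lemma pairing_card_separated:
  assumes "is_pairing L \<rho>" "finite L" "A \<subseteq> L" "separates A \<rho>"
  shows "card L = 2 * card A"
proof -
  have one: "card (p \<inter> A) = 1" if "p \<in> \<rho>" for p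
  proof -
    obtain a b where "p = {a, b}" "a < b" "a \<in> L" "b \<in> L" using pairing_pair[OF assms(1) \<open>p \<in> \<rho>\<close>] .
    then have "(a \<in> A) \<noteq> (b \<in> A)" using assms(4) that by (metis less_irrefl separates_def)
    then show ?thesis using \<open>p = {a, b}\<close> by (auto simp: Int_insert_left)
  qed
  have fin: "finite p" if "p \<in> \<rho>" for p using assms(1,2) that by (auto simp: is_pairing_def intro: finite_subset)
  have "card (\<Union>p\<in>\<rho>. p \<inter> B) = (\<Sum>p\<in>\<rho>. card (p \<inter> B))" for B
    by (rule card_UN_disjoint) (use pairing_finite[OF assms(1,2)] pairing_disjoint[OF assms(1)] fin in auto)
  moreover have "(\<Union>p\<in>\<rho>. p \<inter> A) = A" "(\<Union>p\<in>\<rho>. p \<inter> L) = L"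
    using pairing_Union[OF assms(1)] assms(3) by auto
  moreover have "(\<Sum>p\<in>\<rho>. card (p \<inter> A)) = card \<rho>" using one by simp
  moreover have "(\<Sum>p\<in>\<rho>. card (p \<inter> L)) = 2 * card \<rho>"
  proof -
    have "card (p \<inter> L) = 2" if "p \<in> \<rho>" for p using assms(1) that by (auto simp: is_pairing_def Int_absorb2)
    then show ?thesis by simp
  qed
  ultimately show ?thesis by metis
qed

lemma card_blocks:
  assumes "finite L" "\<And>i. i \<in> L \<Longrightarrow> k i \<in> {1..4 :: nat}"
  shows "int (card {i \<in> L. k i \<le> p}) = (\<Sum>r\<in>{1..p}. block_count k L r)"
proof -
  have "{i \<in> L. k i \<le> p} = (\<Union>r\<in>{1..p}. {i \<in> L. k i = r})" using assms(2) by fastforce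
  then have "card {i \<in> L. k i \<le> p} = (\<Sum>r\<in>{1..p}. card {i \<in> L. k i = r})"
    by (simp only:) (rule card_UN_disjoint, use assms(1) in auto)
  then show ?thesis by (simp add: block_count_def)
qed

text \<open>Induction by removing an ear. It contributes the rank of its smaller node, computed from
  the block sizes because that node is the last of its block, and \<open>tri_exponent\<close>
  changes accordingly.\<close>

theorem pairing_sign:
  assumes "is_pairing L \<rho>" "planar_pairing \<rho>" "finite L"
    and "\<And>i. i \<in> L \<Longrightarrow> k i \<in> {1..4}" and "\<And>i j. i \<in> L \<Longrightarrow> j \<in> L \<Longrightarrow> i \<le> j \<Longrightarrow> k i \<le> k j"
    and "contrasts k \<rho>"
  shows "even (\<Sum>p\<in>\<rho>. card (below L (Min p))) \<longleftrightarrow> even (block_exponent k L)"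
  using assms
proof (induction "card L" arbitrary: L \<rho> rule: less_induct)
  case less
  note \<rho> = less.prems(1-3) and k = less.prems(4,5)
  show ?case
  proof (cases "\<rho> = {}")
    case True
    then have "L = {}" using pairing_Union[OF \<rho>(1)] by simp
    then show ?thesis using True by (simp add: block_exponent_def tri_exponent_def block_count_def)
  next
    case False
    then obtain p0 where "p0 \<in> \<rho>" by blast
    moreover obtain a c where "p0 = {a, c}" "a < c" "a \<in> L" "c \<in> L" using pairing_pair[OF \<rho>(1) \<open>p0 \<in> \<rho>\<close>] .
    ultimately obtain i j where ij: "{i, j} \<in> \<rho>" "i < j" "between L i j = {}"
      using planar_ear[OF \<rho>, of a c] by blast
    have ijL: "i \<in> L" "j \<in> L" using \<rho>(1) ij(1) by (auto simp: is_pairing_def)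
    have gap: "z \<le> i \<or> j \<le> z" if "z \<in> L" for z
      using ij(2,3) that by (auto simp: between_def min_def max_def not_less)
    have con: "contrasting (k i) (k j)" using less.prems(6) ij(1,2) unfolding contrasts_def by blast
    have klt: "k i < k j" using k(2)[OF ijL] ij(2) con by (auto simp: contrasting_def)
    define L' \<rho>' where "L' = L - {i, j}" and "\<rho>' = \<rho> - {{i, j}}"
    have \<rho>': "is_pairing L' \<rho>'" "planar_pairing \<rho>'" "finite L'"
      using pairing_remove[OF \<rho>(1) ij(1)] planar_subset[OF \<rho>(2)] \<rho>(3) by (auto simp: L'_def \<rho>'_def)
    have "card L' < card L" using ijL \<rho>(3) unfolding L'_def by (intro psubset_card_mono) auto
    then have IH: "even (\<Sum>p\<in>\<rho>'. card (below L' (Min p))) \<longleftrightarrow> even (block_exponent k L')"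
      by (rule less.hyps) (use \<rho>' k less.prems(6) in \<open>auto simp: L'_def \<rho>'_def contrasts_def\<close>)
    \<comment> \<open>No label lies inside the ear, so either both of its ends or neither precede a
      given label; ranks change by 0 or 2.\<close>
    have par: "even (card (below L (Min p))) \<longleftrightarrow> even (card (below L' (Min p)))" if p: "p \<in> \<rho>'" for p
    proof -
      obtain x y where xy: "p = {x, y}" "x < y" "x \<in> L'" "y \<in> L'" using pairing_pair[OF \<rho>'(1) p] .
      have m: "Min p = x" using xy by auto
      have x: "x \<in> L" "x \<noteq> i" "x \<noteq> j" using xy by (auto simp: L'_def)
      from gap[OF x(1)] x consider "x < i" | "j < x" by linarith
      then show ?thesis
      proof cases
        case 1
        then have "below L x = below L' x" using ij(2) by (auto simp: below_def L'_def)
        then show ?thesis by (simp add: m)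
      next
        case 2
        then have "below L x = insert i (insert j (below L' x))"
          using ij(2) ijL by (auto simp: below_def L'_def)
        moreover have "i \<notin> below L' x" "j \<notin> below L' x" by (auto simp: below_def L'_def)
        ultimately have "card (below L x) = Suc (Suc (card (below L' x)))"
          using ij(2) \<rho>'(3) by (simp add: below_def)
        then show ?thesis by (simp add: m)
      qed
    qed
    have "even (\<Sum>p\<in>\<rho>'. card (below L (Min p))) \<longleftrightarrow> even (\<Sum>p\<in>\<rho>'. card (below L' (Min p)))"
    proof -
      have "{p \<in> \<rho>'. odd (card (below L (Min p)))} = {p \<in> \<rho>'. odd (card (below L' (Min p)))}"
        using par by blast
      then show ?thesis using pairing_finite[OF \<rho>'(1,3)] by (simp add: even_sum_iff)
    qed
    moreover have "(\<Sum>p\<in>\<rho>. card (below L (Min p))) = card (below L i) + (\<Sum>p\<in>\<rho>'. card (below L (Min p)))"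
    proof -
      have "Min {i, j} = i" using ij(2) by simp
      then show ?thesis
        using sum.remove[OF pairing_finite[OF \<rho>(1,3)] ij(1), of "\<lambda>p. card (below L (Min p))"] by (simp only: \<rho>'_def)
    qed
    moreover have "even (int (card (below L i)) + block_exponent k L') \<longleftrightarrow> even (block_exponent k L)"
      unfolding block_exponent_def
    proof (rule tri_exponent_ear[where p = "k i" and q = "k j"])
      have "int (card L) = int (card {i \<in> L. k i \<le> 4})"
        using k(1) by (intro arg_cong[where f = int] arg_cong[where f = card]) auto
      also have "\<dots> = block_count k L 1 + block_count k L 2 + block_count k L 3 + block_count k L 4"
        by (subst card_blocks[OF \<rho>(3) k(1)]) (auto simp: numeral_eq_Suc)
      finally have total: "int (card L) = block_count k L 1 + block_count k L 2 + block_count k L 3 + block_count k L 4" .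
      then show "even (block_count k L 1 + block_count k L 2 + block_count k L 3 + block_count k L 4)"
        using pairing_card_even[OF \<rho>(1,3)] by (metis even_of_nat_iff)
      \<comment> \<open>If block 2 or 3 is empty, each pair has exactly one element in the other of
        these two, because blocks 1 and 4 do not contrast.\<close>
      have bal: "int (card L) = 2 * block_count k L q" if "block_count k L r = 0" "{r, q} = {2, 3}" for r q
      proof -
        have nr: "k a \<noteq> r" if "a \<in> L" for a
          using \<open>block_count k L r = 0\<close> \<rho>(3) that by (auto simp: block_count_def)
        have "separates {a \<in> L. k a = q} \<rho>"
          unfolding separates_def
        proof (intro allI impI)
          fix a b assume ab: "a \<noteq> b" "{a, b} \<in> \<rho>"
          have abL: "a \<in> L" "b \<in> L" using \<rho>(1) ab(2) by (auto simp: is_pairing_def)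
          have con: "contrasting (k a) (k b)" using less.prems(6) ab unfolding contrasts_def by blast
          have "k a \<in> {1, 2, 3, 4}" "k b \<in> {1, 2, 3, 4}" using k(1)[OF abL(1)] k(1)[OF abL(2)] by auto
          moreover have "(r = 2 \<and> q = 3) \<or> (r = 3 \<and> q = 2)" using that(2) by (auto simp: doubleton_eq_iff)
          ultimately show "(a \<in> {a \<in> L. k a = q}) \<noteq> (b \<in> {a \<in> L. k a = q})"
            using con nr[OF abL(1)] nr[OF abL(2)] abL unfolding contrasting_def by auto
        qed
        then have "card L = 2 * card {a \<in> L. k a = q}"
          by (intro pairing_card_separated[OF \<rho>(1,3)]) auto
        then show ?thesis by (simp add: block_count_def)
      qed
      show "block_count k L 2 = 0 \<Longrightarrow> block_count k L 3 = block_count k L 1 + block_count k L 4"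
        using bal[of 2 3] total by simp
      show "block_count k L 3 = 0 \<Longrightarrow> block_count k L 2 = block_count k L 1 + block_count k L 4"
        using bal[of 3 2] total by (simp add: insert_commute)
      show "(k i, k j) \<in> {(1, 2), (1, 3), (2, 3), (2, 4), (3, 4)}"
        by (rule contrasting_cases[OF k(1)[OF ijL(1)] k(1)[OF ijL(2)] klt con])
      show "block_count k L r = 0" if "k i < r" "r < k j" for r
      proof -
        have "k z \<noteq> r" if "z \<in> L" for z
          using gap[OF that] k(2)[OF that ijL(1)] k(2)[OF ijL(2) that] \<open>k i < r\<close> \<open>r < k j\<close> by auto
        then have "{i \<in> L. k i = r} = {}" by blast
        then show ?thesis unfolding block_count_def by (metis card.empty of_nat_0)
      qed
      have "insert i (below L i) = {z \<in> L. k z \<le> k i}"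
      proof (intro Set.set_eqI iffI)
        fix z assume "z \<in> insert i (below L i)"
        then show "z \<in> {z \<in> L. k z \<le> k i}" using k(2)[of z i] ijL by (auto simp: below_def)
      next
        fix z assume "z \<in> {z \<in> L. k z \<le> k i}"
        then show "z \<in> insert i (below L i)"
          using gap[of z] k(2)[OF ijL(2), of z] klt by (auto simp: below_def)
      qed
      moreover have "card (insert i (below L i)) = Suc (card (below L i))"
        using \<rho>(3) by (simp add: below_def)
      ultimately show "int (card (below L i)) + 1 = (\<Sum>r\<in>{1..k i}. block_count k L r)"
        using card_blocks[of L k "k i", OF \<rho>(3) k(1)] by simp
      show "block_count k L' r = block_count k L r - of_bool (r = k i) - of_bool (r = k j)" for r
      proof -
        define B where "B = {z \<in> L'. k z = r}"
        have fin: "finite B" and nin: "i \<notin> B" "j \<notin> B" using \<rho>'(3) by (auto simp: B_def L'_def)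
        have B: "block_count k L' r = int (card B)" by (simp add: block_count_def B_def)
        consider "r = k i" | "r = k j" | "r \<noteq> k i" "r \<noteq> k j" by blast
        then show ?thesis
        proof cases
          case 1
          then have "{z \<in> L. k z = r} = insert i B" using ijL klt by (auto simp: L'_def B_def)
          then have "block_count k L r = int (card B) + 1" using fin nin by (simp add: block_count_def)
          then show ?thesis using 1 klt B by simp
        next
          case 2
          then have "{z \<in> L. k z = r} = insert j B" using ijL klt by (auto simp: L'_def B_def)
          then have "block_count k L r = int (card B) + 1" using fin nin by (simp add: block_count_def)
          then show ?thesis using 2 klt B by simp
        next
          case 3
          then have "{z \<in> L. k z = r} = B" using ijL by (auto simp: L'_def B_def)
          then have "block_count k L r = int (card B)" by (simp add: block_count_def)
          then show ?thesis using 3 B by simp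
        qed
      qed
    qed
    ultimately show ?thesis using IH by simp
  qed
qed

section \<open>Uniqueness of the tripartite pairing\<close>

definition contrast_ears :: "(nat \<Rightarrow> nat) \<Rightarrow> nat set \<Rightarrow> nat set set" where
  "contrast_ears k L = {{i, j} | i j. i < j \<and> i \<in> L \<and> j \<in> L \<and> contrasting (k i) (k j) \<and>
     (between L i j = {} \<or> (i = Min L \<and> j = Max L))}"

text \<open>Neighbours in different blocks occur only at the three transitions \<open>e 1\<close>,
  \<open>e 2\<close>, \<open>e 3\<close> between blocks; \<open>e0\<close> is the neighbouring pair
  across the cut. If both blocks 1 and 4 occur, \<open>e0\<close> does not contrast; otherwise block
  4 is empty and \<open>e 3\<close> drops out, or block 1 is empty and \<open>e 1\<close> drops
  out.\<close>

lemma contrast_ears_small: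
  assumes "finite L" and k: "\<And>i. i \<in> L \<Longrightarrow> k i \<in> {1..4}" "\<And>i j. i \<in> L \<Longrightarrow> j \<in> L \<Longrightarrow> i \<le> j \<Longrightarrow> k i \<le> k j"
  shows "finite (contrast_ears k L) \<and> card (contrast_ears k L) \<le> 3"
proof -
  define e where "e q = {Max {z \<in> L. k z \<le> q}, Min {z \<in> L. q < k z}}" for q
  define e0 where "e0 = {Min L, Max L}"
  have lin: "{i, j} = e (k i) \<and> k i < k j" if "i < j" "i \<in> L" "j \<in> L" "contrasting (k i) (k j)" "between L i j = {}" for i j
  proof -
    have lt: "k i < k j" using k(2)[of i j] that by (auto simp: contrasting_def)
    have gap: "z \<le> i \<or> j \<le> z" if "z \<in> L" for z
      using \<open>i < j\<close> \<open>between L i j = {}\<close> that by (auto simp: between_def min_def max_def not_less)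
    have "Max {z \<in> L. k z \<le> k i} = i"
    proof (rule Max_eqI)
      show "z \<le> i" if "z \<in> {z \<in> L. k z \<le> k i}" for z
        using gap[of z] k(2)[OF \<open>j \<in> L\<close>, of z] that lt by auto
    qed (use that assms in auto)
    moreover have "Min {z \<in> L. k i < k z} = j"
    proof (rule Min_eqI)
      show "j \<le> z" if "z \<in> {z \<in> L. k i < k z}" for z
        using gap[of z] k(2)[OF _ \<open>i \<in> L\<close>, of z] that by auto
    qed (use that assms lt in auto)
    ultimately show ?thesis using lt by (simp add: e_def)
  qed
  have ext: "Min L \<in> L" "Max L \<in> L" "Min L \<le> i" "i \<le> Max L" if "i \<in> L" for i
    using that assms(1) by (auto intro: Min_in Max_in)
  have sub: "p \<in> (if k (Min L) = 1 \<and> k (Max L) = 4 then {e 1, e 2, e 3}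
      else if k (Min L) = 1 then {e0, e 1, e 2} else {e0, e 2, e 3})" if p: "p \<in> contrast_ears k L" for p
  proof -
    obtain i j where ij: "p = {i, j}" "i < j" "i \<in> L" "j \<in> L" "contrasting (k i) (k j)"
      "between L i j = {} \<or> (i = Min L \<and> j = Max L)"
      using p by (auto simp: contrast_ears_def)
    have mn: "k (Min L) \<le> k i" "k j \<le> k (Max L)" "k (Min L) \<in> {1..4}" "k (Max L) \<in> {1..4}"
      using ext[OF ij(3)] ext[OF ij(4)] k ij(3,4) by blast+
    from ij(6) show ?thesis
    proof
      assume "between L i j = {}"
      then have l: "p = e (k i)" "k i < k j" using lin ij by auto
      have "k i \<in> {1..4}" "k j \<in> {1..4}" using k(1) ij by blast+
      then have "k i = 1 \<or> k i = 2 \<or> k i = 3" using l by auto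
      then show ?thesis using l mn by auto
    next
      assume e: "i = Min L \<and> j = Max L"
      then have "\<not> (k (Min L) = 1 \<and> k (Max L) = 4)" using ij(5) by (auto simp: contrasting_def)
      then show ?thesis using e ij(1) by (auto simp: e0_def)
    qed
  qed
  have three: "card {a, b, c} \<le> 3" for a b c :: "nat set" by (simp add: card_insert_if)
  obtain a b c where "contrast_ears k L \<subseteq> {a, b, c}"
  proof (cases "k (Min L) = 1 \<and> k (Max L) = 4")
    case True
    then show ?thesis using sub that[of "e 1" "e 2" "e 3"] by auto
  next
    case F: False
    show ?thesis
    proof (cases "k (Min L) = 1")
      case True
      then show ?thesis using F sub that[of e0 "e 1" "e 2"] by auto
    next
      case False
      then show ?thesis using sub that[of e0 "e 2" "e 3"] by auto
    qed
  qed
  then show ?thesis using three[of a b c] by (meson card_mono finite.emptyI finite_insert finite_subset order_trans)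
qed

text \<open>If the least label is paired with the greatest, that pair is one ear, closing up across
  the cut, and any further pair contains another. Otherwise the pairs of the least and of the
  greatest label span disjoint intervals, each containing an innermost pair.\<close>

lemma two_contrast_ears:
  assumes \<rho>: "is_pairing L \<rho>" "planar_pairing \<rho>" "finite L" "contrasts k \<rho>" and c: "2 < card L"
  shows "\<exists>p p'. p \<noteq> p' \<and> {p, p'} \<subseteq> \<rho> \<inter> contrast_ears k L"
proof -
  obtain \<pi> where pi: "\<And>a. a \<in> L \<Longrightarrow> \<pi> a \<in> L \<and> \<pi> a \<noteq> a \<and> \<pi> (\<pi> a) = a"
    "\<And>a b. a \<in> L \<Longrightarrow> a \<noteq> b \<Longrightarrow> {a, b} \<in> \<rho> \<longleftrightarrow> b = \<pi> a"
    by (rule pairing_partner[OF \<rho>(1)]) (rule that)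
  have ne: "L \<noteq> {}" using c by auto
  define a b where "a = Min L" and "b = Max L"
  have ab: "a \<in> L" "b \<in> L" and bounds: "\<And>z. z \<in> L \<Longrightarrow> a \<le> z \<and> z \<le> b"
    using ne \<rho>(3) by (auto simp: a_def b_def)
  have pair: "{z, \<pi> z} \<in> \<rho>" if "z \<in> L" for z using pi(1)[OF that] pi(2)[OF that, of "\<pi> z"] by auto
  have ear: "\<exists>i j. {i, j} \<in> \<rho> \<inter> contrast_ears k L \<and> x \<le> i \<and> i < j \<and> j \<le> y" if xy: "{x, y} \<in> \<rho>" "x < y" for x y
  proof -
    obtain i j where ij: "{i, j} \<in> \<rho>" "x \<le> i" "i < j" "j \<le> y" "between L i j = {}"
      using planar_ear[OF \<rho>(1-3) xy] by blast
    moreover have "i \<in> L" "j \<in> L" using ij(1) \<rho>(1) by (auto simp: is_pairing_def)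
    moreover have "contrasting (k i) (k j)" using \<rho>(4) ij(1,3) unfolding contrasts_def by blast
    ultimately show ?thesis unfolding contrast_ears_def by blast
  qed
  have aa: "a < \<pi> a" "\<pi> b < b" using pi(1)[OF ab(1)] pi(1)[OF ab(2)] bounds by (metis le_neq_implies_less)+
  show ?thesis
  proof (cases "\<pi> a = b")
    case True
    have "{a, b} \<in> \<rho>" using pair[OF ab(1)] True by simp
    moreover have lt: "a < b" using aa(1) True by simp
    moreover from calculation have "contrasting (k a) (k b)"
      using \<rho>(4) unfolding contrasts_def by (metis less_irrefl)
    ultimately have 1: "{a, b} \<in> \<rho> \<inter> contrast_ears k L"
      using ab unfolding contrast_ears_def a_def b_def by blast
    have "card {a, b} \<le> 2" by (simp add: card_insert_if)
    then have "L \<noteq> {a, b}" using c by auto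
    then obtain z where z: "z \<in> L" "z \<noteq> a" "z \<noteq> b" using ab by blast
    have z': "\<pi> z \<in> L" "\<pi> z \<noteq> z" "\<pi> z \<noteq> a" "\<pi> z \<noteq> b" using z pi(1) True ab by metis+
    have "{min z (\<pi> z), max z (\<pi> z)} = {z, \<pi> z}" by (auto simp: min_def max_def)
    then have "{min z (\<pi> z), max z (\<pi> z)} \<in> \<rho>" using pair[OF z(1)] by simp
    moreover have "min z (\<pi> z) < max z (\<pi> z)" using z' by (auto simp: min_def max_def)
    ultimately obtain i j where ij: "{i, j} \<in> \<rho> \<inter> contrast_ears k L" "min z (\<pi> z) \<le> i" "i < j" "j \<le> max z (\<pi> z)"
      using ear by blast
    have "a < i"
      using bounds[OF z(1)] bounds[OF z'(1)] z z' ij(2) by (auto simp: min_def split: if_splits)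
    then have "a \<notin> {i, j}" using ij(3) by auto
    then have "{a, b} \<noteq> {i, j}" by blast
    then show ?thesis using 1 ij(1) by (intro exI[of _ "{a, b}"] exI[of _ "{i, j}"]) simp
  next
    case False
    have pa: "\<pi> a \<in> L" "\<pi> (\<pi> a) = a" and pb: "\<pi> b \<in> L" "\<pi> (\<pi> b) = b" using pi(1) ab by blast+
    have lt: "\<pi> a < b" using False bounds[OF pa(1)] by linarith
    have b2: "{\<pi> b, b} \<in> \<rho>" using pair[OF ab(2)] by (simp add: insert_commute)
    have "\<pi> b \<noteq> \<pi> a" using pa(2) pb(2) lt aa(1) by auto
    moreover have "\<pi> b \<noteq> a" using False pb(2) by auto
    moreover have "\<not> (a < \<pi> b \<and> \<pi> b < \<pi> a)"
      using planar_partner_between[OF \<rho>(1,2) pair[OF ab(1)] aa(1) pb(1) _ _ b2] aa(2) lt by auto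
    ultimately have "\<pi> a < \<pi> b" using bounds[OF pb(1)] by linarith
    moreover obtain i j where ij: "{i, j} \<in> \<rho> \<inter> contrast_ears k L" "i < j" "j \<le> \<pi> a"
      using ear[OF pair[OF ab(1)] aa(1)] by blast
    moreover obtain i' j' where ij': "{i', j'} \<in> \<rho> \<inter> contrast_ears k L" "\<pi> b \<le> i'"  "i' < j'"
      using ear[OF b2 aa(2)] by blast
    ultimately have "{i, j} \<noteq> {i', j'}" by (auto simp: doubleton_eq_iff)
    then show ?thesis using ij(1) ij'(1) by (intro exI[of _ "{i, j}"] exI[of _ "{i', j'}"]) simp
  qed
qed

text \<open>
  Both pairings contain at least two of the at most three cyclically adjacent contrasting pairs, so they share one;
  remove it and proceed by induction.
\<close>
theorem contrasting_pairing_unique: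
  assumes "is_pairing L \<rho>" "planar_pairing \<rho>" "contrasts k \<rho>"
    and "is_pairing L \<sigma>" "planar_pairing \<sigma>" "contrasts k \<sigma>"
    and "finite L" and "\<And>i. i \<in> L \<Longrightarrow> k i \<in> {1..4}" and "\<And>i j. i \<in> L \<Longrightarrow> j \<in> L \<Longrightarrow> i \<le> j \<Longrightarrow> k i \<le> k j"
  shows "\<rho> = \<sigma>"
  using assms
proof (induction "card L" arbitrary: L \<rho> \<sigma> rule: less_induct)
  case less
  note \<rho> = less.prems(1-3) and \<sigma> = less.prems(4-6) and fin = less.prems(7) and k = less.prems(8,9)
  show ?case
  proof (cases "L = {}")
    case True
    then have "\<rho> \<subseteq> {}" "\<sigma> \<subseteq> {}" using \<rho>(1) \<sigma>(1) by (auto simp: is_pairing_def)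
    then show ?thesis by simp
  next
    case False
    have "\<exists>p. p \<in> \<rho> \<and> p \<in> \<sigma>"
    proof (cases "2 < card L")
      case True
      obtain p p' where p: "p \<noteq> p'" "{p, p'} \<subseteq> \<rho> \<inter> contrast_ears k L"
        using two_contrast_ears[OF \<rho>(1,2) fin \<rho>(3) True] by blast
      obtain q q' where q: "q \<noteq> q'" "{q, q'} \<subseteq> \<sigma> \<inter> contrast_ears k L"
        using two_contrast_ears[OF \<sigma>(1,2) fin \<sigma>(3) True] by blast
      have C: "finite (contrast_ears k L)" "card (contrast_ears k L) \<le> 3"
        using contrast_ears_small[of L k, OF fin k] by auto
      have "{p, p'} \<inter> {q, q'} \<noteq> {}"
      proof
        assume "{p, p'} \<inter> {q, q'} = {}"
        then have "card ({p, p'} \<union> {q, q'}) = 4" using p(1) q(1) by (subst card_Un_disjoint) auto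
        moreover have "card ({p, p'} \<union> {q, q'}) \<le> 3"
          using card_mono[OF C(1), of "{p, p'} \<union> {q, q'}"] C(2) p(2) q(2) by auto
        ultimately show False by simp
      qed
      then show ?thesis using p(2) q(2) by blast
    next
      case F: False
      have full: "p = L" if "is_pairing L \<tau>" "p \<in> \<tau>" for p \<tau>
        using that F card_seteq[OF fin, of p] by (auto simp: is_pairing_def)
      have "\<rho> \<noteq> {}" "\<sigma> \<noteq> {}" using False pairing_Union[OF \<rho>(1)] pairing_Union[OF \<sigma>(1)] by auto
      then show ?thesis using full[OF \<rho>(1)] full[OF \<sigma>(1)] by blast
    qed
    then obtain p where p: "p \<in> \<rho>" "p \<in> \<sigma>" by blast
    obtain a b where ab: "p = {a, b}" "a < b" "a \<in> L" "b \<in> L" using pairing_pair[OF \<rho>(1) p(1)] .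
    have "card (L - p) < card L" using ab fin by (intro psubset_card_mono) auto
    then have "\<rho> - {p} = \<sigma> - {p}"
    proof (rule less.hyps)
      show "is_pairing (L - p) (\<rho> - {p})" "is_pairing (L - p) (\<sigma> - {p})"
        using pairing_remove \<rho>(1) \<sigma>(1) p by blast+
      show "planar_pairing (\<rho> - {p})" "planar_pairing (\<sigma> - {p})"
        using planar_subset[OF \<rho>(2)] planar_subset[OF \<sigma>(2)] by blast+
    qed (use \<rho>(3) \<sigma>(3) fin k in \<open>auto simp: contrasts_def\<close>)
    then show ?thesis using p by blast
  qed
qed

section \<open>Dimer sums of a graph with nodes\<close>

text \<open>\<open>noncrossing\<close> is the combinatorial form in which planarity enters; it is
  stated for all subgraphs because it is applied to the single edges of an arbitrary
  configuration.\<close>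

locale dimer_nodes = bipartite_graph V1 V2 E
  for V1 V2 :: "'v set" and E :: "('v \<times> 'v) set" +
  fixes wt :: "('v \<times> 'v) \<Rightarrow> real" and N :: nat and node :: "nat \<Rightarrow> 'v"
  assumes node_inj: "inj_on node {1..N}" and node_V: "node ` {1..N} \<subseteq> V1 \<union> V2"
    and noncrossing: "\<And>H i j k l. H \<subseteq> E \<Longrightarrow> 1 \<le> i \<Longrightarrow> i < j \<Longrightarrow> j < k \<Longrightarrow> k < l \<Longrightarrow> l \<le> N \<Longrightarrow>
      edge_conn H (node i) (node k) \<Longrightarrow> edge_conn H (node j) (node l) \<Longrightarrow> edge_conn H (node i) (node j)"
begin

definition covered :: "nat set \<Rightarrow> 'v set" where
  "covered I = {v \<in> V1 \<union> V2. \<forall>i\<in>{1..N}. node i = v \<longrightarrow> (i \<in> I \<longleftrightarrow> v \<in> V2)}"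

definition minor :: "nat set \<Rightarrow> real" where
  "minor I = dimer_sum wt (covered I)"

definition joint_degree :: "nat set \<Rightarrow> nat set \<Rightarrow> 'v \<Rightarrow> nat" where
  "joint_degree I J v = of_bool (v \<in> covered I) + of_bool (v \<in> covered J)"

definition node_pairs :: "('v \<times> 'v) set \<Rightarrow> nat set \<Rightarrow> nat set set" where
  "node_pairs H L = {{i, j} | i j. i \<in> L \<and> j \<in> L \<and> i \<noteq> j \<and> edge_conn H (node i) (node j)}"

lemma node_pairs_iff:
  assumes "i \<in> L" "j \<in> L" "i \<noteq> j"
  shows "{i, j} \<in> node_pairs H L \<longleftrightarrow> edge_conn H (node i) (node j)"
  using assms edge_conn_sym unfolding node_pairs_def by (auto simp: doubleton_eq_iff)

lemma covered_node:
  assumes "i \<in> {1..N}"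
  shows "node i \<in> covered I \<longleftrightarrow> (i \<in> I \<longleftrightarrow> node i \<in> V2)"
proof -
  have "node i \<in> V1 \<union> V2" using node_V assms by blast
  moreover have "j = i" if "j \<in> {1..N}" "node j = node i" for j
    using inj_onD[OF node_inj that(2)] that(1) assms by blast
  ultimately show ?thesis using assms unfolding covered_def by blast
qed

lemma covered_other: "v \<in> V1 \<union> V2 \<Longrightarrow> v \<notin> node ` {1..N} \<Longrightarrow> v \<in> covered I"
  by (auto simp: covered_def)

lemma covered_outside: "v \<notin> V1 \<union> V2 \<Longrightarrow> v \<notin> covered I"
  by (auto simp: covered_def)

text \<open>The degrees of a superposition depend only on the intersection and union of the index
  sets. Hence all products in an exchange relation are sums over the same configurations.\<close>

lemma joint_degree_cong:
  assumes "I \<inter> J = I' \<inter> J'" "I \<union> J = I' \<union> J'"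
  shows "joint_degree I J = joint_degree I' J'"
proof
  fix v
  have e: "(i \<in> I \<and> i \<in> J) = (i \<in> I' \<and> i \<in> J')" "(i \<in> I \<or> i \<in> J) = (i \<in> I' \<or> i \<in> J')" for i
    using assms by blast+
  consider i where "i \<in> {1..N}" "v = node i" | "v \<in> V1 \<union> V2" "v \<notin> node ` {1..N}" | "v \<notin> V1 \<union> V2" by blast
  then show "joint_degree I J v = joint_degree I' J' v"
  proof cases
    case (1 i)
    then show ?thesis using e[of i] covered_node[OF 1(1)] unfolding joint_degree_def
      by (cases "i \<in> I"; cases "i \<in> J"; cases "i \<in> I'"; cases "i \<in> J'"; cases "node i \<in> V2") auto
  next
    case 2
    then show ?thesis by (simp add: joint_degree_def covered_other)
  next
    case 3
    then show ?thesis by (simp add: joint_degree_def covered_outside)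
  qed
qed

lemma uncovered_nodes:
  assumes "I \<subseteq> {1..N}" "J \<subseteq> {1..N}"
  shows "{v \<in> V1 \<union> V2. (v \<in> covered I) \<noteq> (v \<in> covered J)} = node ` ((I - J) \<union> (J - I))"
proof (intro Set.set_eqI iffI)
  fix v assume v: "v \<in> {v \<in> V1 \<union> V2. (v \<in> covered I) \<noteq> (v \<in> covered J)}"
  then have "v \<in> node ` {1..N}" using covered_other[of v] by blast
  then obtain i where i: "i \<in> {1..N}" "v = node i" by blast
  then have "(i \<in> I) \<noteq> (i \<in> J)" using v covered_node[OF i(1)] by auto
  then show "v \<in> node ` ((I - J) \<union> (J - I))" using i by blast
next
  fix v assume "v \<in> node ` ((I - J) \<union> (J - I))"
  then obtain i where i: "i \<in> (I - J) \<union> (J - I)" "v = node i" by blast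
  then have "i \<in> {1..N}" using assms by blast
  moreover from this have "v \<in> V1 \<union> V2" using node_V i(2) by blast
  ultimately show "v \<in> {v \<in> V1 \<union> V2. (v \<in> covered I) \<noteq> (v \<in> covered J)}"
    using i covered_node[of i] by auto
qed

context
  fixes I J L m
  assumes I: "I \<subseteq> {1..N}" and J: "J \<subseteq> {1..N}" and L: "L = (I - J) \<union> (J - I)"
    and m: "m \<in> configs (joint_degree I J)"
begin

lemma L_sub: "L \<subseteq> {1..N}"
  using I J L by blast

lemma star_one_iff: "card (star (singles E m) s) = 1 \<longleftrightarrow> s \<in> node ` L"
  using singles_star_one[of m "covered I" "covered J" s] m uncovered_nodes[OF I J] L
  unfolding joint_degree_def[abs_def] by blast

lemma star_le_two: "card (star (singles E m) s) \<le> 2"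
  by (rule singles_star_le2[OF m]) (simp add: joint_degree_def)

text \<open>The vertices of degree one are the nodes in \<open>L\<close>, and by
  \<open>component_two_ends\<close> each component containing one of them contains exactly
  two.\<close>

lemma node_pairs_pairing: "is_pairing L (node_pairs (singles E m) L)"
  unfolding is_pairing_def
proof (intro conjI ballI)
  fix p assume "p \<in> node_pairs (singles E m) L"
  then show "card p = 2" "p \<subseteq> L" by (auto simp: node_pairs_def)
next
  fix i assume i: "i \<in> L"
  let ?H = "singles E m"
  have H: "?H \<subseteq> E" by (auto simp: singles_def)
  have "card (star ?H (node i)) = 1" using star_one_iff i by blast
  then obtain b where b: "b \<noteq> node i" "{v. edge_conn ?H (node i) v \<and> card (star ?H v) = 1} = {node i, b}"
    using component_two_ends[OF H star_le_two] by blast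
  then have bc: "edge_conn ?H (node i) b" "b \<in> node ` L" using star_one_iff by blast+
  then obtain j where j: "j \<in> L" "b = node j" by blast
  have u: "j' = j" if "j' \<in> L" "j' \<noteq> i" "edge_conn ?H (node i) (node j')" for j'
  proof -
    have "card (star ?H (node j')) = 1" using star_one_iff that(1) by blast
    then have "node j' \<in> {node i, b}" using b(2) that(3) by blast
    moreover have "node j' \<noteq> node i" using inj_onD[OF node_inj] that(1,2) i L_sub by blast
    ultimately have "node j' = node j" using j(2) by blast
    then show ?thesis using inj_onD[OF node_inj] that(1) j(1) L_sub by blast
  qed
  show "\<exists>!p. p \<in> node_pairs ?H L \<and> i \<in> p"
  proof (rule ex1I[of _ "{i, j}"])
    show "{i, j} \<in> node_pairs ?H L \<and> i \<in> {i, j}"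
      using i j b(1) bc(1) unfolding node_pairs_def by blast
    fix p assume p: "p \<in> node_pairs ?H L \<and> i \<in> p"
    then obtain a c where ac: "p = {a, c}" "a \<in> L" "c \<in> L" "a \<noteq> c" "edge_conn ?H (node a) (node c)"
      unfolding node_pairs_def by blast
    show "p = {i, j}"
    proof (cases "i = a")
      case True
      then show ?thesis using u[of c] ac by auto
    next
      case False
      then have "i = c" using p ac(1) by blast
      then show ?thesis using u[of a] ac edge_conn_sym[OF ac(5)] by auto
    qed
  qed
qed

text \<open>By \<open>noncrossing\<close>, two crossing pairs would lie in one component, giving a
  label two partners.\<close>

lemma node_pairs_planar: "planar_pairing (node_pairs (singles E m) L)"
  unfolding planar_pairing_def
proof (intro notI, elim exE conjE)
  fix a b c d assume h: "{a, c} \<in> node_pairs (singles E m) L" "{b, d} \<in> node_pairs (singles E m) L"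
    "a < b" "b < c" "c < d"
  let ?H = "singles E m"
  have H: "?H \<subseteq> E" by (auto simp: singles_def)
  have in_L: "a \<in> L" "b \<in> L" "c \<in> L" "d \<in> L"
    using pairing_subset[OF node_pairs_pairing h(1)] pairing_subset[OF node_pairs_pairing h(2)] by auto
  have conn: "edge_conn ?H (node a) (node c)" "edge_conn ?H (node b) (node d)"
    using h node_pairs_iff in_L by auto
  have "edge_conn ?H (node a) (node b)"
    by (rule noncrossing[OF H _ h(3-5) _ conn]) (use in_L L_sub in auto)
  then have "{a, b} \<in> node_pairs ?H L" using node_pairs_iff[OF in_L(1,2)] h by auto
  then have "{a, b} = {a, c}"
    using pairing_disjoint[OF node_pairs_pairing _ h(1), of "{a, b}" a] by auto
  then show False using h by (auto simp: doubleton_eq_iff)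
qed

lemma compatible_iff_separates:
  "compatible (singles E m) (covered I) \<longleftrightarrow> separates I (node_pairs (singles E m) L)"
proof -
  let ?H = "singles E m"
  have lab: "(node i \<in> covered I \<longleftrightarrow> node i \<in> V2) \<longleftrightarrow> i \<in> I" if "i \<in> L" for i
    using covered_node[of i I] L_sub that by auto
  have ne: "node i \<noteq> node j" if "i \<in> L" "j \<in> L" "i \<noteq> j" for i j
    using inj_onD[OF node_inj] that L_sub by blast
  show ?thesis
  proof
    assume c: "compatible ?H (covered I)"
    show "separates I (node_pairs ?H L)"
      unfolding separates_def
    proof (intro allI impI)
      fix i j assume ij: "i \<noteq> j" "{i, j} \<in> node_pairs ?H L"
      then have "i \<in> L" "j \<in> L" using pairing_subset[OF node_pairs_pairing ij(2)] by auto
      moreover from this have "edge_conn ?H (node i) (node j)" using node_pairs_iff ij by blast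
      ultimately have "(node i \<in> covered I \<longleftrightarrow> node i \<in> V2) \<noteq> (node j \<in> covered I \<longleftrightarrow> node j \<in> V2)"
        using c ne[of i j] ij(1) star_one_iff unfolding compatible_def by blast
      then show "(i \<in> I) \<noteq> (j \<in> I)" using lab \<open>i \<in> L\<close> \<open>j \<in> L\<close> by simp
    qed
  next
    assume s: "separates I (node_pairs ?H L)"
    show "compatible ?H (covered I)"
      unfolding compatible_def
    proof (intro allI impI, elim conjE)
      fix a b assume ab: "a \<noteq> b" "edge_conn ?H a b" "card (star ?H a) = 1" "card (star ?H b) = 1"
      have "a \<in> node ` L" "b \<in> node ` L" using ab(3,4) star_one_iff by auto
      then obtain i j where ij: "i \<in> L" "a = node i" "j \<in> L" "b = node j" by blast
      then have "i \<noteq> j" using ab(1) by blast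
      then have "{i, j} \<in> node_pairs ?H L" using node_pairs_iff ij ab(2) by blast
      then have "(i \<in> I) \<noteq> (j \<in> I)" using s \<open>i \<noteq> j\<close> unfolding separates_def by blast
      then show "(a \<in> covered I \<longleftrightarrow> a \<in> V2) \<noteq> (b \<in> covered I \<longleftrightarrow> b \<in> V2)"
        using lab[OF ij(1)] lab[OF ij(3)] ij(2,4) by simp
    qed
  qed
qed

end

theorem minor_mult:
  assumes I: "I \<subseteq> {1..N}" and J: "J \<subseteq> {1..N}" and L: "L = (I - J) \<union> (J - I)"
  shows "minor I * minor J = (\<Sum>m\<in>configs (joint_degree I J).
    of_bool (separates I (node_pairs (singles E m) L)) * dd_weight E wt (node ` L) m)"
proof -
  have "minor I * minor J = (\<Sum>m\<in>configs (joint_degree I J).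
      if compatible (singles E m) (covered I) then dd_weight E wt (node ` L) m else 0)"
    unfolding minor_def joint_degree_def[abs_def]
    by (rule dimer_sum_mult) (use uncovered_nodes[OF I J] L in simp)
  also have "\<dots> = (\<Sum>m\<in>configs (joint_degree I J).
      of_bool (separates I (node_pairs (singles E m) L)) * dd_weight E wt (node ` L) m)"
    by (rule sum.cong[OF refl]) (simp add: compatible_iff_separates[OF I J L])
  finally show ?thesis .
qed

lemma separates_Int: "is_pairing L \<rho> \<Longrightarrow> separates (A \<inter> L) \<rho> \<longleftrightarrow> separates A \<rho>"
  unfolding separates_def is_pairing_def by (metis Int_iff insert_subset)

text \<open>A Pluecker exchange relation. Moving \<open>i\<close> and \<open>j\<close> between the
  index sets keeps their intersection and union, so the relation can be checked for one
  configuration at a time, where it is \<open>separates_exchange\<close> for the pairing of its path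
  ends.\<close>

theorem minor_exchange:
  assumes I: "I \<subseteq> {1..N}" and J: "J \<subseteq> {1..N}" and j: "j \<in> J - I" and L: "L = (I - J) \<union> (J - I)"
  shows "minor I * minor J =
    (\<Sum>i\<in>I - J. (-1) ^ card (between L i j) * (minor (insert j (I - {i})) * minor (insert i (J - {j}))))"
proof -
  let ?C = "configs (joint_degree I J)" and ?\<rho> = "\<lambda>m. node_pairs (singles E m) L"
  have finL: "finite L" using I J L finite_subset[of L "{1..N}"] by blast
  have sep: "separates I (?\<rho> m) \<longleftrightarrow> separates (I - J) (?\<rho> m)" if "m \<in> ?C" for m
  proof -
    have "I \<inter> L = I - J" using L by blast
    then show ?thesis using separates_Int[OF node_pairs_pairing[OF I J L that], of I] by simp
  qed
  have step: "minor (insert j (I - {i})) * minor (insert i (J - {j})) =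
      (\<Sum>m\<in>?C. of_bool (separates (insert j ((I - J) - {i})) (?\<rho> m)) * dd_weight E wt (node ` L) m)"
    if i: "i \<in> I - J" for i
  proof -
    let ?I = "insert j (I - {i})" and ?J = "insert i (J - {j})"
    have sub: "?I \<subseteq> {1..N}" "?J \<subseteq> {1..N}" using I J i j by auto
    have L': "L = (?I - ?J) \<union> (?J - ?I)" using i j L by auto
    have deg: "joint_degree ?I ?J = joint_degree I J"
      by (rule joint_degree_cong) (use i j in auto)
    have "separates ?I (?\<rho> m) \<longleftrightarrow> separates (insert j ((I - J) - {i})) (?\<rho> m)" if "m \<in> ?C" for m
    proof -
      have "?I \<inter> L = insert j ((I - J) - {i})" using L i j by auto
      then show ?thesis using separates_Int[OF node_pairs_pairing[OF I J L that], of ?I] by simp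
    qed
    then show ?thesis unfolding minor_mult[OF sub L'] deg by (intro sum.cong) auto
  qed
  have exch: "(of_bool (separates (I - J) (?\<rho> m)) :: real) =
      (\<Sum>i\<in>I - J. (-1) ^ card (between L i j) * of_bool (separates (insert j ((I - J) - {i})) (?\<rho> m)))"
    if "m \<in> ?C" for m
    by (rule separates_exchange[OF node_pairs_pairing[OF I J L that] node_pairs_planar[OF I J L that] finL])
      (use L j in auto)
  have "minor I * minor J = (\<Sum>m\<in>?C. of_bool (separates (I - J) (?\<rho> m)) * dd_weight E wt (node ` L) m)"
    unfolding minor_mult[OF I J L] by (intro sum.cong) (auto simp: sep)
  also have "\<dots> = (\<Sum>m\<in>?C. \<Sum>i\<in>I - J. (-1) ^ card (between L i j) *
      (of_bool (separates (insert j ((I - J) - {i})) (?\<rho> m)) * dd_weight E wt (node ` L) m))"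
    by (intro sum.cong[OF refl]) (simp add: exch sum_distrib_right mult.assoc)
  also have "\<dots> = (\<Sum>i\<in>I - J. (-1) ^ card (between L i j) *
      (minor (insert j (I - {i})) * minor (insert i (J - {j}))))"
    by (subst sum.swap) (intro sum.cong[OF refl], simp add: step sum_distrib_left)
  finally show ?thesis .
qed

end

section \<open>Realization by the minors of a matrix\<close>

lemma parity_card_between_sym_diff:
  assumes "finite A" "finite B"
  shows "(-1 :: real) ^ card (between ((A - B) \<union> (B - A)) i j) =
    (-1) ^ card (between A i j) * (-1) ^ card (between B i j)"
proof -
  let ?A = "between A i j" and ?B = "between B i j"
  have fin: "finite ?A" "finite ?B" using assms by (auto simp: between_def)
  have "between ((A - B) \<union> (B - A)) i j = (?A - ?B) \<union> (?B - ?A)" by (auto simp: between_def)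
  then have "card (between ((A - B) \<union> (B - A)) i j) = card (?A - ?B) + card (?B - ?A)"
    using fin by (simp add: card_Un_disjoint Diff_Int_distrib2 Int_Diff)
  moreover have "card ?A = card (?A - ?B) + card (?A \<inter> ?B)" "card ?B = card (?B - ?A) + card (?A \<inter> ?B)"
    using fin card_Int_Diff[of ?A ?B] card_Int_Diff[of ?B ?A] by (auto simp: Int_commute)
  ultimately have "card ?A + card ?B = card (between ((A - B) \<union> (B - A)) i j) + 2 * card (?A \<inter> ?B)" by simp
  then have "(-1 :: real) ^ (card ?A + card ?B) = (-1) ^ (card (between ((A - B) \<union> (B - A)) i j) + 2 * card (?A \<inter> ?B))"
    by (rule arg_cong)
  then show ?thesis by (simp add: power_add power_mult)
qed

lemma sorted_list_split:
  fixes j :: nat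
  assumes "finite J" "j \<in> J"
  obtains xs ys where "sorted_list_of_set J = xs @ j # ys" "sorted_list_of_set (J - {j}) = xs @ ys"
    "set xs = {z \<in> J. z < j}" "set ys = {z \<in> J. j < z}"
proof -
  obtain xs ys where s: "sorted_list_of_set J = xs @ j # ys"
    using assms split_list[of j "sorted_list_of_set J"] by auto
  have so: "sorted (xs @ j # ys)" "distinct (xs @ j # ys)" "set (xs @ j # ys) = J"
    unfolding s[symmetric] using assms(1) by simp_all
  have "sorted_list_of_set (J - {j}) = remove1 j (xs @ j # ys)"
    using assms s by (simp add: sorted_list_of_set_remove)
  also have "\<dots> = xs @ ys" using so(2) by (simp add: remove1_append)
  finally have r: "sorted_list_of_set (J - {j}) = xs @ ys" .
  have x: "z < j" if "z \<in> set xs" for z using so(1,2) that by (auto simp: sorted_append intro: le_neq_trans)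
  have y: "j < z" if "z \<in> set ys" for z using so(1,2) that by (auto simp: sorted_append intro: le_neq_trans)
  have "set xs = {z \<in> J. z < j}" "set ys = {z \<in> J. j < z}"
    using so(3) x y by (fastforce simp: set_eq_iff)+
  then show thesis using that s r by blast
qed

text \<open>Normalize the matrix to be the identity on the rows of a set \<open>I0\<close> with
  nonzero value; sets differing from \<open>I0\<close> in one element then dictate all other
  entries. The remaining values follow by induction on the distance to \<open>I0\<close>, because
  the row expansion of the determinant for \<open>J\<close> coincides with the exchange relation for
  \<open>I0\<close> and \<open>J\<close>.\<close>

theorem minors_realized:
  fixes \<Delta> :: "nat set \<Rightarrow> real"
  assumes exch: "\<And>I J j. I \<subseteq> {1..N} \<Longrightarrow> J \<subseteq> {1..N} \<Longrightarrow> card I = n \<Longrightarrow> card J = n \<Longrightarrow> j \<in> J - I \<Longrightarrow>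
    \<Delta> I * \<Delta> J = (\<Sum>i\<in>I - J. (-1) ^ card (between ((I - J) \<union> (J - I)) i j) *
      (\<Delta> (insert j (I - {i})) * \<Delta> (insert i (J - {j}))))"
  shows "\<exists>\<kappa> r. \<forall>I\<subseteq>{1..N}. card I = n \<longrightarrow> \<Delta> I = \<kappa> * list_det n (map r (sorted_list_of_set I))"
proof (cases "\<forall>I\<subseteq>{1..N}. card I = n \<longrightarrow> \<Delta> I = 0")
  case True
  then show ?thesis by (intro exI[of _ 0]) simp
next
  case False
  then obtain I0 where I0: "I0 \<subseteq> {1..N}" "card I0 = n" "\<Delta> I0 \<noteq> 0" by blast
  define l where "l = sorted_list_of_set I0"
  define \<kappa> where "\<kappa> = \<Delta> I0"
  \<comment> \<open>Replacing the unit row of \<open>l ! c\<close> by row \<open>j\<close> gives a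
    determinant equal to entry \<open>r j c\<close>; the power of -1 accounts for moving
    \<open>j\<close> to its sorted place.\<close>
  define r where "r j c = (if j \<in> I0 then of_bool (l ! c = j)
    else (-1) ^ card (between I0 (l ! c) j) * \<Delta> (insert j (I0 - {l ! c})) / \<kappa>)" for j c
  have finI0: "finite I0" using I0(1) finite_subset by blast
  have l: "set l = I0" "distinct l" "length l = n" using finI0 I0(2) by (auto simp: l_def)
  have lin: "l ! c \<in> I0" if "c < n" for c using l that nth_mem by metis
  have unit: "r (l ! c') c = of_bool (c = c')" if "c < n" "c' < n" for c c'
    using lin that l by (auto simp: r_def nth_eq_iff_index_eq)
  have base: "list_det n (map r l) = 1"
  proof -
    have "list_det n (map r l) = rows_det n (\<lambda>i j. of_bool (i = j))"
      unfolding list_det_def by (rule rows_det_cong) (use unit l in auto)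
    also have "\<dots> = 1"
    proof -
      have "Matrix.mat n n (\<lambda>(i, j). of_bool (i = j)) = (1\<^sub>m n :: real mat)" by (rule eq_matI) auto
      then show ?thesis by (simp add: rows_det_def)
    qed
    finally show ?thesis .
  qed
  have main: "\<Delta> J = \<kappa> * list_det n (map r (sorted_list_of_set J))" if "J \<subseteq> {1..N}" "card J = n" for J
    using that
  proof (induction "card (I0 - J)" arbitrary: J rule: less_induct)
    case less
    have finJ: "finite J" using less.prems(1) finite_subset by blast
    show ?case
    proof (cases "J \<subseteq> I0")
      case True
      then have "J = I0" using card_subset_eq[OF finI0] less.prems I0 by simp
      then show ?thesis using base by (simp add: \<kappa>_def l_def)
    next
      case False
      then obtain j where j: "j \<in> J" "j \<notin> I0" by blast
      obtain xs ys where s: "sorted_list_of_set J = xs @ j # ys" "sorted_list_of_set (J - {j}) = xs @ ys"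
        "set xs = {z \<in> J. z < j}" "set ys = {z \<in> J. j < z}"
        using sorted_list_split[OF finJ j(1)] .
      have len: "n = Suc (length xs + length ys)"
        using less.prems(2) finJ s(1) by (metis add_Suc_right length_Cons length_append length_sorted_list_of_set)
      have term0: "list_det n (map r (xs @ i # ys)) = 0" if "i \<in> I0 \<inter> J" for i
      proof (rule list_det_not_distinct)
        have "i \<in> J" "i \<noteq> j" using that j by auto
        then have "i \<in> set xs \<or> i \<in> set ys" unfolding s(3,4) by auto
        then have "r i \<in> r ` set xs \<or> r i \<in> r ` set ys" by blast
        then show "\<not> distinct (map r (xs @ i # ys))" by auto
      qed (use len in simp)
      have term1: "\<kappa> * list_det n (map r (xs @ i # ys)) =
          (-1) ^ card (between J i j) * \<Delta> (insert i (J - {j}))" if i: "i \<in> I0 - J" for i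
      proof -
        have ij: "i \<noteq> j" using i j by auto
        have "list_det n (map r (xs @ i # ys)) =
            (-1) ^ (card {z \<in> set xs. i < z} + card {z \<in> set ys. z < i}) * list_det n (map r (insort i (xs @ ys)))"
        proof (rule list_det_insort[OF len])
          show "sorted (xs @ ys)" "distinct (xs @ ys)" unfolding s(2)[symmetric] by simp_all
          show "i \<notin> set (xs @ ys)" using i s(3,4) by auto
        qed
        moreover have "insort i (xs @ ys) = sorted_list_of_set (insert i (J - {j}))"
          using i finJ s(2) by (simp add: sorted_list_of_set_insert)
        moreover have "card {z \<in> set xs. i < z} + card {z \<in> set ys. z < i} = card (between J i j)"
        proof -
          have "between J i j = {z \<in> set xs. i < z} \<union> {z \<in> set ys. z < i}"
            unfolding s(3,4) using ij by (auto simp: between_def min_def max_def)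
          moreover have "{z \<in> set xs. i < z} \<inter> {z \<in> set ys. z < i} = {}" by auto
          ultimately show ?thesis by (simp add: card_Un_disjoint)
        qed
        moreover have "\<Delta> (insert i (J - {j})) = \<kappa> * list_det n (map r (sorted_list_of_set (insert i (J - {j}))))"
        proof (rule less.hyps)
          have "I0 - insert i (J - {j}) \<subset> I0 - J" using i j by auto
          then show "card (I0 - insert i (J - {j})) < card (I0 - J)"
            using finI0 by (intro psubset_card_mono) auto
          show "insert i (J - {j}) \<subseteq> {1..N}" using i I0(1) less.prems(1) by auto
          show "card (insert i (J - {j})) = n" using i j(1) finJ less.prems(2) len by simp
        qed
        ultimately show ?thesis by simp
      qed
      have coef: "(\<Sum>c<n. r j c * f (l ! c)) = (\<Sum>i\<in>I0. (-1) ^ card (between I0 i j) * \<Delta> (insert j (I0 - {i})) / \<kappa> * f i)"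
        for f :: "nat \<Rightarrow> real"
        using sum.reindex_bij_betw[OF bij_betw_nth[OF l(2) refl l(1)[symmetric]],
            of "\<lambda>i. (-1) ^ card (between I0 i j) * \<Delta> (insert j (I0 - {i})) / \<kappa> * f i"] j(2)
        by (simp add: r_def l(3))
      have ln: "n = length (map r xs) + Suc (length (map r ys))" using len by simp
      \<comment> \<open>Expand row \<open>j\<close> in the unit rows of \<open>I0\<close>. Labels of
        \<open>I0\<close> that already occur in \<open>J\<close> give repeated rows, so only those
        in \<open>I0 - J\<close> survive, as in the exchange relation.\<close>
      have "list_det n (map r (xs @ j # ys)) = list_det n (map r xs @ (\<lambda>c. \<Sum>c'<n. r j c' * r (l ! c') c) # map r ys)"
      proof -
        have eq: "r j c = (\<Sum>c'<n. r j c' * r (l ! c') c)" if c: "c < n" for c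
        proof -
          have "(\<Sum>c'<n. r j c' * r (l ! c') c) = (\<Sum>c'<n. if c' = c then r j c else 0)"
            by (rule sum.cong) (use unit c in auto)
          then show ?thesis using c by simp
        qed
        show ?thesis unfolding map_append list.map by (rule list_det_cong1[OF ln]) (rule eq)
      qed
      also have "\<dots> = (\<Sum>c'<n. r j c' * list_det n (map r (xs @ (l ! c') # ys)))"
        unfolding map_append list.map by (rule list_det_sum[OF ln]) simp
      also have "\<dots> = (\<Sum>i\<in>I0. (-1) ^ card (between I0 i j) * \<Delta> (insert j (I0 - {i})) / \<kappa> * list_det n (map r (xs @ i # ys)))"
        by (rule coef)
      also have "\<dots> = (\<Sum>i\<in>I0 - J. (-1) ^ card (between I0 i j) * \<Delta> (insert j (I0 - {i})) / \<kappa> * list_det n (map r (xs @ i # ys)))"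
        by (rule sum.mono_neutral_right) (use finI0 term0 in auto)
      finally have "\<kappa> * \<kappa> * list_det n (map r (xs @ j # ys)) =
          (\<Sum>i\<in>I0 - J. \<kappa> * \<kappa> * ((-1) ^ card (between I0 i j) * \<Delta> (insert j (I0 - {i})) / \<kappa> * list_det n (map r (xs @ i # ys))))"
        by (simp only: sum_distrib_left)
      also have "\<dots> = (\<Sum>i\<in>I0 - J. (-1) ^ card (between I0 i j) * \<Delta> (insert j (I0 - {i})) * (\<kappa> * list_det n (map r (xs @ i # ys))))"
      proof -
        have "\<kappa> * \<kappa> * (p * q / \<kappa> * z) = p * q * (\<kappa> * z)" for p q z using I0(3) by (simp add: \<kappa>_def)
        then show ?thesis by simp
      qed
      also have "\<dots> = (\<Sum>i\<in>I0 - J. (-1) ^ card (between ((I0 - J) \<union> (J - I0)) i j) *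
          (\<Delta> (insert j (I0 - {i})) * \<Delta> (insert i (J - {j}))))"
      proof (rule sum.cong[OF refl])
        fix i assume i: "i \<in> I0 - J"
        show "(-1) ^ card (between I0 i j) * \<Delta> (insert j (I0 - {i})) * (\<kappa> * list_det n (map r (xs @ i # ys))) =
            (-1) ^ card (between ((I0 - J) \<union> (J - I0)) i j) * (\<Delta> (insert j (I0 - {i})) * \<Delta> (insert i (J - {j})))"
          unfolding term1[OF i] parity_card_between_sym_diff[OF finI0 finJ] by (simp only: mult_ac)
      qed
      also have "\<dots> = \<Delta> I0 * \<Delta> J"
        by (rule exch[symmetric]) (use I0 less.prems j in auto)
      finally show ?thesis using I0(3) s(1) by (simp add: \<kappa>_def)
    qed
  qed
  then show ?thesis by blast
qed

section \<open>Determinants whose rows are tensors with vectors of the plane\<close>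

definition tensor_row :: "nat \<Rightarrow> (nat \<Rightarrow> real) \<Rightarrow> real \<times> real \<Rightarrow> nat \<Rightarrow> real" where
  "tensor_row n m u = (\<lambda>j. fst u * top_vec n m j + snd u * bot_vec n m j)"

definition item_row :: "nat \<Rightarrow> bool \<times> (nat \<Rightarrow> real) \<Rightarrow> nat \<Rightarrow> real" where
  "item_row n p = (if fst p then top_vec n (snd p) else bot_vec n (snd p))"

text \<open>The number of adjacent swaps that bring all top items before the bottom items;
  \<open>b\<close> counts the bottom items already passed.\<close>

fun inversions :: "nat \<Rightarrow> (bool \<times> 'a) list \<Rightarrow> nat" where
  "inversions b [] = 0"
| "inversions b (p # ps) = (if fst p then b + inversions b ps else inversions (Suc b) ps)"

definition tops :: "(bool \<times> 'a) list \<Rightarrow> 'a list" where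
  "tops ps = map snd (filter fst ps)"

definition bots :: "(bool \<times> 'a) list \<Rightarrow> 'a list" where
  "bots ps = map snd (filter (\<lambda>p. \<not> fst p) ps)"

lemma inversions_append: "inversions b (ps @ qs) = inversions b ps + inversions (b + length (bots ps)) qs"
  by (induction ps arbitrary: b) (auto simp: bots_def)

text \<open>\<open>A\<close> and \<open>B\<close> collect the rows sorted so far; the next top row
  has to cross all of \<open>B\<close>.\<close>

lemma list_det_sort_items:
  assumes "length A + length B + length ps = 2 * n"
  shows "list_det (2 * n) (map (top_vec n) A @ map (bot_vec n) B @ map (item_row n) ps) =
    (-1) ^ inversions (length B) ps *
    list_det (2 * n) (map (top_vec n) (A @ tops ps) @ map (bot_vec n) (B @ bots ps))"
  using assms
proof (induction ps arbitrary: A B)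
  case Nil
  then show ?case by (simp add: tops_def bots_def)
next
  case (Cons p ps)
  show ?case
  proof (cases "fst p")
    case True
    have "list_det (2 * n) (map (top_vec n) A @ top_vec n (snd p) # map (bot_vec n) B @ map (item_row n) ps) =
        (-1) ^ length B * list_det (2 * n) (map (top_vec n) A @ map (bot_vec n) B @ top_vec n (snd p) # map (item_row n) ps)"
      by (subst list_det_move) (use Cons.prems in auto)
    then have "list_det (2 * n) (map (top_vec n) A @ map (bot_vec n) B @ map (item_row n) (p # ps)) =
        (-1) ^ length B * list_det (2 * n) (map (top_vec n) (A @ [snd p]) @ map (bot_vec n) B @ map (item_row n) ps)"
      using True by (simp add: item_row_def mult.assoc[symmetric] power_add[symmetric])
    then show ?thesis using Cons.IH[of "A @ [snd p]" B] Cons.prems True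
      by (simp add: tops_def bots_def power_add)
  next
    case False
    then show ?thesis using Cons.IH[of A "B @ [snd p]"] Cons.prems
      by (simp add: tops_def bots_def item_row_def)
  qed
qed

lemma list_det_items:
  assumes "length ps = 2 * n"
  shows "list_det (2 * n) (map (item_row n) ps) =
    (-1) ^ inversions 0 ps * (if length (tops ps) = n then list_det n (tops ps) * list_det n (bots ps) else 0)"
proof -
  have "length (tops ps) + length (bots ps) = length ps"
    using sum_length_filter_compl[of fst ps] by (simp add: tops_def bots_def)
  then show ?thesis
    using list_det_sort_items[of "[]" "[]" ps n] list_det_block[of "tops ps" "bots ps" n] assms by simp
qed

text \<open>
  A label in \<open>D\<close> contributes both basis rows: a white node removed from the node set is covered by both
  matchings of a superposition, hence it belongs to both index sets of a product of minors.
\<close>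
definition labelled_rows :: "nat \<Rightarrow> nat \<Rightarrow> (nat \<Rightarrow> nat \<Rightarrow> real) \<Rightarrow> nat set \<Rightarrow> nat set \<Rightarrow> (nat \<Rightarrow> real \<times> real) \<Rightarrow> (nat \<Rightarrow> real) list" where
  "labelled_rows n N r L D u = concat (map (\<lambda>i. if i \<in> L then [tensor_row n (r i) (u i)]
     else if i \<in> D then [tensor_row n (r i) (1, 0), tensor_row n (r i) (0, 1)] else []) [1..<Suc N])"

definition items :: "nat \<Rightarrow> (nat \<Rightarrow> nat \<Rightarrow> real) \<Rightarrow> nat set \<Rightarrow> nat set \<Rightarrow> nat set \<Rightarrow> (bool \<times> (nat \<Rightarrow> real)) list" where
  "items N r L D T = concat (map (\<lambda>i. if i \<in> L then [(i \<in> T, r i)]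
     else if i \<in> D then [(True, r i), (False, r i)] else []) [1..<Suc N])"

lemma labelled_rows_items:
  assumes "\<And>i. i \<in> L \<Longrightarrow> u i = (if i \<in> T then (1, 0) else (0, 1))"
  shows "labelled_rows n N r L D u = map (item_row n) (items N r L D T)"
  unfolding labelled_rows_def items_def map_concat
  by (rule arg_cong[where f = concat]) (auto simp: assms tensor_row_def item_row_def)

lemma items_tops_bots:
  assumes "D \<inter> L = {}" "T \<subseteq> L"
  shows "tops (items N r L D T) = map r (filter (\<lambda>i. i \<in> T \<union> D) [1..<Suc N])"
    and "bots (items N r L D T) = map r (filter (\<lambda>i. i \<in> (L - T) \<union> D) [1..<Suc N])"
proof -
  have "tops (items N r L D T) = map r (filter (\<lambda>i. i \<in> T \<union> D) [1..<Suc N]) \<and>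
      bots (items N r L D T) = map r (filter (\<lambda>i. i \<in> (L - T) \<union> D) [1..<Suc N])"
    by (induction N) (use assms in \<open>auto simp: items_def tops_def bots_def\<close>)
  then show "tops (items N r L D T) = map r (filter (\<lambda>i. i \<in> T \<union> D) [1..<Suc N])"
    and "bots (items N r L D T) = map r (filter (\<lambda>i. i \<in> (L - T) \<union> D) [1..<Suc N])" by auto
qed

lemma filter_upt_sorted_list:
  assumes "I \<subseteq> {1..N}"
  shows "filter (\<lambda>i. i \<in> I) [1..<Suc N] = sorted_list_of_set I"
proof -
  have "set (filter (\<lambda>i. i \<in> I) [1..<Suc N]) = I" using assms by auto
  moreover have "sorted (filter (\<lambda>i. i \<in> I) [1..<Suc N])"
    by (rule sorted_wrt_filter) (simp del: upt_Suc)
  moreover have "distinct (filter (\<lambda>i. i \<in> I) [1..<Suc N])" by simp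
  ultimately show ?thesis by (metis sorted_list_of_set.idem_if_sorted_distinct)
qed

lemma card_filter_upt: "length (filter P [1..<Suc N]) = card {i \<in> {1..N}. P i}"
proof -
  have "distinct (filter P [1..<Suc N])" by simp
  from distinct_card[OF this] have "length (filter P [1..<Suc N]) = card (set (filter P [1..<Suc N]))" by simp
  also have "set (filter P [1..<Suc N]) = {i \<in> {1..N}. P i}" by auto
  finally show ?thesis .
qed

text \<open>A new top row at label \<open>i\<close> crosses \<open>b\<close> bottom rows after
  \<open>t\<close> earlier top rows. Labels below \<open>i\<close> in \<open>L\<close> give one
  earlier row and those in \<open>D\<close> one of each kind, so \<open>b\<close> has the parity of
  \<open>card (below L i) + t\<close>, and the values of \<open>t\<close> sum to a binomial
  coefficient.\<close>

lemma inversions_items: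
  assumes "D \<inter> L = {}" "T \<subseteq> L" "0 \<notin> L"
  shows "even (inversions 0 (items N r L D T) + (\<Sum>i\<in>(T \<union> D) \<inter> {1..N}. card (below L i)) +
    (card ((T \<union> D) \<inter> {1..N}) choose 2))"
proof (induction N)
  case 0
  then show ?case by (simp add: items_def numeral_2_eq_2)
next
  case (Suc N)
  let ?i = "Suc N"
  define t where "t = card ((T \<union> D) \<inter> {1..N})"
  define b where "b = length (bots (items N r L D T))"
  have b: "b = card (((L - T) \<union> D) \<inter> {1..N})"
    unfolding b_def items_tops_bots(2)[OF assms(1,2)] length_map card_filter_upt
    by (rule arg_cong[where f = card]) auto
  have bel: "below L ?i = (T \<inter> {1..N}) \<union> ((L - T) \<inter> {1..N})"
  proof -
    have "1 \<le> z" if "z \<in> L" for z using assms(3) that by (cases z) auto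
    then show ?thesis using assms(2) by (auto simp: below_def)
  qed
  have "card (below L ?i) = card (T \<inter> {1..N}) + card ((L - T) \<inter> {1..N})"
    unfolding bel by (rule card_Un_disjoint) auto
  moreover have "t = card (T \<inter> {1..N}) + card (D \<inter> {1..N})"
    unfolding t_def Int_Un_distrib2 by (rule card_Un_disjoint) (use assms in auto)
  moreover have "b = card ((L - T) \<inter> {1..N}) + card (D \<inter> {1..N})"
    unfolding b Int_Un_distrib2 by (rule card_Un_disjoint) (use assms in auto)
  ultimately have "b + card (below L ?i) + t =
      2 * (card (T \<inter> {1..N}) + card ((L - T) \<inter> {1..N}) + card (D \<inter> {1..N}))" by simp
  then have par: "even (b + card (below L ?i) + t)" by (metis dvd_triv_left)
  have split: "items ?i r L D T = items N r L D T @ (if ?i \<in> L then [(?i \<in> T, r ?i)]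
     else if ?i \<in> D then [(True, r ?i), (False, r ?i)] else [])"
    by (simp add: items_def)
  have ch: "Suc t choose 2 = (t choose 2) + t" by (simp add: numeral_2_eq_2)
  show ?case
  proof (cases "?i \<in> T \<union> D")
    case True
    have S: "(T \<union> D) \<inter> {1..?i} = insert ?i ((T \<union> D) \<inter> {1..N})"
      using True by (auto simp: atLeastAtMostSuc_conv)
    have c: "card ((T \<union> D) \<inter> {1..?i}) = Suc t" unfolding S t_def by simp
    have "(\<Sum>i\<in>(T \<union> D) \<inter> {1..?i}. card (below L i)) =
        card (below L ?i) + (\<Sum>i\<in>(T \<union> D) \<inter> {1..N}. card (below L i))"
      unfolding S by (subst sum.insert) auto
    moreover have "inversions 0 (items ?i r L D T) = inversions 0 (items N r L D T) + b"
      unfolding split inversions_append b_def using True assms by auto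
    ultimately show ?thesis using Suc.IH par unfolding c ch t_def[symmetric] by simp presburger
  next
    case False
    have S: "(T \<union> D) \<inter> {1..?i} = (T \<union> D) \<inter> {1..N}"
      using False by (auto simp: atLeastAtMostSuc_conv)
    have "inversions 0 (items ?i r L D T) = inversions 0 (items N r L D T)"
      unfolding split inversions_append using False by auto
    then show ?thesis using Suc.IH unfolding S by simp
  qed
qed

text \<open>Sorting the rows into top and bottom ones makes the matrix block diagonal, and
  \<open>inversions_items\<close> turns the sorting sign into a product over labels.\<close>

lemma list_det_labelled_basis:
  assumes D: "D \<inter> L = {}" "D \<subseteq> {1..N}" and L: "L \<subseteq> {1..N}" and T: "T \<subseteq> L" and c: "card L + 2 * card D = 2 * n"
    and u: "\<And>i. i \<in> L \<Longrightarrow> u i = (if i \<in> T then (1, 0) else (0, 1))"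
  shows "list_det (2 * n) (labelled_rows n N r L D u) =
    (-1) ^ (n choose 2) * (\<Prod>i\<in>D. (-1) ^ card (below L i)) * ((\<Prod>i\<in>T. (-1) ^ card (below L i)) *
    (if card (T \<union> D) = n then list_det n (map r (sorted_list_of_set (T \<union> D))) *
      list_det n (map r (sorted_list_of_set ((L - T) \<union> D))) else 0))"
proof -
  let ?ps = "items N r L D T"
  have fin: "finite L" "finite D" using L D finite_subset by blast+
  have finT: "finite T" using T fin finite_subset by blast
  have sub: "T \<union> D \<subseteq> {1..N}" "(L - T) \<union> D \<subseteq> {1..N}" using T L D by auto
  have tb: "tops ?ps = map r (sorted_list_of_set (T \<union> D))" "bots ?ps = map r (sorted_list_of_set ((L - T) \<union> D))"
    using items_tops_bots[OF D(1) T, of N r] filter_upt_sorted_list[OF sub(1)] filter_upt_sorted_list[OF sub(2)] by simp_all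
  have lt: "length (tops ?ps) = card (T \<union> D)" "length (bots ?ps) = card ((L - T) \<union> D)"
    unfolding tb using fin finT by simp_all
  have cs: "card (T \<union> D) = card T + card D" "card ((L - T) \<union> D) = card (L - T) + card D"
    using fin finT D(1) T by (auto intro!: card_Un_disjoint)
  have "card L = card T + card (L - T)" using card_Int_Diff[OF fin(1), of T] T by (simp add: Int_absorb1)
  then have "length (tops ?ps) + length (bots ?ps) = 2 * n" unfolding lt cs using c by simp
  moreover have "length (tops ?ps) + length (bots ?ps) = length ?ps"
    using sum_length_filter_compl[of fst ?ps] by (simp add: tops_def bots_def)
  ultimately have len: "length ?ps = 2 * n" by simp
  have "0 \<notin> L" using L by auto
  then have inv: "even (inversions 0 ?ps + (\<Sum>i\<in>T \<union> D. card (below L i)) + (card (T \<union> D) choose 2))"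
    using inversions_items[OF D(1) T, of N r] sub(1) by (simp add: Int_absorb2)
  have rows: "labelled_rows n N r L D u = map (item_row n) ?ps" by (rule labelled_rows_items) (rule u)
  show ?thesis
  proof (cases "card (T \<union> D) = n")
    case True
    have "(-1 :: real) ^ inversions 0 ?ps = (-1) ^ ((\<Sum>i\<in>T \<union> D. card (below L i)) + (n choose 2))"
      using inv True by (auto simp: minus_one_power_iff)
    also have "\<dots> = (-1) ^ (n choose 2) * (\<Prod>i\<in>T \<union> D. (-1) ^ card (below L i))"
      by (simp add: power_add power_sum)
    also have "(\<Prod>i\<in>T \<union> D. (-1 :: real) ^ card (below L i)) =
        (\<Prod>i\<in>T. (-1) ^ card (below L i)) * (\<Prod>i\<in>D. (-1) ^ card (below L i))"
      by (rule prod.union_disjoint) (use fin finT D(1) T in auto)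
    finally show ?thesis
      unfolding rows list_det_items[OF len] lt(1) using True tb by simp
  next
    case False
    then show ?thesis unfolding rows list_det_items[OF len] lt(1) by simp
  qed
qed

text \<open>Multilinearity in the vectors \<open>u i\<close>; the induction counts the labels whose
  vector is not yet a basis vector.\<close>

lemma bilinear_extend:
  fixes f g :: "(nat \<Rightarrow> real \<times> real) \<Rightarrow> real"
  assumes "finite L"
    and f: "\<And>u i a b. i \<in> L \<Longrightarrow> f (u(i := (a, b))) = a * f (u(i := (1, 0))) + b * f (u(i := (0, 1)))"
    and g: "\<And>u i a b. i \<in> L \<Longrightarrow> g (u(i := (a, b))) = a * g (u(i := (1, 0))) + b * g (u(i := (0, 1)))"
    and eq: "\<And>u. (\<And>i. i \<in> L \<Longrightarrow> u i \<in> {(1, 0), (0, 1)}) \<Longrightarrow> f u = g u"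
  shows "f u = g u"
proof (induction "card {i \<in> L. u i \<notin> {(1, 0), (0, 1)}}" arbitrary: u rule: less_induct)
  case less
  show ?case
  proof (cases "{i \<in> L. u i \<notin> {(1, 0), (0, 1)}} = {}")
    case True
    then show ?thesis by (intro eq) blast
  next
    case False
    then obtain i where i: "i \<in> L" "u i \<notin> {(1, 0), (0, 1)}" by blast
    have e: "f (u(i := w)) = g (u(i := w))" if "w \<in> {(1, 0), (0, 1)}" for w
    proof (rule less.hyps)
      have "{j \<in> L. (u(i := w)) j \<notin> {(1, 0), (0, 1)}} \<subset> {j \<in> L. u j \<notin> {(1, 0), (0, 1)}}"
        using i that by auto
      then show "card {j \<in> L. (u(i := w)) j \<notin> {(1, 0), (0, 1)}} < card {j \<in> L. u j \<notin> {(1, 0), (0, 1)}}"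
        using assms(1) by (intro psubset_card_mono) auto
    qed
    have "u = u(i := (fst (u i), snd (u i)))" by simp
    then show ?thesis using f[OF i(1), of u] g[OF i(1), of u] e by (metis insertCI)
  qed
qed

section \<open>Three-term relations for inserted and deleted rows\<close>

lemma list_det_move_two:
  assumes "n = length P + length Q + length R + 2"
  shows "list_det n (P @ s # Q @ t # R) = (-1) ^ length Q * list_det n ((P @ Q @ R) @ [s, t])"
proof -
  have "list_det n ((P @ s # Q) @ t # R @ []) = (-1) ^ length R * list_det n ((P @ s # Q) @ R @ [t])"
    by (rule list_det_move) (use assms in simp)
  moreover have "list_det n (P @ s # (Q @ R) @ [t]) = (-1) ^ length (Q @ R) * list_det n (P @ (Q @ R) @ s # [t])"
    by (rule list_det_move) (use assms in simp)
  ultimately have "list_det n (P @ s # Q @ t # R) =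
      (-1) ^ length R * ((-1) ^ length (Q @ R) * list_det n ((P @ Q @ R) @ [s, t]))" by simp
  \<comment> \<open>Both \<open>s\<close> and \<open>t\<close> cross \<open>R\<close>, so only the
    crossing of \<open>Q\<close> leaves a sign.\<close>
  also have "\<dots> = (-1) ^ (length R + length R) * ((-1) ^ length Q * list_det n ((P @ Q @ R) @ [s, t]))"
    by (simp add: power_add)
  finally show ?thesis by simp
qed

text \<open>All six lists contain the rows of \<open>C\<close> together with two of
  \<open>a\<close>, \<open>b\<close>, \<open>c\<close>, \<open>d\<close>. Moving these two to the
  end gives the three-term relation, and the moving signs of each of the three products multiply to
  the parity of \<open>length X1 + length X3\<close>.\<close>

lemma list_det_condense1:
  assumes n: "n = length X0 + length X1 + length X2 + length X3 + length X4 + 4"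
  defines "f \<equiv> list_det n"
  shows "f (X0 @ a # X1 @ y # X2 @ c # X3 @ v # X4) * f (X0 @ X1 @ y # b # X2 @ X3 @ v # d # X4) =
    f (X0 @ X1 @ y # b # X2 @ c # X3 @ v # X4) * f (X0 @ a # X1 @ y # X2 @ X3 @ v # d # X4) +
    f (X0 @ X1 @ y # X2 @ c # X3 @ v # d # X4) * f (X0 @ a # X1 @ y # b # X2 @ X3 @ v # X4)"
proof -
  define C where "C = X0 @ X1 @ y # X2 @ X3 @ v # X4"
  let ?\<phi> = "\<lambda>p q. f (C @ [p, q])"
  have nC: "n = Suc (Suc (length C))" using n by (simp add: C_def)
  note pl = list_det_pluecker[OF nC, of a c b d, folded f_def]
  have e: "f (X0 @ a # X1 @ y # X2 @ c # X3 @ v # X4) = (-1) ^ (length X1 + length X2 + 1) * ?\<phi> a c"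
    "f (X0 @ X1 @ y # b # X2 @ X3 @ v # d # X4) = (-1) ^ (length X2 + length X3 + 1) * ?\<phi> b d"
    "f (X0 @ X1 @ y # b # X2 @ c # X3 @ v # X4) = (-1) ^ length X2 * ?\<phi> b c"
    "f (X0 @ a # X1 @ y # X2 @ X3 @ v # d # X4) = (-1) ^ (length X1 + length X2 + length X3 + 2) * ?\<phi> a d"
    "f (X0 @ X1 @ y # X2 @ c # X3 @ v # d # X4) = (-1) ^ (length X3 + 1) * ?\<phi> c d"
    "f (X0 @ a # X1 @ y # b # X2 @ X3 @ v # X4) = (-1) ^ (length X1 + 1) * ?\<phi> a b"
    using list_det_move_two[of n X0 "X1 @ y # X2" "X3 @ v # X4" a c]
      list_det_move_two[of n "X0 @ X1 @ [y]" "X2 @ X3 @ [v]" X4 b d]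
      list_det_move_two[of n "X0 @ X1 @ [y]" X2 "X3 @ v # X4" b c]
      list_det_move_two[of n X0 "X1 @ y # X2 @ X3 @ [v]" X4 a d]
      list_det_move_two[of n "X0 @ X1 @ y # X2" "X3 @ [v]" X4 c d]
      list_det_move_two[of n X0 "X1 @ [y]" "X2 @ X3 @ v # X4" a b] n
    by (simp_all add: f_def C_def ac_simps)
  have sq: "(-1 :: real) ^ k * (-1) ^ k = 1" for k by (simp flip: power_add)
  show ?thesis unfolding e power_add using pl sq[of "length X2"] by (simp add: algebra_simps)
qed

text \<open>The same relation when row \<open>a\<close> stands behind all others instead of in
  front; the swaps of \<open>a\<close> change the sign of all three products alike.\<close>

lemma list_det_condense2:
  assumes n: "n = length X0 + length X1 + length X2 + length X3 + length X4 + 4"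
  defines "f \<equiv> list_det n"
  shows "f (X0 @ y # X1 @ c # X2 @ v # X3 @ a # X4) * f (X0 @ y # b # X1 @ X2 @ v # d # X3 @ X4) =
    f (X0 @ y # b # X1 @ c # X2 @ v # X3 @ X4) * f (X0 @ y # X1 @ X2 @ v # d # X3 @ a # X4) +
    f (X0 @ y # X1 @ c # X2 @ v # d # X3 @ X4) * f (X0 @ y # b # X1 @ X2 @ v # X3 @ a # X4)"
proof -
  define C where "C = X0 @ y # X1 @ X2 @ v # X3 @ X4"
  let ?\<phi> = "\<lambda>p q. f (C @ [p, q])"
  have nC: "n = Suc (Suc (length C))" using n by (simp add: C_def)
  note pl = list_det_pluecker[OF nC, of a c b d, folded f_def]
  have anti: "?\<phi> p q = - ?\<phi> q p" for p q
    unfolding f_def by (rule list_det_swap) (use nC in simp)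
  have e: "f (X0 @ y # X1 @ c # X2 @ v # X3 @ a # X4) = (-1) ^ (length X2 + length X3 + 1) * ?\<phi> c a"
    "f (X0 @ y # b # X1 @ X2 @ v # d # X3 @ X4) = (-1) ^ (length X1 + length X2 + 1) * ?\<phi> b d"
    "f (X0 @ y # b # X1 @ c # X2 @ v # X3 @ X4) = (-1) ^ length X1 * ?\<phi> b c"
    "f (X0 @ y # X1 @ X2 @ v # d # X3 @ a # X4) = (-1) ^ length X3 * ?\<phi> d a"
    "f (X0 @ y # X1 @ c # X2 @ v # d # X3 @ X4) = (-1) ^ (length X2 + 1) * ?\<phi> c d"
    "f (X0 @ y # b # X1 @ X2 @ v # X3 @ a # X4) = (-1) ^ (length X1 + length X2 + length X3 + 1) * ?\<phi> b a"
    using list_det_move_two[of n "X0 @ y # X1" "X2 @ v # X3" X4 c a]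
      list_det_move_two[of n "X0 @ [y]" "X1 @ X2 @ [v]" "X3 @ X4" b d]
      list_det_move_two[of n "X0 @ [y]" X1 "X2 @ v # X3 @ X4" b c]
      list_det_move_two[of n "X0 @ y # X1 @ X2 @ [v]" X3 X4 d a]
      list_det_move_two[of n "X0 @ y # X1" "X2 @ [v]" "X3 @ X4" c d]
      list_det_move_two[of n "X0 @ [y]" "X1 @ X2 @ v # X3" X4 b a] n
    by (simp_all add: f_def C_def ac_simps)
  have sq: "(-1 :: real) ^ k * (-1) ^ k = 1" for k by (simp flip: power_add)
  show ?thesis
    unfolding e power_add anti[of c a] anti[of d a] anti[of b a]
    using pl sq[of "length X2"] by (simp add: algebra_simps)
qed

text \<open>The pair \<open>u\<close>, \<open>u'\<close> arises from the standard basis by a change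
  of basis of determinant 1. Thus a doubled label can be made to contain its ordinary row
  again.\<close>

lemma list_det_double_row:
  assumes len: "n' = length xs + Suc (Suc (length ys))" and w: "fst u * snd u' - snd u * fst u' = 1"
  shows "list_det n' (xs @ tensor_row n m (1, 0) # tensor_row n m (0, 1) # ys) =
    list_det n' (xs @ tensor_row n m u # tensor_row n m u' # ys)"
proof -
  let ?a = "tensor_row n m (1, 0)" and ?b = "tensor_row n m (0, 1)"
  have t: "tensor_row n m u = (\<lambda>j. fst u * ?a j + snd u * ?b j)" for u by (simp add: tensor_row_def)
  have z: "list_det n' (xs @ r # r # ys) = 0" for r
    by (rule list_det_not_distinct) (use len in auto)
  have 1: "list_det n' (xs @ tensor_row n m u # q # ys) =
      fst u * list_det n' (xs @ ?a # q # ys) + snd u * list_det n' (xs @ ?b # q # ys)" for q u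
    unfolding t[of u] by (rule list_det_linear) (use len in simp)
  have 2: "list_det n' (xs @ q # tensor_row n m u # ys) =
      fst u * list_det n' (xs @ q # ?a # ys) + snd u * list_det n' (xs @ q # ?b # ys)" for q u
    unfolding t[of u] using list_det_linear[of n' "xs @ [q]" ys] len by simp
  have s: "list_det n' (xs @ ?b # ?a # ys) = - list_det n' (xs @ ?a # ?b # ys)"
    by (rule list_det_swap) (use len in simp)
  have "list_det n' (xs @ tensor_row n m u # tensor_row n m u' # ys) =
      (fst u * snd u' - snd u * fst u') * list_det n' (xs @ ?a # ?b # ys)"
    unfolding 1[of u] 2[of _ u'] s z by (simp add: algebra_simps)
  then show ?thesis using w by simp
qed

section \<open>Expansion of the tensor determinant over planar pairings\<close>

definition wedge :: "real \<times> real \<Rightarrow> real \<times> real \<Rightarrow> real" where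
  "wedge a b = fst a * snd b - snd a * fst b"

definition pair_weight :: "nat set \<Rightarrow> (nat \<Rightarrow> real \<times> real) \<Rightarrow> nat set set \<Rightarrow> real" where
  "pair_weight L u \<rho> = (\<Prod>p\<in>\<rho>. (-1) ^ card (below L (Min p)) * wedge (u (Min p)) (u (Max p)))"

text \<open>Exactly one pair contains \<open>i\<close>, and its factor is linear in
  \<open>u i\<close>.\<close>

lemma pair_weight_linear:
  assumes \<rho>: "is_pairing L \<rho>" "finite L" and i: "i \<in> L"
  shows "pair_weight L (u(i := (a, b))) \<rho> =
    a * pair_weight L (u(i := (1, 0))) \<rho> + b * pair_weight L (u(i := (0, 1))) \<rho>"
proof -
  have "\<exists>!p. p \<in> \<rho> \<and> i \<in> p" using \<rho>(1) i by (simp add: is_pairing_def)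
  then obtain p where p: "p \<in> \<rho>" "i \<in> p" by (elim ex1E conjE)
  obtain x y where xy: "p = {x, y}" "x < y" "x \<in> L" "y \<in> L" using pairing_pair[OF \<rho>(1) p(1)] .
  have mm: "Min p = x" "Max p = y" using xy by auto
  let ?R = "\<lambda>w. \<Prod>q\<in>\<rho> - {p}. (-1) ^ card (below L (Min q)) * wedge (w (Min q)) (w (Max q))"
  have R: "?R (u(i := c)) = ?R u" for c
  proof (rule prod.cong[OF refl])
    fix q assume q: "q \<in> \<rho> - {p}"
    then obtain s t where st: "q = {s, t}" "s < t" "s \<in> L" "t \<in> L" using pairing_pair[OF \<rho>(1), of q] by blast
    have "i \<notin> q" using pairing_disjoint[OF \<rho>(1) p(1), of q i] p(2) q by auto
    then have "Min q \<noteq> i" "Max q \<noteq> i" using st by auto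
    then show "(-1) ^ card (below L (Min q)) * wedge ((u(i := c)) (Min q)) ((u(i := c)) (Max q)) =
        (-1) ^ card (below L (Min q)) * wedge (u (Min q)) (u (Max q))" by simp
  qed
  have e: "pair_weight L (u(i := c)) \<rho> =
      (-1) ^ card (below L x) * wedge ((u(i := c)) x) ((u(i := c)) y) * ?R u" for c
    unfolding pair_weight_def
    by (subst prod.remove[OF pairing_finite[OF \<rho>] p(1)]) (simp only: mm R)
  have "i = x \<or> i = y" using p xy by auto
  then show ?thesis unfolding e using xy(2) by (auto simp: wedge_def algebra_simps)
qed

lemma length_labelled_rows:
  assumes "L \<subseteq> {1..N}" "D \<subseteq> {1..N}" "D \<inter> L = {}"
  shows "length (labelled_rows n N r L D u) = card L + 2 * card D"
proof -
  have "length (labelled_rows n N r L D u) =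
      (\<Sum>i\<leftarrow>[1..<Suc N]. if i \<in> L then 1 else if i \<in> D then 2 else 0)"
    unfolding labelled_rows_def length_concat map_map comp_def
    by (rule arg_cong[where f = sum_list], rule map_cong) auto
  also have "\<dots> = (\<Sum>i\<in>{1..N}. if i \<in> L then 1 else if i \<in> D then 2 else 0)"
    by (subst sum_list_distinct_conv_sum_set) (auto simp: atLeastLessThanSuc_atLeastAtMost simp del: upt_Suc)
  also have "\<dots> = (\<Sum>i\<in>{1..N}. (if i \<in> L then 1 else 0) + (if i \<in> D then 2 else 0))"
    by (rule sum.cong) (use assms(3) in auto)
  also have "\<dots> = card ({1..N} \<inter> L) + 2 * card ({1..N} \<inter> D)"
    by (simp add: sum.distrib sum.If_cases)
  finally show ?thesis using assms by (simp add: Int_absorb1)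
qed

lemma labelled_rows_split:
  assumes "i \<in> L" "i \<in> {1..N}"
  shows "\<exists>R1 R2. \<forall>c. labelled_rows n N r L D (u(i := c)) = R1 @ tensor_row n (r i) c # R2"
proof -
  have s: "[1..<Suc N] = [1..<i] @ i # [Suc i..<Suc N]"
    using assms(2) upt_add_eq_append[of 1 i "Suc N - i"] upt_conv_Cons[of i "Suc N"] by (simp del: upt_Suc)
  let ?g = "\<lambda>u i. if i \<in> L then [tensor_row n (r i) (u i)]
     else if i \<in> D then [tensor_row n (r i) (1, 0), tensor_row n (r i) (0, 1)] else []"
  have m: "map (?g (u(i := c))) xs = map (?g u) xs" if "i \<notin> set xs" for xs c
    using that by (auto intro!: map_cong)
  have "labelled_rows n N r L D (u(i := c)) =
      concat (map (?g u) [1..<i]) @ tensor_row n (r i) c # concat (map (?g u) [Suc i..<Suc N])" for c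
  proof -
    have m1: "map (?g (u(i := c))) [1..<i] = map (?g u) [1..<i]"
      and m2: "map (?g (u(i := c))) [Suc i..<Suc N] = map (?g u) [Suc i..<Suc N]"
      by (rule m; simp)+
    show ?thesis
      unfolding labelled_rows_def s map_append list.map concat_append concat.simps m1 m2
      using assms(1) by simp
  qed
  then show ?thesis by blast
qed

lemma list_det_labelled_linear:
  assumes "L \<subseteq> {1..N}" "D \<subseteq> {1..N}" "D \<inter> L = {}" "card L + 2 * card D = 2 * n" "i \<in> L"
  shows "list_det (2 * n) (labelled_rows n N r L D (u(i := (a, b)))) =
    a * list_det (2 * n) (labelled_rows n N r L D (u(i := (1, 0)))) +
    b * list_det (2 * n) (labelled_rows n N r L D (u(i := (0, 1))))"
proof -
  have "i \<in> {1..N}" using assms by blast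
  then obtain R1 R2 where R: "\<And>c. labelled_rows n N r L D (u(i := c)) = R1 @ tensor_row n (r i) c # R2"
    using labelled_rows_split[OF assms(5)] by blast
  have len: "2 * n = length R1 + Suc (length R2)"
    using length_labelled_rows[OF assms(1-3), of n r "u(i := (0, 0))"] assms(4) unfolding R by simp
  have "tensor_row n (r i) (a, b) = (\<lambda>j. a * tensor_row n (r i) (1, 0) j + b * tensor_row n (r i) (0, 1) j)"
    by (simp add: tensor_row_def)
  then show ?thesis unfolding R using list_det_linear[OF len] by simp
qed

context dimer_nodes
begin

text \<open>Both sides are multilinear in \<open>u\<close>. For basis vectors the left side is a
  signed product of two minors with intersection \<open>D\<close> and union
  \<open>L \<union> D\<close>, which \<open>minor_mult\<close> expands;
  \<open>prod_wedge_basis\<close> identifies the result with the pairing weights.\<close>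

theorem labelled_expansion:
  assumes real: "\<And>I. I \<subseteq> {1..N} \<Longrightarrow> card I = n \<Longrightarrow> minor I = \<kappa> * list_det n (map r (sorted_list_of_set I))"
    and L: "L \<subseteq> {1..N}" and D: "D \<subseteq> {1..N}" "D \<inter> L = {}" and c: "card L + 2 * card D = 2 * n"
  shows "\<kappa> * \<kappa> * list_det (2 * n) (labelled_rows n N r L D u) =
    (-1) ^ (n choose 2) * (\<Prod>i\<in>D. (-1) ^ card (below L i)) *
    (\<Sum>m\<in>configs (joint_degree D (L \<union> D)).
      pair_weight L u (node_pairs (singles E m) L) * dd_weight E wt (node ` L) m)"
proof -
  let ?C = "configs (joint_degree D (L \<union> D))" and ?\<rho> = "\<lambda>m. node_pairs (singles E m) L"
  have fin: "finite L" "finite D" using L D finite_subset by blast+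
  have LD: "L \<union> D \<subseteq> {1..N}" and LDd: "L = (D - (L \<union> D)) \<union> (L \<union> D - D)" using L D by auto
  have \<rho>: "is_pairing L (?\<rho> m)" "planar_pairing (?\<rho> m)" if "m \<in> ?C" for m
    using node_pairs_pairing[OF D(1) LD LDd that] node_pairs_planar[OF D(1) LD LDd that] by auto
  show ?thesis
  proof (rule bilinear_extend[OF fin(1), where u = u])
    fix u i a b assume i: "i \<in> L"
    show "\<kappa> * \<kappa> * list_det (2 * n) (labelled_rows n N r L D (u(i := (a, b)))) =
        a * (\<kappa> * \<kappa> * list_det (2 * n) (labelled_rows n N r L D (u(i := (1, 0))))) +
        b * (\<kappa> * \<kappa> * list_det (2 * n) (labelled_rows n N r L D (u(i := (0, 1)))))"
      unfolding list_det_labelled_linear[OF L D c i, of r u a b] by (simp add: algebra_simps)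
    have s: "(\<Sum>m\<in>?C. pair_weight L (u(i := (a, b))) (?\<rho> m) * dd_weight E wt (node ` L) m) =
        a * (\<Sum>m\<in>?C. pair_weight L (u(i := (1, 0))) (?\<rho> m) * dd_weight E wt (node ` L) m) +
        b * (\<Sum>m\<in>?C. pair_weight L (u(i := (0, 1))) (?\<rho> m) * dd_weight E wt (node ` L) m)"
      unfolding sum_distrib_left sum.distrib[symmetric]
      by (rule sum.cong[OF refl], subst pair_weight_linear[OF \<rho>(1) fin(1) i]) (auto simp: algebra_simps)
    show "(-1) ^ (n choose 2) * (\<Prod>i\<in>D. (-1) ^ card (below L i)) *
          (\<Sum>m\<in>?C. pair_weight L (u(i := (a, b))) (?\<rho> m) * dd_weight E wt (node ` L) m) =
        a * ((-1) ^ (n choose 2) * (\<Prod>i\<in>D. (-1) ^ card (below L i)) *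
          (\<Sum>m\<in>?C. pair_weight L (u(i := (1, 0))) (?\<rho> m) * dd_weight E wt (node ` L) m)) +
        b * ((-1) ^ (n choose 2) * (\<Prod>i\<in>D. (-1) ^ card (below L i)) *
          (\<Sum>m\<in>?C. pair_weight L (u(i := (0, 1))) (?\<rho> m) * dd_weight E wt (node ` L) m))"
      unfolding s by (simp only: distrib_left mult_ac)
  next
    fix u :: "nat \<Rightarrow> real \<times> real" assume u: "\<And>i. i \<in> L \<Longrightarrow> u i \<in> {(1, 0), (0, 1)}"
    define T where "T = {i \<in> L. u i = (1, 0)}"
    have T: "T \<subseteq> L" by (auto simp: T_def)
    have uT: "u i = (if i \<in> T then (1, 0) else (0, 1))" if "i \<in> L" for i
      using u[OF that] that by (auto simp: T_def)
    let ?I = "T \<union> D" and ?J = "(L - T) \<union> D"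
    have sub: "?I \<subseteq> {1..N}" "?J \<subseteq> {1..N}" using T L D by auto
    have deg: "joint_degree ?I ?J = joint_degree D (L \<union> D)"
      by (rule joint_degree_cong) (use T D in auto)
    have LIJ: "L = (?I - ?J) \<union> (?J - ?I)" using T D by auto
    have pw: "pair_weight L u (?\<rho> m) = of_bool (separates T (?\<rho> m)) * (\<Prod>i\<in>T. (-1) ^ card (below L i))"
      if "m \<in> ?C" for m
      unfolding pair_weight_def wedge_def by (rule prod_wedge_basis[OF \<rho>[OF that] fin(1) T uT])
    have sum: "(\<Sum>m\<in>?C. of_bool (separates T (?\<rho> m)) * dd_weight E wt (node ` L) m) = minor ?I * minor ?J"
    proof -
      have "?I \<inter> L = T" using T D by auto
      then have "separates ?I (?\<rho> m) \<longleftrightarrow> separates T (?\<rho> m)" if "m \<in> ?C" for m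
        using separates_Int[OF \<rho>(1)[OF that], of ?I] by simp
      then show ?thesis unfolding minor_mult[OF sub LIJ] deg by (intro sum.cong) auto
    qed
    have finT: "finite T" using T fin finite_subset by blast
    have cs: "card ?I = card T + card D" "card ?J = card (L - T) + card D"
      using fin finT D(2) T by (auto intro!: card_Un_disjoint)
    have cL: "card L = card T + card (L - T)" using card_Int_Diff[OF fin(1), of T] T by (simp add: Int_absorb1)
    have prod: "\<kappa> * \<kappa> * (if card ?I = n then list_det n (map r (sorted_list_of_set ?I)) *
        list_det n (map r (sorted_list_of_set ?J)) else 0) = minor ?I * minor ?J"
    proof (cases "card ?I = n")
      case True
      then have "card ?J = n" using cs cL c by simp
      then show ?thesis using True real[OF sub(1)] real[OF sub(2)] by simp
    next
      case False
      \<comment> \<open>Index sets of a size other than \<open>n\<close> are not covered by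
        \<open>real\<close>. Their product vanishes anyway, since a separating \<open>T\<close>
        contains exactly half of \<open>L\<close>.\<close>
      have "\<not> separates T (?\<rho> m)" if "m \<in> ?C" for m
      proof
        assume "separates T (?\<rho> m)"
        then have "card L = 2 * card T" by (rule pairing_card_separated[OF \<rho>(1)[OF that] fin(1) T])
        then show False using False cs(1) c by simp
      qed
      then show ?thesis unfolding sum[symmetric] using False by simp
    qed
    have "\<kappa> * \<kappa> * list_det (2 * n) (labelled_rows n N r L D u) =
        (-1) ^ (n choose 2) * (\<Prod>i\<in>D. (-1) ^ card (below L i)) * (\<Prod>i\<in>T. (-1) ^ card (below L i)) *
        (\<kappa> * \<kappa> * (if card ?I = n then list_det n (map r (sorted_list_of_set ?I)) *
        list_det n (map r (sorted_list_of_set ?J)) else 0))"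
      by (subst list_det_labelled_basis[OF D(2,1) L T c uT]) (auto simp only: mult_ac)
    also have "\<dots> = (-1) ^ (n choose 2) * (\<Prod>i\<in>D. (-1) ^ card (below L i)) *
        (\<Sum>m\<in>?C. pair_weight L u (?\<rho> m) * dd_weight E wt (node ` L) m)"
    proof -
      have "(\<Sum>m\<in>?C. pair_weight L u (?\<rho> m) * dd_weight E wt (node ` L) m) =
          (\<Prod>i\<in>T. (-1) ^ card (below L i)) * (minor ?I * minor ?J)"
        unfolding sum[symmetric] sum_distrib_left by (rule sum.cong[OF refl]) (simp add: pw)
      then show ?thesis unfolding prod by (simp only: mult_ac)
    qed
    finally show "\<kappa> * \<kappa> * list_det (2 * n) (labelled_rows n N r L D u) =
        (-1) ^ (n choose 2) * (\<Prod>i\<in>D. (-1) ^ card (below L i)) *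
        (\<Sum>m\<in>?C. pair_weight L u (?\<rho> m) * dd_weight E wt (node ` L) m)" .
  qed
qed

end

text \<open>Vectors at the angles \<open>0, \<pi>/2, 3\<pi>/4, \<pi>\<close>, so that \<open>wedge\<close> is \<open>1\<close> on contrasting blocks and \<open>0\<close> otherwise.\<close>
definition block_vec :: "nat \<Rightarrow> real \<times> real" where
  "block_vec q = (if q = 1 then (1, 0) else if q = 2 then (0, 1) else if q = 3 then (-1, 1) else (-1, 0))"

lemma wedge_block_vec:
  assumes "p \<in> {1..4}" "q \<in> {1..4}" "p \<le> q"
  shows "wedge (block_vec p) (block_vec q) = of_bool (contrasting p q)"
proof -
  have "p \<in> {1, 2, 3, 4}" "q \<in> {1, 2, 3, 4}" using assms by auto
  then show ?thesis using assms(3) by (auto simp: block_vec_def wedge_def contrasting_def doubleton_eq_iff)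
qed

lemma pair_weight_blocks:
  assumes \<rho>: "is_pairing L \<rho>" "finite L"
    and k: "\<And>i. i \<in> L \<Longrightarrow> k i \<in> {1..4}" "\<And>i j. i \<in> L \<Longrightarrow> j \<in> L \<Longrightarrow> i \<le> j \<Longrightarrow> k i \<le> k j"
  shows "pair_weight L (\<lambda>i. block_vec (k i)) \<rho> =
    (if contrasts k \<rho> then (-1) ^ (\<Sum>p\<in>\<rho>. card (below L (Min p))) else 0)"
proof -
  have w: "wedge (block_vec (k (Min p))) (block_vec (k (Max p))) = of_bool (contrasting (k (Min p)) (k (Max p)))"
    if p: "p \<in> \<rho>" for p
  proof -
    obtain x y where xy: "p = {x, y}" "x < y" "x \<in> L" "y \<in> L" using pairing_pair[OF \<rho>(1) p] .
    then have "Min p = x" "Max p = y" by auto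
    then show ?thesis using wedge_block_vec[OF k(1) k(1) k(2)] xy by simp
  qed
  have sym: "contrasting p q \<longleftrightarrow> contrasting q p" for p q
    by (auto simp: contrasting_def insert_commute)
  have c: "contrasts k \<rho> \<longleftrightarrow> (\<forall>p\<in>\<rho>. contrasting (k (Min p)) (k (Max p)))"
  proof
    assume c: "contrasts k \<rho>"
    show "\<forall>p\<in>\<rho>. contrasting (k (Min p)) (k (Max p))"
    proof
      fix p assume p: "p \<in> \<rho>"
      obtain x y where xy: "p = {x, y}" "x < y" "x \<in> L" "y \<in> L" using pairing_pair[OF \<rho>(1) p] .
      then have "Min p = x" "Max p = y" by auto
      then show "contrasting (k (Min p)) (k (Max p))" using c p xy unfolding contrasts_def by auto
    qed
  next
    assume r: "\<forall>p\<in>\<rho>. contrasting (k (Min p)) (k (Max p))"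
    show "contrasts k \<rho>"
      unfolding contrasts_def
    proof (intro allI impI)
      fix a b assume ab: "{a, b} \<in> \<rho>" "a \<noteq> b"
      then have "contrasting (k (Min {a, b})) (k (Max {a, b}))" using r by blast
      then show "contrasting (k a) (k b)" using sym by (auto simp: min_def max_def split: if_splits)
    qed
  qed
  have "pair_weight L (\<lambda>i. block_vec (k i)) \<rho> =
      (\<Prod>p\<in>\<rho>. (-1) ^ card (below L (Min p)) * of_bool (contrasting (k (Min p)) (k (Max p))))"
    unfolding pair_weight_def by (rule prod.cong[OF refl]) (simp only: w)
  also have "\<dots> = (if contrasts k \<rho> then (-1) ^ (\<Sum>p\<in>\<rho>. card (below L (Min p))) else 0)"
  proof (cases "contrasts k \<rho>")
    case True
    then show ?thesis using c by (simp add: power_sum)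
  next
    case False
    then obtain p where "p \<in> \<rho>" "\<not> contrasting (k (Min p)) (k (Max p))" using c by blast
    then show ?thesis using False pairing_finite[OF \<rho>] by (auto simp: prod_zero_iff)
  qed
  finally show ?thesis .
qed

section \<open>Tripartite double-dimer sums\<close>

context dimer_nodes
begin

text \<open>A removed white label lies in both index sets and a removed black label in neither; in
  both cases the two matchings cover the vertex, which is therefore required to have degree
  two.\<close>

lemma joint_degree_removed:
  assumes L: "L \<subseteq> {1..N}" and D: "D \<subseteq> {1..N}" "D \<inter> L = {}"
    and white: "\<And>i. i \<in> D \<Longrightarrow> node i \<in> V2" and black: "\<And>i. i \<in> {1..N} - L - D \<Longrightarrow> node i \<notin> V2"
    and v: "v \<in> V1 \<union> V2"
  shows "joint_degree D (L \<union> D) v = (if v \<in> node ` L then 1 else 2)"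
proof (cases "v \<in> node ` {1..N}")
  case True
  then obtain i where i: "i \<in> {1..N}" "v = node i" by blast
  have "v \<in> node ` L \<longleftrightarrow> i \<in> L" using i L inj_on_image_mem_iff[OF node_inj i(1) L] by simp
  then show ?thesis
    using i D(2) white[of i] black[of i] covered_node[OF i(1)] unfolding joint_degree_def
    by (cases "i \<in> L"; cases "i \<in> D") auto
next
  case False
  then show ?thesis using covered_other[OF v False] L by (auto simp: joint_degree_def)
qed

text \<open>The block vectors annihilate every pairing that joins equal colours. By
  \<open>contrasting_pairing_unique\<close> at most one pairing survives, and
  \<open>pairing_sign\<close> gives its sign. If none exists the sum is 0, in accordance with the
  convention in \<open>Ztrip\<close>.\<close>

theorem ztrip_expansion:
  fixes col :: "nat \<Rightarrow> rgb"
  assumes real: "\<And>I. I \<subseteq> {1..N} \<Longrightarrow> card I = n \<Longrightarrow> minor I = \<kappa> * list_det n (map r (sorted_list_of_set I))"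
    and L: "L \<subseteq> {1..N}" and D: "D \<subseteq> {1..N}" "D \<inter> L = {}" and c: "card L + 2 * card D = 2 * n"
    and white: "\<And>i. i \<in> D \<Longrightarrow> node i \<in> V2" and black: "\<And>i. i \<in> {1..N} - L - D \<Longrightarrow> node i \<notin> V2"
    and k: "\<And>i. i \<in> {1..N} \<Longrightarrow> k i \<in> {1..4}" "\<And>i j. i \<in> {1..N} \<Longrightarrow> j \<in> {1..N} \<Longrightarrow> i \<le> j \<Longrightarrow> k i \<le> k j"
    and col: "\<And>i j. i \<in> {1..N} \<Longrightarrow> j \<in> {1..N} \<Longrightarrow> col i \<noteq> col j \<longleftrightarrow> contrasting (k i) (k j)"
  shows "\<kappa> * \<kappa> * list_det (2 * n) (labelled_rows n N r L D (\<lambda>i. block_vec (k i))) =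
    (-1) ^ (n choose 2) * (\<Prod>i\<in>D. (-1) ^ card (below L i)) *
    (if even (block_exponent k L) then 1 else - 1) * Ztrip V1 V2 E wt node col L"
proof -
  let ?C = "configs (joint_degree D (L \<union> D))" and ?\<rho> = "\<lambda>m. node_pairs (singles E m) L"
  let ?s = "if even (block_exponent k L) then 1 else - 1 :: real"
  have fin: "finite L" using L finite_subset by blast
  have LD: "L \<union> D \<subseteq> {1..N}" and LDd: "L = (D - (L \<union> D)) \<union> (L \<union> D - D)" using L D by auto
  have \<rho>: "is_pairing L (?\<rho> m)" "planar_pairing (?\<rho> m)" if "m \<in> ?C" for m
    using node_pairs_pairing[OF D(1) LD LDd that] node_pairs_planar[OF D(1) LD LDd that] by auto
  have kL: "\<And>i. i \<in> L \<Longrightarrow> k i \<in> {1..4}" "\<And>i j. i \<in> L \<Longrightarrow> j \<in> L \<Longrightarrow> i \<le> j \<Longrightarrow> k i \<le> k j"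
    using k L by blast+
  have trip: "tripartite col L \<rho> \<longleftrightarrow> is_pairing L \<rho> \<and> planar_pairing \<rho> \<and> contrasts k \<rho>" for \<rho>
  proof -
    have "(\<forall>p\<in>\<rho>. \<forall>a\<in>p. \<forall>b\<in>p. a \<noteq> b \<longrightarrow> col a \<noteq> col b) \<longleftrightarrow> contrasts k \<rho>" if pr: "is_pairing L \<rho>"
    proof
      assume r: "\<forall>p\<in>\<rho>. \<forall>a\<in>p. \<forall>b\<in>p. a \<noteq> b \<longrightarrow> col a \<noteq> col b"
      show "contrasts k \<rho>"
        unfolding contrasts_def
      proof (intro allI impI)
        fix a b assume ab: "{a, b} \<in> \<rho>" "a \<noteq> b"
        have "col a \<noteq> col b" by (rule r[rule_format, OF ab(1) _ _ ab(2)]) auto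
        moreover have "a \<in> {1..N}" "b \<in> {1..N}" using pairing_subset[OF pr ab(1)] L by auto
        ultimately show "contrasting (k a) (k b)" using col by blast
      qed
    next
      assume ct: "contrasts k \<rho>"
      show "\<forall>p\<in>\<rho>. \<forall>a\<in>p. \<forall>b\<in>p. a \<noteq> b \<longrightarrow> col a \<noteq> col b"
      proof (intro ballI impI)
        fix p a b assume p: "p \<in> \<rho>" "a \<in> p" "b \<in> p" "a \<noteq> b"
        obtain x y where xy: "p = {x, y}" "x < y" "x \<in> L" "y \<in> L" using pairing_pair[OF pr p(1)] .
        have "p = {a, b}" using p xy by auto
        then have "contrasting (k a) (k b)" using ct p unfolding contrasts_def by blast
        moreover have "a \<in> {1..N}" "b \<in> {1..N}" using pairing_subset[OF pr p(1)] L p by auto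
        ultimately show "col a \<noteq> col b" using col by blast
      qed
    qed
    then show ?thesis unfolding tripartite_def by blast
  qed
  have uniq: "\<rho> = \<sigma>" if "tripartite col L \<rho>" "tripartite col L \<sigma>" for \<rho> \<sigma>
    by (rule contrasting_pairing_unique[OF _ _ _ _ _ _ fin kL]) (use that in \<open>simp_all add: trip\<close>)
  have sgn: "(-1 :: real) ^ (\<Sum>p\<in>\<rho>. card (below L (Min p))) = ?s" if "tripartite col L \<rho>" for \<rho>
  proof -
    have "even (\<Sum>p\<in>\<rho>. card (below L (Min p))) \<longleftrightarrow> even (block_exponent k L)"
      by (rule pairing_sign) (use that fin kL in \<open>auto simp: trip\<close>)
    then show ?thesis by (simp only: minus_one_power_iff)
  qed
  have pw: "pair_weight L (\<lambda>i. block_vec (k i)) (?\<rho> m) = ?s * of_bool (tripartite col L (?\<rho> m))" if m: "m \<in> ?C" for m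
  proof (cases "tripartite col L (?\<rho> m)")
    case True
    then show ?thesis using pair_weight_blocks[OF \<rho>(1)[OF m] fin kL] sgn[OF True] unfolding trip by simp
  next
    case False
    then have "\<not> contrasts k (?\<rho> m)" using \<rho>[OF m] unfolding trip by blast
    then show ?thesis using pair_weight_blocks[OF \<rho>(1)[OF m] fin kL] False by simp
  qed
  have Z: "(\<Sum>m\<in>?C. of_bool (tripartite col L (?\<rho> m)) * dd_weight E wt (node ` L) m) = Ztrip V1 V2 E wt node col L"
  proof (cases "\<exists>\<rho>. tripartite col L \<rho>")
    case False
    then show ?thesis by (simp add: Ztrip_def)
  next
    case True
    then obtain \<sigma> where \<sigma>: "tripartite col L \<sigma>" by blast
    have the: "(THE \<rho>. tripartite col L \<rho>) = \<sigma>" by (rule the_equality) (use \<sigma> uniq in auto)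
    let ?\<tau> = "(\<lambda>p. node ` p) ` \<sigma>"
    have cfg: "m \<in> ?C \<longleftrightarrow> dd_config (V1 \<union> V2) E (node ` L) m" for m
      unfolding configs_def dd_config_def
      using joint_degree_removed[OF L D white black] by auto
    have pairs: "dd_pairs_as E m (node ` L) ?\<tau> \<longleftrightarrow> tripartite col L (?\<rho> m)" if m: "m \<in> ?C" for m
    proof -
      have injL: "inj_on node L" using node_inj L inj_on_subset by blast
      have \<sigma>p: "is_pairing L \<sigma>" using \<sigma> by (simp add: tripartite_def)
      have img: "{node i, node j} \<in> ?\<tau> \<longleftrightarrow> {i, j} \<in> \<sigma>" if "i \<in> L" "j \<in> L" for i j
      proof
        assume "{node i, node j} \<in> ?\<tau>"
        then obtain p where p: "p \<in> \<sigma>" "node ` {i, j} = node ` p" by auto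
        have "{i, j} = p"
          using inj_on_image_eq_iff[OF injL, of "{i, j}" p] p pairing_subset[OF \<sigma>p p(1)] that by simp
        then show "{i, j} \<in> \<sigma>" using p by simp
      next
        assume "{i, j} \<in> \<sigma>"
        then show "{node i, node j} \<in> ?\<tau>" by (intro image_eqI[of _ _ "{i, j}"]) auto
      qed
      have "dd_pairs_as E m (node ` L) ?\<tau> \<longleftrightarrow>
          (\<forall>i\<in>L. \<forall>j\<in>L. i \<noteq> j \<longrightarrow> ({i, j} \<in> ?\<rho> m \<longleftrightarrow> {i, j} \<in> \<sigma>))"
      proof -
        have "(node i \<noteq> node j \<longrightarrow> (edge_conn (singles E m) (node i) (node j) \<longleftrightarrow> {node i, node j} \<in> ?\<tau>)) \<longleftrightarrow>
            (i \<noteq> j \<longrightarrow> ({i, j} \<in> ?\<rho> m \<longleftrightarrow> {i, j} \<in> \<sigma>))" if ij: "i \<in> L" "j \<in> L" for i j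
          using img[OF ij] node_pairs_iff[OF ij, of "singles E m"] inj_on_eq_iff[OF injL ij] by metis
        then show ?thesis unfolding dd_pairs_as_def dd_conn_eq by simp
      qed
      also have "\<dots> \<longleftrightarrow> ?\<rho> m = \<sigma>"
      proof
        assume r: "\<forall>i\<in>L. \<forall>j\<in>L. i \<noteq> j \<longrightarrow> ({i, j} \<in> ?\<rho> m \<longleftrightarrow> {i, j} \<in> \<sigma>)"
        have "p \<in> ?\<rho> m \<longleftrightarrow> p \<in> \<sigma>" for p
        proof
          assume p: "p \<in> ?\<rho> m"
          obtain x y where "p = {x, y}" "x < y" "x \<in> L" "y \<in> L" using pairing_pair[OF \<rho>(1)[OF m] p] .
          then show "p \<in> \<sigma>" using r p by auto
        next
          assume p: "p \<in> \<sigma>"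
          obtain x y where "p = {x, y}" "x < y" "x \<in> L" "y \<in> L" using pairing_pair[OF \<sigma>p p] .
          then show "p \<in> ?\<rho> m" using r p by auto
        qed
        then show "?\<rho> m = \<sigma>" by blast
      qed simp
      also have "\<dots> \<longleftrightarrow> tripartite col L (?\<rho> m)" using \<sigma> uniq by metis
      finally show ?thesis .
    qed
    have finC: "finite ?C" by (rule finite_configs) (simp add: joint_degree_def)
    have "Ztrip V1 V2 E wt node col L =
        (\<Sum>m\<in>{m. dd_config (V1 \<union> V2) E (node ` L) m \<and> dd_pairs_as E m (node ` L) ?\<tau>}. dd_weight E wt (node ` L) m)"
      using True by (simp add: Ztrip_def the ZDD_def)
    also have "\<dots> = (\<Sum>m\<in>{m \<in> ?C. tripartite col L (?\<rho> m)}. dd_weight E wt (node ` L) m)"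
      by (rule sum.cong) (use cfg pairs in auto)
    also have "\<dots> = (\<Sum>m\<in>?C. of_bool (tripartite col L (?\<rho> m)) * dd_weight E wt (node ` L) m)"
      by (rule sum.mono_neutral_cong_left) (use finC in auto)
    finally show ?thesis ..
  qed
  have "(\<Sum>m\<in>?C. pair_weight L (\<lambda>i. block_vec (k i)) (?\<rho> m) * dd_weight E wt (node ` L) m) =
      ?s * Ztrip V1 V2 E wt node col L"
    unfolding Z[symmetric] sum_distrib_left by (rule sum.cong[OF refl]) (simp only: pw mult.assoc)
  with labelled_expansion[OF real L D c, of "\<lambda>i. block_vec (k i)"] show ?thesis by (simp only: mult.assoc)
qed

end

section \<open>Signs and colours\<close>

text \<open>The exponent of the sign in \<open>ztrip_expansion\<close>, apart from the factor that
  depends on \<open>n\<close> alone.\<close>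

definition sign_exponent :: "(nat \<Rightarrow> nat) \<Rightarrow> nat set \<Rightarrow> nat set \<Rightarrow> int" where
  "sign_exponent k L D = block_exponent k L + int (\<Sum>i\<in>D. card (below L i))"

lemma block_count_Diff:
  assumes "finite L" "U \<subseteq> L"
  shows "block_count k (L - U) q = block_count k L q - (\<Sum>z\<in>U. of_bool (k z = q))"
proof -
  have fU: "finite U" using assms finite_subset by blast
  have "{i \<in> L. k i = q} = {i \<in> L - U. k i = q} \<union> {i \<in> U. k i = q}" using assms by auto
  moreover have "{i \<in> L - U. k i = q} \<inter> {i \<in> U. k i = q} = {}" by auto
  ultimately have "card {i \<in> L. k i = q} = card {i \<in> L - U. k i = q} + card {i \<in> U. k i = q}"
    using assms(1) fU by (simp add: card_Un_disjoint)
  moreover have "(\<Sum>z\<in>U. of_bool (k z = q) :: int) = int (card {i \<in> U. k i = q})"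
    using fU by (simp add: of_bool_def sum.If_cases Int_def)
  ultimately show ?thesis by (simp add: block_count_def)
qed

lemma card_below_interval:
  assumes "U \<subseteq> {1..N}" "y \<in> {1..N}"
  shows "int (card (below ({1..N} - U) y)) = int y - 1 - (\<Sum>z\<in>U. of_bool (z < y))"
proof -
  have fU: "finite U" using assms finite_subset by blast
  have "{1..<y} = below ({1..N} - U) y \<union> {z \<in> U. z < y}" using assms by (auto simp: below_def)
  moreover have "below ({1..N} - U) y \<inter> {z \<in> U. z < y} = {}" by (auto simp: below_def)
  ultimately have "card {1..<y} = card (below ({1..N} - U) y) + card {z \<in> U. z < y}"
    using fU by (simp add: card_Un_disjoint below_def)
  moreover have "(\<Sum>z\<in>U. of_bool (z < y) :: int) = int (card {z \<in> U. z < y})"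
    using fU by (simp add: of_bool_def sum.If_cases Int_def)
  moreover have "int (card {1..<y}) = int y - 1" using assms(2) by simp
  ultimately show ?thesis by linarith
qed

lemma even_div2_shift:
  fixes X :: int
  shows "even ((X - 1) div 2) \<longleftrightarrow> (even (X div 2) \<longleftrightarrow> odd X)"
    and "even ((X - 2) div 2) \<longleftrightarrow> odd (X div 2)"
    and "even ((X + 1) div 2) \<longleftrightarrow> (even (X div 2) \<longleftrightarrow> even X)"
  by presburger+

text \<open>Arranged so that every quotient halves a fixed quantity minus a small shift, ready for
  \<open>even_div2_shift\<close>. Removing \<open>2 * s\<close> labels lowers half the total from
  \<open>n\<close> to \<open>n - s\<close>.\<close>

lemma even_tri_exponent:
  fixes c1 c2 c3 c4 n :: int
  assumes "c1 + c2 + c3 + c4 = 2 * n" "a1 + a2 + a3 + a4 = 2 * s"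
  shows "even (tri_exponent (c1 - a1) (c2 - a2) (c3 - a3) (c4 - a4)) \<longleftrightarrow>
    ((even ((c1 + c4 - (a1 + a4)) div 2) \<longleftrightarrow> even ((c3 - a3) div 2)) \<longleftrightarrow>
     (even ((n - c2 - (s - a2)) div 2) \<longleftrightarrow> even (c4 - a4) \<or> odd (n - s)))"
proof -
  have h: "(c1 - a1 + (c2 - a2) + (c3 - a3) + (c4 - a4)) div 2 = n - s" using assms by linarith
  have e: "c1 - a1 + (c4 - a4) = c1 + c4 - (a1 + a4)" "n - s - (c2 - a2) = n - c2 - (s - a2)" by simp_all
  have o: "even (n - s - 1) \<longleftrightarrow> odd (n - s)" by simp
  show ?thesis unfolding tri_exponent_def Let_def h e even_add even_mult_iff o by blast
qed


lemma even_sign_exponent: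
  fixes k :: "nat \<Rightarrow> nat" and n :: nat
  defines "c \<equiv> block_count k {1..2 * n}"
  assumes tot: "c 1 + c 2 + c 3 + c 4 = 2 * int n"
    and U: "U \<subseteq> {1..2 * n}" "card U = 2 * s" and D: "D \<subseteq> {1..2 * n}" and k: "\<And>z. z \<in> U \<Longrightarrow> k z \<in> {1..4}"
  defines "a \<equiv> \<lambda>q. \<Sum>z\<in>U. of_bool (k z = q)"
  shows "even (sign_exponent k ({1..2 * n} - U) D) \<longleftrightarrow>
    (((even ((c 1 + c 4 - (a 1 + a 4)) div 2) \<longleftrightarrow> even ((c 3 - a 3) div 2)) \<longleftrightarrow>
     (even ((int n - c 2 - (int s - a 2)) div 2) \<longleftrightarrow> even (c 4 - a 4) \<or> odd (int n - int s))) \<longleftrightarrow>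
    even (\<Sum>i\<in>D. int i - 1 - (\<Sum>z\<in>U. of_bool (z < i))))"
proof -
  have bc: "block_count k ({1..2 * n} - U) q = c q - a q" for q
    unfolding c_def a_def by (rule block_count_Diff) (use U in auto)
  have bl: "int (\<Sum>i\<in>D. card (below ({1..2 * n} - U) i)) = (\<Sum>i\<in>D. int i - 1 - (\<Sum>z\<in>U. of_bool (z < i)))"
    unfolding of_nat_sum by (rule sum.cong[OF refl]) (use card_below_interval[OF U(1)] D in blast)
  have "a 1 + a 2 + a 3 + a 4 = (\<Sum>z\<in>U. 1)"
    unfolding a_def sum.distrib[symmetric]
  proof (rule sum.cong[OF refl])
    fix z assume "z \<in> U"
    then have "k z \<in> {1, 2, 3, 4}" using k[of z] by auto
    then show "of_bool (k z = 1) + of_bool (k z = 2) + of_bool (k z = 3) + of_bool (k z = 4) = (1 :: int)" by auto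
  qed
  then have sm: "a 1 + a 2 + a 3 + a 4 = 2 * int s" using U(2) by simp
  show ?thesis
    unfolding sign_exponent_def block_exponent_def bc bl even_add even_tri_exponent[OF tot sm] ..
qed

text \<open>The agreement of the signs of the three products, by a finite check: seven block
  patterns for either place of \<open>x\<close>. Once the shifts are resolved, each case is
  propositional in the parities of \<open>e\<close>, \<open>d\<close>, \<open>m\<close>,
  \<open>c4\<close>, the three halves and the positions \<open>y\<close> and
  \<open>v\<close>.\<close>

lemma sign_exponent_parity:
  fixes k :: "nat \<Rightarrow> nat"
  assumes tot: "block_count k {1..2 * n} 1 + block_count k {1..2 * n} 2 + block_count k {1..2 * n} 3 + block_count k {1..2 * n} 4 = 2 * int n"
    and mem: "x \<in> {1..2 * n}" "y \<in> {1..2 * n}" "w \<in> {1..2 * n}" "v \<in> {1..2 * n}"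
    and ord: "x < y \<and> y < w \<and> w < v \<or> y < w \<and> w < v \<and> v < x"
    and blocks: "(if x < y then (k x, k y, k w, k v) else (k y, k w, k v, k x)) \<in>
      {(1, 1, 2, 3), (1, 2, 2, 3), (1, 2, 3, 3), (1, 2, 3, 4), (2, 2, 3, 4), (2, 3, 3, 4), (2, 3, 4, 4)}"
  defines "s \<equiv> \<lambda>U D. sign_exponent k ({1..2 * n} - U) D"
  shows "(even (s {} {} + s {x, y, w, v} {y, v}) \<longleftrightarrow> even (s {x, y} {y} + s {w, v} {v})) \<and>
    (even (s {} {} + s {x, y, w, v} {y, v}) \<longleftrightarrow> even (s {x, v} {v} + s {w, y} {y}))"
proof -
  define c1 c2 c3 c4 where "c1 = block_count k {1..2 * n} 1" and "c2 = block_count k {1..2 * n} 2"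
    and "c3 = block_count k {1..2 * n} 3" and "c4 = block_count k {1..2 * n} 4"
  define m where "m = int n"
  define e d where "e = c1 + c4" and "d = m - c2"
  have t: "c1 + c2 + c3 + c4 = 2 * m" using tot by (simp only: c1_def c2_def c3_def c4_def m_def)
  \<comment> \<open>The total is \<open>2 * m\<close>, so \<open>c3 = m + d - e\<close>; this
    removes one of the otherwise independent parities.\<close>
  have par: "even c3 \<longleftrightarrow> (even e \<longleftrightarrow> (even d \<longleftrightarrow> even m))" using t unfolding e_def d_def by presburger
  note E = even_sign_exponent[of k n, OF tot, folded c1_def c2_def c3_def c4_def m_def, folded e_def d_def]
  have ne: "x \<noteq> y" "x \<noteq> w" "x \<noteq> v" "y \<noteq> w" "y \<noteq> v" "w \<noteq> v" using ord by auto
  have k4: "k z \<in> {1..4}" if "z \<in> {x, y, w, v}" for z using blocks that by (auto split: if_splits)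
  have sum1: "sum f {a} = f a" for f :: "nat \<Rightarrow> int" and a by simp
  have sum2: "sum f {a, b} = f a + f b" if "a \<noteq> b" for f :: "nat \<Rightarrow> int" and a b using that by simp
  have sum4: "sum f {a, b, c, d} = f a + f b + f c + f d"
    if "a \<noteq> b" "a \<noteq> c" "a \<noteq> d" "b \<noteq> c" "b \<noteq> d" "c \<noteq> d" for f :: "nat \<Rightarrow> int" and a b c d using that by simp
  have E0: "even (s {} {}) \<longleftrightarrow> ((even (e div 2) \<longleftrightarrow> even (c3 div 2)) \<longleftrightarrow> (even (d div 2) \<longleftrightarrow> even c4 \<or> odd m))"
    unfolding s_def by (subst E[where s = 0]) auto
  have Exywv: "even (s {x, y, w, v} {y, v}) \<longleftrightarrow>
      (((even ((e - ((of_bool (k x = 1) + of_bool (k y = 1) + of_bool (k w = 1) + of_bool (k v = 1)) + (of_bool (k x = 4) + of_bool (k y = 4) + of_bool (k w = 4) + of_bool (k v = 4)))) div 2) \<longleftrightarrow> even ((c3 - (of_bool (k x = 3) + of_bool (k y = 3) + of_bool (k w = 3) + of_bool (k v = 3))) div 2)) \<longleftrightarrow> (even ((d - (int 2 - (of_bool (k x = 2) + of_bool (k y = 2) + of_bool (k w = 2) + of_bool (k v = 2)))) div 2) \<longleftrightarrow> even (c4 - (of_bool (k x = 4) + of_bool (k y = 4) + of_bool (k w = 4) + of_bool (k v = 4))) \<or> odd (m - int 2))) \<longleftrightarrow> even ((int y - 1 - (of_bool (x < y) + of_bool (y < y) + of_bool (w < y) + of_bool (v < y))) + (int v - 1 -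 (of_bool (x < v) + of_bool (y < v) + of_bool (w < v) + of_bool (v < v)))))"
  proof -
    have "{x, y, w, v} \<subseteq> {1..2 * n}" "card {x, y, w, v} = 2 * 2" "{y, v} \<subseteq> {1..2 * n}" "\<And>z. z \<in> {x, y, w, v} \<Longrightarrow> k z \<in> {1..4}"
      using mem ne k4 by auto
    then show ?thesis unfolding s_def by (subst E) (simp_all only: sum4[OF ne] sum2[OF ne(5)])
  qed
  have Exy: "even (s {x, y} {y}) \<longleftrightarrow>
      (((even ((e - ((of_bool (k x = 1) + of_bool (k y = 1)) + (of_bool (k x = 4) + of_bool (k y = 4)))) div 2) \<longleftrightarrow> even ((c3 - (of_bool (k x = 3) + of_bool (k y = 3))) div 2)) \<longleftrightarrow> (even ((d - (int 1 - (of_bool (k x = 2) + of_bool (k y = 2)))) div 2) \<longleftrightarrow> even (c4 - (of_bool (k x = 4) + of_bool (k y = 4))) \<or> odd (m - int 1))) \<longleftrightarrow> even ((int y - 1 - (of_bool (x < y) + of_bool (y < y)))))"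
  proof -
    have "{x, y} \<subseteq> {1..2 * n}" "card {x, y} = 2 * 1" "{y} \<subseteq> {1..2 * n}" "\<And>z. z \<in> {x, y} \<Longrightarrow> k z \<in> {1..4}"
      using mem ne k4 by auto
    then show ?thesis unfolding s_def by (subst E) (simp_all only: sum2[OF ne(1)] sum1)
  qed
  have Ewv: "even (s {w, v} {v}) \<longleftrightarrow>
      (((even ((e - ((of_bool (k w = 1) + of_bool (k v = 1)) + (of_bool (k w = 4) + of_bool (k v = 4)))) div 2) \<longleftrightarrow> even ((c3 - (of_bool (k w = 3) + of_bool (k v = 3))) div 2)) \<longleftrightarrow> (even ((d - (int 1 - (of_bool (k w = 2) + of_bool (k v = 2)))) div 2) \<longleftrightarrow> even (c4 - (of_bool (k w = 4) + of_bool (k v = 4))) \<or> odd (m - int 1))) \<longleftrightarrow> even ((int v - 1 - (of_bool (w < v) + of_bool (v < v)))))"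
  proof -
    have "{w, v} \<subseteq> {1..2 * n}" "card {w, v} = 2 * 1" "{v} \<subseteq> {1..2 * n}" "\<And>z. z \<in> {w, v} \<Longrightarrow> k z \<in> {1..4}"
      using mem ne k4 by auto
    then show ?thesis unfolding s_def by (subst E) (simp_all only: sum2[OF ne(6)] sum1)
  qed
  have Exv: "even (s {x, v} {v}) \<longleftrightarrow>
      (((even ((e - ((of_bool (k x = 1) + of_bool (k v = 1)) + (of_bool (k x = 4) + of_bool (k v = 4)))) div 2) \<longleftrightarrow> even ((c3 - (of_bool (k x = 3) + of_bool (k v = 3))) div 2)) \<longleftrightarrow> (even ((d - (int 1 - (of_bool (k x = 2) + of_bool (k v = 2)))) div 2) \<longleftrightarrow> even (c4 - (of_bool (k x = 4) + of_bool (k v = 4))) \<or> odd (m - int 1))) \<longleftrightarrow> even ((int v - 1 - (of_bool (x < v) + of_bool (v < v)))))"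
  proof -
    have "{x, v} \<subseteq> {1..2 * n}" "card {x, v} = 2 * 1" "{v} \<subseteq> {1..2 * n}" "\<And>z. z \<in> {x, v} \<Longrightarrow> k z \<in> {1..4}"
      using mem ne k4 by auto
    then show ?thesis unfolding s_def by (subst E) (simp_all only: sum2[OF ne(3)] sum1)
  qed
  have Ewy: "even (s {w, y} {y}) \<longleftrightarrow>
      (((even ((e - ((of_bool (k w = 1) + of_bool (k y = 1)) + (of_bool (k w = 4) + of_bool (k y = 4)))) div 2) \<longleftrightarrow> even ((c3 - (of_bool (k w = 3) + of_bool (k y = 3))) div 2)) \<longleftrightarrow> (even ((d - (int 1 - (of_bool (k w = 2) + of_bool (k y = 2)))) div 2) \<longleftrightarrow> even (c4 - (of_bool (k w = 4) + of_bool (k y = 4))) \<or> odd (m - int 1))) \<longleftrightarrow> even ((int y - 1 - (of_bool (w < y) + of_bool (y < y)))))"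
  proof -
    have "{w, y} \<subseteq> {1..2 * n}" "card {w, y} = 2 * 1" "{y} \<subseteq> {1..2 * n}" "\<And>z. z \<in> {w, y} \<Longrightarrow> k z \<in> {1..4}"
      using mem ne k4 by auto
    then show ?thesis unfolding s_def by (subst E) (simp_all only: sum2[OF ne(4)[symmetric]] sum1)
  qed
  note all = E0 Exywv Exy Ewv Exv Ewy
  from ord show ?thesis
  proof
    assume o: "x < y \<and> y < w \<and> w < v"
    then have lt: "(x < y) = True" "(y < x) = False" "(x < w) = True" "(w < x) = False" "(x < v) = True" "(v < x) = False" "(y < w) = True" "(w < y) = False" "(y < v) = True" "(v < y) = False" "(w < v) = True" "(v < w) = False" by auto
    have "(k x, k y, k w, k v) \<in>
      {(1, 1, 2, 3), (1, 2, 2, 3), (1, 2, 3, 3), (1, 2, 3, 4), (2, 2, 3, 4), (2, 3, 3, 4), (2, 3, 4, 4)}"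
      using blocks lt by simp
    then consider "k x = 1" "k y = 1" "k w = 2" "k v = 3"
      | "k x = 1" "k y = 2" "k w = 2" "k v = 3"
      | "k x = 1" "k y = 2" "k w = 3" "k v = 3"
      | "k x = 1" "k y = 2" "k w = 3" "k v = 4"
      | "k x = 2" "k y = 2" "k w = 3" "k v = 4"
      | "k x = 2" "k y = 3" "k w = 3" "k v = 4"
      | "k x = 2" "k y = 3" "k w = 4" "k v = 4" by auto
    then show ?thesis
      unfolding even_add all
      by cases (simp_all add: lt even_div2_shift par, argo+)
  next
    assume o: "y < w \<and> w < v \<and> v < x"
    then have lt: "(y < w) = True" "(w < y) = False" "(y < v) = True" "(v < y) = False" "(y < x) = True" "(x < y) = False" "(w < v) = True" "(v < w) = False" "(w < x) = True" "(x < w) = False" "(v < x) = True" "(x < v) = False" by auto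
    have "(k y, k w, k v, k x) \<in>
      {(1, 1, 2, 3), (1, 2, 2, 3), (1, 2, 3, 3), (1, 2, 3, 4), (2, 2, 3, 4), (2, 3, 3, 4), (2, 3, 4, 4)}"
      using blocks lt by simp
    then consider "k y = 1" "k w = 1" "k v = 2" "k x = 3"
      | "k y = 1" "k w = 2" "k v = 2" "k x = 3"
      | "k y = 1" "k w = 2" "k v = 3" "k x = 3"
      | "k y = 1" "k w = 2" "k v = 3" "k x = 4"
      | "k y = 2" "k w = 2" "k v = 3" "k x = 4"
      | "k y = 2" "k w = 3" "k v = 3" "k x = 4"
      | "k y = 2" "k w = 3" "k v = 4" "k x = 4" by auto
    then show ?thesis
      unfolding even_add all
      by cases (simp_all add: lt even_div2_shift par, argo+)
  qed
qed

text \<open>Let \<open>s\<close> and \<open>t\<close> be the positions of \<open>i\<close> and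
  \<open>j\<close> in the cyclic interval. If \<open>s \<le> t\<close>, walking on from
  \<open>i\<close> reaches \<open>j\<close> directly; otherwise walking on from \<open>j\<close>
  passes \<open>N\<close> and reaches \<open>i\<close>. A shorter walk would give two congruent
  positions less than \<open>N\<close> apart.\<close>

lemma circ_contig_arc:
  assumes S: "circ_contig N S" and N: "S \<subseteq> {1..N}" and ij: "i \<in> S" "j \<in> S" "i < j"
  shows "{i..j} \<subseteq> S \<or> {1..i} \<union> {j..N} \<subseteq> S"
proof -
  obtain a K where K: "K \<le> N" "S = {(a + t) mod N + 1 | t. t < K}" using S by (auto simp: circ_contig_def)
  obtain s t where s: "s < K" "i = (a + s) mod N + 1" and t: "t < K" "j = (a + t) mod N + 1"
    using ij K(2) by blast
  have bounds: "1 \<le> i" "j \<le> N" using N ij by auto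
  have mem: "z \<in> S" if "u < K" "(a + u) mod N = z - 1" "1 \<le> z" for u z
    using that K(2) by force
  \<comment> \<open>\<open>q\<close> counts how often the walk of \<open>e\<close> steps passes
    \<open>N\<close>; labels are residues plus 1.\<close>
  have shift: "(a + (b + e)) mod N = z - 1" if "(a + b) mod N + e = z - 1 + q * N" "1 \<le> z" "z \<le> N" for b e z q
  proof -
    have "(a + (b + e)) mod N = ((a + b) mod N + e) mod N" by (simp add: add.assoc mod_add_left_eq)
    also have "\<dots> = (z - 1) mod N" unfolding that(1) by simp
    finally show ?thesis using that(2,3) by simp
  qed
  show ?thesis
  proof (cases "s \<le> t")
    case True
    have "j - i \<le> t - s"
    proof (rule ccontr)
      assume n: "\<not> j - i \<le> t - s"
      have "(a + (s + (j - i))) mod N = j - 1"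
        by (rule shift[where q = 0]) (use s(2) ij(3) bounds in auto)
      then have "(a + (s + (j - i))) mod N = (a + t) mod N" using t(2) by simp
      then have "N dvd a + (s + (j - i)) - (a + t)" using n True by (subst (asm) mod_eq_dvd_iff_nat) auto
      then have "N \<le> a + (s + (j - i)) - (a + t)" using n True by (intro dvd_imp_le) auto
      then show False using ij(3) bounds True by linarith
    qed
    have "z \<in> S" if z: "z \<in> {i..j}" for z
    proof (rule mem[of "s + (z - i)"])
      show "s + (z - i) < K" using z \<open>j - i \<le> t - s\<close> t(1) True by auto
      show "(a + (s + (z - i))) mod N = z - 1"
        by (rule shift[where q = 0]) (use z s(2) bounds in auto)
    qed (use z bounds in auto)
    then show ?thesis by blast
  next
    case False
    have le: "N - j + i \<le> s - t"
    proof (rule ccontr)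
      assume n: "\<not> N - j + i \<le> s - t"
      have "(a + (t + (N - j + i))) mod N = i - 1"
        by (rule shift[where q = 1]) (use t(2) ij(3) bounds in auto)
      then have "(a + (t + (N - j + i))) mod N = (a + s) mod N" using s(2) by simp
      then have "N dvd a + (t + (N - j + i)) - (a + s)" using n False by (subst (asm) mod_eq_dvd_iff_nat) auto
      then have "N \<le> a + (t + (N - j + i)) - (a + s)" using n False by (intro dvd_imp_le) auto
      then show False using ij(3) bounds False by linarith
    qed
    have "z \<in> S" if z: "z \<in> {j..N}" for z
    proof (rule mem[of "t + (z - j)"])
      show "t + (z - j) < K" using z le s(1) False by auto
      show "(a + (t + (z - j))) mod N = z - 1"
        by (rule shift[where q = 0]) (use z t(2) bounds in auto)
    qed (use z bounds ij in auto)
    moreover have "z \<in> S" if z: "z \<in> {1..i}" for z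
    proof (rule mem[of "t + (N - j + z)"])
      show "t + (N - j + z) < K" using z le s(1) False by auto
      show "(a + (t + (N - j + z))) mod N = z - 1"
        by (rule shift[where q = 1]) (use z t(2) bounds ij in auto)
    qed (use z in auto)
    ultimately show ?thesis by blast
  qed
qed

lemma rgb_third:
  fixes r g :: rgb
  assumes "r \<noteq> g"
  shows "\<exists>b. b \<noteq> r \<and> b \<noteq> g \<and> (\<forall>c. c = r \<or> c = g \<or> c = b)"
proof -
  have all: "(\<forall>c. P c) \<longleftrightarrow> P Red \<and> P Green \<and> P Blue" for P by (metis rgb.exhaust)
  have ex: "(\<exists>c. P c) \<longleftrightarrow> P Red \<or> P Green \<or> P Blue" for P by (metis rgb.exhaust)
  show ?thesis using assms by (cases r; cases g) (simp_all add: all ex)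
qed

text \<open>Cut the circle before label 1 and let \<open>p\<close> be the first label of another
  colour. Block 1 is the initial run, blocks 2 and 3 hold the colour of \<open>p\<close> and the
  third colour, and block 4 holds the labels after \<open>p\<close> where the first colour returns.
  Contiguity puts the blocks in this order.\<close>

lemma colour_blocks:
  fixes col :: "nat \<Rightarrow> rgb"
  assumes cc: "\<forall>c. circ_contig N {i \<in> {1..N}. col i = c}"
  obtains k where "\<And>i. i \<in> {1..N} \<Longrightarrow> k i \<in> {1..4 :: nat}"
    "\<And>i j. i \<in> {1..N} \<Longrightarrow> j \<in> {1..N} \<Longrightarrow> i \<le> j \<Longrightarrow> k i \<le> k j"
    "\<And>i j. i \<in> {1..N} \<Longrightarrow> j \<in> {1..N} \<Longrightarrow> col i \<noteq> col j \<longleftrightarrow> contrasting (k i) (k j)"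
proof (cases "\<exists>i\<in>{1..N}. col i \<noteq> col 1")
  case False
  then have same: "col i = col 1" if "i \<in> {1..N}" for i using that by blast
  show ?thesis
  proof (rule that[of "\<lambda>_. 1"])
    show "col i \<noteq> col j \<longleftrightarrow> contrasting 1 1" if "i \<in> {1..N}" "j \<in> {1..N}" for i j
      using same[OF that(1)] same[OF that(2)] by (simp add: contrasting_def)
  qed simp_all
next
  case True
  define p where "p = (LEAST i. i \<in> {1..N} \<and> col i \<noteq> col 1)"
  have "p \<in> {1..N} \<and> col p \<noteq> col 1" unfolding p_def by (rule LeastI_ex) (use True in blast)
  then have p: "p \<in> {1..N}" "col p \<noteq> col 1" by auto
  have pmin: "p \<le> i" if "i \<in> {1..N}" "col i \<noteq> col 1" for i
    unfolding p_def by (rule Least_le) (use that in blast)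
  have one: "1 \<in> {1..N}" using p by auto
  define r g where "r = col 1" and "g = col p"
  have "r \<noteq> g" using p by (simp add: r_def g_def)
  then obtain b where b: "b \<noteq> r" "b \<noteq> g" "\<And>c. c = r \<or> c = g \<or> c = b" using rgb_third by blast
  have arc: "{i..j} \<subseteq> {l. col l = c} \<or> {1..i} \<union> {j..N} \<subseteq> {l. col l = c}"
    if "i \<in> {1..N}" "j \<in> {1..N}" "i < j" "col i = c" "col j = c" for i j c
  proof -
    have "circ_contig N {i \<in> {1..N}. col i = c}" using cc by blast
    from circ_contig_arc[OF this _ _ _ that(3)]
    have "{i..j} \<subseteq> {i \<in> {1..N}. col i = c} \<or> {1..i} \<union> {j..N} \<subseteq> {i \<in> {1..N}. col i = c}"
      using that by blast
    then show ?thesis by blast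
  qed
  define k :: "nat \<Rightarrow> nat" where "k i = (if col i = r then (if p < i then 4 else 1) else if col i = g then 2 else 3)" for i
  show ?thesis
  proof (rule that[of k])
    show "k i \<in> {1..4}" for i by (simp add: k_def)
    show "col i \<noteq> col j \<longleftrightarrow> contrasting (k i) (k j)" for i j
      using b(1,2) \<open>r \<noteq> g\<close> b(3)[of "col i"] b(3)[of "col j"]
      by (auto simp: k_def contrasting_def doubleton_eq_iff)
    fix i j assume ij: "i \<in> {1..N}" "j \<in> {1..N}" "i \<le> j"
    show "k i \<le> k j"
    proof (cases "i = j")
      case False
      then have lt: "i < j" using ij by simp
      have after_p: "p < i \<Longrightarrow> col i = r \<Longrightarrow> col j = r"
      proof -
        assume h: "p < i" "col i = r"
        \<comment> \<open>The arc from 1 to \<open>i\<close> contains \<open>p\<close>, which has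
          another colour, so the arc from \<open>i\<close> to \<open>N\<close> has colour
          \<open>r\<close>.\<close>
        have "{1..i} \<subseteq> {l. col l = r} \<or> {1..1} \<union> {i..N} \<subseteq> {l. col l = r}"
          by (rule arc) (use one ij h p in \<open>auto simp: r_def\<close>)
        moreover have "j \<in> {i..N}" using ij lt by simp
        ultimately have "{1..i} \<subseteq> {l. col l = r} \<or> j \<in> {l. col l = r}" by blast
        moreover have "p \<in> {1..i}" using p h by auto
        ultimately show "col j = r" using p(2) by (auto simp: r_def)
      qed
      have after_b: "col i = b \<Longrightarrow> col j \<noteq> g"
      proof
        assume h: "col i = b" "col j = g"
        have "p \<le> i" using pmin ij(1) h(1) b(1) by (auto simp: r_def)
        moreover have "p \<noteq> i" using h(1) b(2) by (auto simp: g_def)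
        ultimately have pi: "p < i" by simp
        \<comment> \<open>Colour \<open>g\<close> would have to fill either the arc through
          \<open>i\<close> or the arc through 1, both of which contain another colour.\<close>
        have "{p..j} \<subseteq> {l. col l = g} \<or> {1..p} \<union> {j..N} \<subseteq> {l. col l = g}"
          by (rule arc) (use p ij pi lt h in \<open>auto simp: g_def\<close>)
        moreover have "i \<in> {p..j}" "1 \<in> {1..p}" using pi lt p by auto
        ultimately have "col i = g \<or> col 1 = g" by blast
        then show False using h(1) b(2) \<open>r \<noteq> g\<close> by (auto simp: r_def)
      qed
      have p_lt: "col i \<noteq> r \<Longrightarrow> p < j" using pmin[OF ij(1)] lt by (auto simp: r_def)
      consider "col i = r" "p < i" | "col i = r" "\<not> p < i" | "col i = g" | "col i = b" using b(3) by blast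
      then show ?thesis
      proof cases
        case 1
        then show ?thesis using after_p lt by (simp add: k_def)
      next
        case 2
        then show ?thesis by (simp add: k_def)
      next
        case 3
        then show ?thesis using p_lt \<open>r \<noteq> g\<close> by (simp add: k_def)
      next
        case 4
        then show ?thesis using p_lt after_b b(1,2) by (simp add: k_def)
      qed
    qed simp
  qed
qed

lemma block_count_total:
  assumes k: "\<And>i. i \<in> {1..N} \<Longrightarrow> k i \<in> {1..4}"
  shows "block_count k {1..N} 1 + block_count k {1..N} 2 + block_count k {1..N} 3 + block_count k {1..N} 4 = int N"
proof -
  have "int (card {i \<in> {1..N}. k i \<le> 4}) = (\<Sum>r\<in>{1..4}. block_count k {1..N} r)"
    by (rule card_blocks) (use k in auto)
  moreover have "{i \<in> {1..N}. k i \<le> 4} = {1..N}" using k by force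
  ultimately show ?thesis by (simp add: numeral_eq_Suc)
qed

text \<open>Three pairwise contrasting blocks are 2, 3 and one of 1 and 4. The listed tuples are the
  monotone ones containing such a triple.\<close>

lemma four_blocks:
  assumes q: "q1 \<in> {1..4 :: nat}" "q2 \<in> {1..4}" "q3 \<in> {1..4}" "q4 \<in> {1..4}" "q1 \<le> q2" "q2 \<le> q3" "q3 \<le> q4"
    and t: "{s1, s2, s3} \<subseteq> {q1, q2, q3, q4}" "contrasting s1 s2" "contrasting s1 s3" "contrasting s2 s3"
  shows "(q1, q2, q3, q4) \<in>
    {(1, 1, 2, 3), (1, 2, 2, 3), (1, 2, 3, 3), (1, 2, 3, 4), (2, 2, 3, 4), (2, 3, 3, 4), (2, 3, 4, 4)}"
proof -
  have s: "s1 \<in> {1, 2, 3, 4}" "s2 \<in> {1, 2, 3, 4}" "s3 \<in> {1, 2, 3, 4}"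
    using subsetD[OF t(1), of s1] subsetD[OF t(1), of s2] subsetD[OF t(1), of s3] q by auto
  have "2 \<in> {s1, s2, s3} \<and> 3 \<in> {s1, s2, s3} \<and> (1 \<in> {s1, s2, s3} \<or> 4 \<in> {s1, s2, s3})"
    using s t(2-4) by (elim insertE emptyE; simp add: contrasting_def doubleton_eq_iff)
  then have "2 \<in> {q1, q2, q3, q4}" "3 \<in> {q1, q2, q3, q4}" "1 \<in> {q1, q2, q3, q4} \<or> 4 \<in> {q1, q2, q3, q4}"
    using t(1) by blast+
  note mem = this
  have extra: "q2 = 2 \<or> q1 = 2 \<or> q3 = 2" "q2 = 3 \<or> q4 = 3 \<or> q3 = 3" "q1 = 1 \<or> q4 = 4"
    using mem q by auto
  have "q1 = 1 \<or> q1 = 2" "q4 = 3 \<or> q4 = 4" "q2 = 1 \<or> q2 = 2 \<or> q2 = 3 \<or> q2 = 4" "q3 = 1 \<or> q3 = 2 \<or> q3 = 3 \<or> q3 = 4"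
    using mem(1,2) q by auto
  then show ?thesis by (elim disjE) (use extra q(5-7) in simp_all)
qed

lemma upt_split_four:
  assumes "1 \<le> a" "a < b" "b < c" "c < d" "d \<le> M"
  shows "\<exists>S0 S1 S2 S3 S4. [1..<Suc M] = S0 @ a # S1 @ b # S2 @ c # S3 @ d # S4 \<and>
    (set S0 \<union> set S1 \<union> set S2 \<union> set S3 \<union> set S4) \<inter> {a, b, c, d} = {}"
proof -
  have s: "[i..<k] = [i..<j] @ j # [Suc j..<k]" if "i \<le> j" "j < k" for i j k :: nat
    using that upt_add_eq_append[of i j "k - j"] upt_conv_Cons[of j k] by simp
  have "[1..<Suc M] = [1..<a] @ a # [Suc a..<b] @ b # [Suc b..<c] @ c # [Suc c..<d] @ d # [Suc d..<Suc M]"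
    using assms s[of 1 a "Suc M"] s[of "Suc a" b "Suc M"] s[of "Suc b" c "Suc M"] s[of "Suc c" d "Suc M"]
    by (simp del: upt_Suc)
  moreover have "(set [1..<a] \<union> set [Suc a..<b] \<union> set [Suc b..<c] \<union> set [Suc c..<d] \<union> set [Suc d..<Suc M]) \<inter> {a, b, c, d} = {}"
    using assms by auto
  ultimately show ?thesis by blast
qed

context
  fixes n :: nat and r :: "nat \<Rightarrow> nat \<Rightarrow> real" and u u' :: "nat \<Rightarrow> real \<times> real"
  assumes dual: "\<And>i. wedge (u i) (u' i) = 1"
begin

text \<open>The rows coming from one of the four distinguished labels, when the labels in
  \<open>U\<close> are removed and those of them in \<open>D\<close> are doubled.\<close>

definition slot :: "nat set \<Rightarrow> nat set \<Rightarrow> nat \<Rightarrow> (nat \<Rightarrow> real) list" where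
  "slot U D i = (if i \<notin> U then [tensor_row n (r i) (u i)]
     else if i \<in> D then [tensor_row n (r i) (1, 0), tensor_row n (r i) (0, 1)] else [])"

lemma labelled_rows_four:
  assumes s: "[1..<Suc M] = S0 @ p1 # S1 @ p2 # S2 @ p3 # S3 @ p4 # S4"
    and d: "(set S0 \<union> set S1 \<union> set S2 \<union> set S3 \<union> set S4) \<inter> {p1, p2, p3, p4} = {}"
    and U: "U \<subseteq> {p1, p2, p3, p4}"
  shows "labelled_rows n M r ({1..M} - U) D u =
    map (\<lambda>i. tensor_row n (r i) (u i)) S0 @ slot U D p1 @ map (\<lambda>i. tensor_row n (r i) (u i)) S1 @ slot U D p2 @
    map (\<lambda>i. tensor_row n (r i) (u i)) S2 @ slot U D p3 @ map (\<lambda>i. tensor_row n (r i) (u i)) S3 @ slot U D p4 @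
    map (\<lambda>i. tensor_row n (r i) (u i)) S4"
proof -
  let ?g = "\<lambda>i. if i \<in> {1..M} - U then [tensor_row n (r i) (u i)]
     else if i \<in> D then [tensor_row n (r i) (1, 0), tensor_row n (r i) (0, 1)] else []"
  have mem: "z \<in> {1..M}" if "z \<in> set (S0 @ p1 # S1 @ p2 # S2 @ p3 # S3 @ p4 # S4)" for z
    using that unfolding s[symmetric] by auto
  have seg: "concat (map ?g S) = map (\<lambda>i. tensor_row n (r i) (u i)) S"
    if "set S \<subseteq> {1..M} - {p1, p2, p3, p4}" for S
  proof -
    have "map ?g S = map (\<lambda>i. [tensor_row n (r i) (u i)]) S" by (rule map_cong[OF refl]) (use that U in auto)
    then have "concat (map ?g S) = concat (map (\<lambda>i. [tensor_row n (r i) (u i)]) S)" by (rule arg_cong)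
    then show ?thesis by (simp only: concat_map_singleton)
  qed
  have sl: "?g p = slot U D p" if "p \<in> {p1, p2, p3, p4}" for p
    using mem[of p] that by (auto simp: slot_def)
  have sub: "set S \<subseteq> {1..M} - {p1, p2, p3, p4}" if "S \<in> {S0, S1, S2, S3, S4}" for S
  proof
    fix z assume "z \<in> set S"
    then have "z \<in> set (S0 @ p1 # S1 @ p2 # S2 @ p3 # S3 @ p4 # S4)" "z \<notin> {p1, p2, p3, p4}" using that d by auto
    then show "z \<in> {1..M} - {p1, p2, p3, p4}" using mem by blast
  qed
  show ?thesis
    unfolding labelled_rows_def s map_append list.map concat_append concat.simps
    using seg[OF sub] sl by simp
qed

text \<open>Cutting the row list at the four labels and writing the doubled rows of \<open>y\<close>
  and \<open>v\<close> with the vectors \<open>u\<close> and \<open>u'\<close> yields the row lists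
  of \<open>list_det_condense1\<close> or \<open>list_det_condense2\<close>, depending on whether
  \<open>x\<close> comes first or last.\<close>

lemma labelled_condensation:
  assumes ord: "x < y \<and> y < w \<and> w < v \<or> y < w \<and> w < v \<and> v < x"
    and mem: "x \<in> {1..2 * n}" "y \<in> {1..2 * n}" "w \<in> {1..2 * n}" "v \<in> {1..2 * n}"
  defines "f \<equiv> \<lambda>U D. list_det (2 * n) (labelled_rows n (2 * n) r ({1..2 * n} - U) D u)"
  shows "f {} {} * f {x, y, w, v} {y, v} = f {x, y} {y} * f {w, v} {v} + f {x, v} {v} * f {w, y} {y}"
proof -
  let ?a = "\<lambda>i. tensor_row n (r i) (u i)" and ?b = "\<lambda>i. tensor_row n (r i) (u' i)"
  let ?s = "\<lambda>i. tensor_row n (r i) (1, 0)" and ?t = "\<lambda>i. tensor_row n (r i) (0, 1)"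
  have dbl: "list_det (2 * n) (xs @ ?s i # ?t i # ys) = list_det (2 * n) (xs @ ?a i # ?b i # ys)"
    if "2 * n = length xs + Suc (Suc (length ys))" for xs ys i
    by (rule list_det_double_row[OF that]) (use dual[of i] in \<open>simp add: wedge_def\<close>)
  from ord show ?thesis
  proof
    assume o: "x < y \<and> y < w \<and> w < v"
    then obtain S0 S1 S2 S3 S4 where s: "[1..<Suc (2 * n)] = S0 @ x # S1 @ y # S2 @ w # S3 @ v # S4"
      and d: "(set S0 \<union> set S1 \<union> set S2 \<union> set S3 \<union> set S4) \<inter> {x, y, w, v} = {}"
      using upt_split_four[of x y w v "2 * n"] mem by auto
    have ne: "x \<noteq> y" "x \<noteq> w" "x \<noteq> v" "y \<noteq> w" "y \<noteq> v" "w \<noteq> v" using o by auto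
    let ?X0 = "map ?a S0" and ?X1 = "map ?a S1" and ?X2 = "map ?a S2" and ?X3 = "map ?a S3" and ?X4 = "map ?a S4"
    have len: "2 * n = length ?X0 + length ?X1 + length ?X2 + length ?X3 + length ?X4 + 4"
      using arg_cong[OF s, of length] by (simp del: upt_Suc)
    note R = labelled_rows_four[OF s d]
    have e: "f {} {} = list_det (2 * n) (?X0 @ ?a x # ?X1 @ ?a y # ?X2 @ ?a w # ?X3 @ ?a v # ?X4)"
      "f {x, y, w, v} {y, v} = list_det (2 * n) (?X0 @ ?X1 @ ?a y # ?b y # ?X2 @ ?X3 @ ?a v # ?b v # ?X4)"
      "f {x, y} {y} = list_det (2 * n) (?X0 @ ?X1 @ ?a y # ?b y # ?X2 @ ?a w # ?X3 @ ?a v # ?X4)"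
      "f {w, v} {v} = list_det (2 * n) (?X0 @ ?a x # ?X1 @ ?a y # ?X2 @ ?X3 @ ?a v # ?b v # ?X4)"
      "f {x, v} {v} = list_det (2 * n) (?X0 @ ?X1 @ ?a y # ?X2 @ ?a w # ?X3 @ ?a v # ?b v # ?X4)"
      "f {w, y} {y} = list_det (2 * n) (?X0 @ ?a x # ?X1 @ ?a y # ?b y # ?X2 @ ?X3 @ ?a v # ?X4)"
      unfolding f_def
      using ne len R[of "{}" "{}"] R[of "{x, y, w, v}" "{y, v}"] R[of "{x, y}" "{y}"] R[of "{w, v}" "{v}"]
        R[of "{x, v}" "{v}"] R[of "{w, y}" "{y}"]
        dbl[of "?X0 @ ?X1" "?X2 @ ?X3 @ ?s v # ?t v # ?X4" y] dbl[of "?X0 @ ?X1 @ ?a y # ?b y # ?X2 @ ?X3" ?X4 v]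
        dbl[of "?X0 @ ?X1" "?X2 @ ?a w # ?X3 @ ?a v # ?X4" y] dbl[of "?X0 @ ?a x # ?X1 @ ?a y # ?X2 @ ?X3" ?X4 v]
        dbl[of "?X0 @ ?X1 @ ?a y # ?X2 @ ?a w # ?X3" ?X4 v] dbl[of "?X0 @ ?a x # ?X1" "?X2 @ ?X3 @ ?a v # ?X4" y]
      by (simp_all add: slot_def)
    show ?thesis unfolding e by (rule list_det_condense1[OF len])
  next
    assume o: "y < w \<and> w < v \<and> v < x"
    then obtain S0 S1 S2 S3 S4 where s: "[1..<Suc (2 * n)] = S0 @ y # S1 @ w # S2 @ v # S3 @ x # S4"
      and d: "(set S0 \<union> set S1 \<union> set S2 \<union> set S3 \<union> set S4) \<inter> {y, w, v, x} = {}"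
      using upt_split_four[of y w v x "2 * n"] mem by auto
    have ne: "x \<noteq> y" "x \<noteq> w" "x \<noteq> v" "y \<noteq> w" "y \<noteq> v" "w \<noteq> v" using o by auto
    let ?X0 = "map ?a S0" and ?X1 = "map ?a S1" and ?X2 = "map ?a S2" and ?X3 = "map ?a S3" and ?X4 = "map ?a S4"
    have len: "2 * n = length ?X0 + length ?X1 + length ?X2 + length ?X3 + length ?X4 + 4"
      using arg_cong[OF s, of length] by (simp del: upt_Suc)
    note R = labelled_rows_four[OF s d]
    have e: "f {} {} = list_det (2 * n) (?X0 @ ?a y # ?X1 @ ?a w # ?X2 @ ?a v # ?X3 @ ?a x # ?X4)"
      "f {x, y, w, v} {y, v} = list_det (2 * n) (?X0 @ ?a y # ?b y # ?X1 @ ?X2 @ ?a v # ?b v # ?X3 @ ?X4)"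
      "f {x, y} {y} = list_det (2 * n) (?X0 @ ?a y # ?b y # ?X1 @ ?a w # ?X2 @ ?a v # ?X3 @ ?X4)"
      "f {w, v} {v} = list_det (2 * n) (?X0 @ ?a y # ?X1 @ ?X2 @ ?a v # ?b v # ?X3 @ ?a x # ?X4)"
      "f {x, v} {v} = list_det (2 * n) (?X0 @ ?a y # ?X1 @ ?a w # ?X2 @ ?a v # ?b v # ?X3 @ ?X4)"
      "f {w, y} {y} = list_det (2 * n) (?X0 @ ?a y # ?b y # ?X1 @ ?X2 @ ?a v # ?X3 @ ?a x # ?X4)"
      unfolding f_def
      using ne len R[of "{}" "{}"] R[of "{x, y, w, v}" "{y, v}"] R[of "{x, y}" "{y}"] R[of "{w, v}" "{v}"]
        R[of "{x, v}" "{v}"] R[of "{w, y}" "{y}"]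
        dbl[of ?X0 "?X1 @ ?X2 @ ?s v # ?t v # ?X3 @ ?X4" y] dbl[of "?X0 @ ?a y # ?b y # ?X1 @ ?X2" "?X3 @ ?X4" v]
        dbl[of ?X0 "?X1 @ ?a w # ?X2 @ ?a v # ?X3 @ ?X4" y] dbl[of "?X0 @ ?a y # ?X1 @ ?X2" "?X3 @ ?a x # ?X4" v]
        dbl[of "?X0 @ ?a y # ?X1 @ ?a w # ?X2" "?X3 @ ?X4" v] dbl[of ?X0 "?X1 @ ?X2 @ ?a v # ?X3 @ ?a x # ?X4" y]
      by (simp_all add: slot_def)
    show ?thesis unfolding e by (rule list_det_condense2[OF len])
  qed
qed

end

section \<open>Condensation\<close>

text \<open>Quarter turn of \<open>a\<close>, divided by its squared length.\<close>

lemma wedge_dual: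
  assumes "a \<noteq> (0, 0)"
  shows "wedge a (- snd a / ((fst a)\<^sup>2 + (snd a)\<^sup>2), fst a / ((fst a)\<^sup>2 + (snd a)\<^sup>2)) = 1"
proof -
  have "(fst a)\<^sup>2 + (snd a)\<^sup>2 \<noteq> 0" using assms by (cases a) (simp add: sum_power2_eq_zero_iff)
  then show ?thesis by (simp add: wedge_def power2_eq_square add_divide_distrib[symmetric])
qed

text \<open>Translates the determinant relation of \<open>labelled_condensation\<close> into one for
  the double-dimer sums; all three products carry the same sign by
  \<open>sign_exponent_parity\<close>, so it cancels.\<close>

lemma (in dimer_nodes) ztrip_condensation:
  fixes col :: "nat \<Rightarrow> rgb"
  assumes N: "N = 2 * n" and cc: "\<forall>c. circ_contig N {i \<in> {1..N}. col i = c}"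
    and mem: "x \<in> {1..N}" "y \<in> {1..N}" "w \<in> {1..N}" "v \<in> {1..N}"
    and ord: "x < y \<and> y < w \<and> w < v \<or> y < w \<and> w < v \<and> v < x"
    and cols: "col ` {x, y, w, v} = UNIV"
    and bw: "node x \<in> V1" "node w \<in> V1" "node y \<in> V2" "node v \<in> V2"
  defines "Z \<equiv> \<lambda>U. Ztrip V1 V2 E wt node col ({1..N} - U)"
  shows "Z {} * Z {x, y, w, v} = Z {x, y} * Z {w, v} + Z {x, v} * Z {w, y}"
proof -
  obtain \<kappa> r where real: "\<And>I. I \<subseteq> {1..N} \<Longrightarrow> card I = n \<Longrightarrow> minor I = \<kappa> * list_det n (map r (sorted_list_of_set I))"
    using minors_realized[of N n minor] minor_exchange by blast
  obtain k where k: "\<And>i. i \<in> {1..N} \<Longrightarrow> k i \<in> {1..4 :: nat}"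
    "\<And>i j. i \<in> {1..N} \<Longrightarrow> j \<in> {1..N} \<Longrightarrow> i \<le> j \<Longrightarrow> k i \<le> k j"
    "\<And>i j. i \<in> {1..N} \<Longrightarrow> j \<in> {1..N} \<Longrightarrow> col i \<noteq> col j \<longleftrightarrow> contrasting (k i) (k j)"
    using colour_blocks[OF cc] by blast
  define u where "u i = block_vec (k i)" for i
  define F where "F U D = list_det (2 * n) (labelled_rows n N r ({1..N} - U) D u)" for U D
  define sg :: "int \<Rightarrow> real" where "sg e = (if even e then 1 else - 1)" for e
  define s where "s U D = sign_exponent k ({1..N} - U) D" for U D
  have sgm: "sg a * sg b = sg (a + b)" for a b by (simp add: sg_def)
  have ne: "x \<noteq> y" "x \<noteq> w" "x \<noteq> v" "y \<noteq> w" "y \<noteq> v" "w \<noteq> v" using ord by auto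
  have "\<exists>d. wedge (u i) d = 1" for i
  proof -
    have "u i \<noteq> (0, 0)" by (simp add: u_def block_vec_def)
    from wedge_dual[OF this] show ?thesis by blast
  qed
  then obtain u' where dual: "\<And>i. wedge (u i) (u' i) = 1" by metis
  have cond: "F {} {} * F {x, y, w, v} {y, v} = F {x, y} {y} * F {w, v} {v} + F {x, v} {v} * F {w, y} {y}"
    unfolding F_def N by (rule labelled_condensation[OF dual ord]) (use mem N in auto)
  have tot: "block_count k {1..2 * n} 1 + block_count k {1..2 * n} 2 + block_count k {1..2 * n} 3 + block_count k {1..2 * n} 4 = 2 * int n"
    using block_count_total[of N k] k(1) N by simp
  have blocks: "(if x < y then (k x, k y, k w, k v) else (k y, k w, k v, k x)) \<in>
      {(1, 1, 2, 3), (1, 2, 2, 3), (1, 2, 3, 3), (1, 2, 3, 4), (2, 2, 3, 4), (2, 3, 3, 4), (2, 3, 4, 4)}"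
  proof -
    have "\<exists>i\<in>{x, y, w, v}. col i = c" for c
    proof -
      have "c \<in> col ` {x, y, w, v}" using cols by simp
      then show ?thesis by (metis imageE)
    qed
    then obtain i1 i2 i3 where i: "i1 \<in> {x, y, w, v}" "col i1 = Red" "i2 \<in> {x, y, w, v}" "col i2 = Green"
      "i3 \<in> {x, y, w, v}" "col i3 = Blue" by metis
    have iN: "i1 \<in> {1..N}" "i2 \<in> {1..N}" "i3 \<in> {1..N}" using i(1,3,5) mem by auto
    have con: "contrasting (k i1) (k i2)" "contrasting (k i1) (k i3)" "contrasting (k i2) (k i3)"
      using k(3)[OF iN(1,2)] k(3)[OF iN(1,3)] k(3)[OF iN(2,3)] i(2,4,6) by auto
    have sub: "{k i1, k i2, k i3} \<subseteq> {k x, k y, k w, k v}" "{k i1, k i2, k i3} \<subseteq> {k y, k w, k v, k x}"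
      using i(1,3,5) by auto
    note km = k(1)[OF mem(1)] k(1)[OF mem(2)] k(1)[OF mem(3)] k(1)[OF mem(4)]
    from ord show ?thesis
    proof
      assume o: "x < y \<and> y < w \<and> w < v"
      then have "k x \<le> k y" "k y \<le> k w" "k w \<le> k v" using k(2) mem by auto
      from four_blocks[OF km this sub(1) con] show ?thesis using o by simp
    next
      assume o: "y < w \<and> w < v \<and> v < x"
      then have "k y \<le> k w" "k w \<le> k v" "k v \<le> k x" using k(2) mem by auto
      from four_blocks[OF km(2,3,4,1) this sub(2) con] show ?thesis using o by simp
    qed
  qed
  have memn: "x \<in> {1..2 * n}" "y \<in> {1..2 * n}" "w \<in> {1..2 * n}" "v \<in> {1..2 * n}" using mem N by auto
  have par: "sg (s {} {} + s {x, y, w, v} {y, v}) = sg (s {x, y} {y} + s {w, v} {v})"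
    "sg (s {} {} + s {x, y, w, v} {y, v}) = sg (s {x, v} {v} + s {w, y} {y})"
    using sign_exponent_parity[OF tot memn ord blocks] unfolding s_def N sg_def by auto
  \<comment> \<open>\<open>U\<close> is the set of removed nodes and \<open>D\<close> its white
    part; equal numbers of both colours keep the number of rows at \<open>2 * n\<close>.\<close>
  have expand: "\<kappa> * \<kappa> * F U D = (-1) ^ (n choose 2) * sg (s U D) * Z U"
    if U: "U \<subseteq> {x, y, w, v}" "D \<subseteq> U" "D \<subseteq> {y, v}" "U - D \<subseteq> {x, w}" "card U = 2 * card D" for U D
  proof -
    have UN: "U \<subseteq> {1..N}" using U(1) mem by auto
    then have "finite U" using finite_subset by blast
    then have "card ({1..N} - U) = N - card U" using UN by (simp add: card_Diff_subset)
    moreover have "card U \<le> N" using card_mono[OF _ UN] by simp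
    ultimately have c: "card ({1..N} - U) + 2 * card D = 2 * n" using U(5) N by simp
    have white: "node i \<in> V2" if "i \<in> D" for i using that U(3) bw by auto
    have black: "node i \<notin> V2" if "i \<in> {1..N} - ({1..N} - U) - D" for i
    proof -
      have "i \<in> {x, w}" using that U(4) by blast
      then have "node i \<in> V1" using bw by auto
      then show ?thesis using disj by blast
    qed
    have "D \<subseteq> {1..N}" "D \<inter> ({1..N} - U) = {}" using U UN by auto
    from ztrip_expansion[where col = col, OF real _ this c white black k]
    have "\<kappa> * \<kappa> * F U D = (-1) ^ (n choose 2) * (\<Prod>i\<in>D. (-1) ^ card (below ({1..N} - U) i)) *
        (if even (block_exponent k ({1..N} - U)) then 1 else - 1) * Z U"
      unfolding F_def u_def[abs_def] Z_def by simp
    moreover have "(\<Prod>i\<in>D. (-1) ^ card (below ({1..N} - U) i)) *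
        (if even (block_exponent k ({1..N} - U)) then 1 else - 1) = sg (s U D)"
      unfolding power_sum[symmetric] sg_def s_def sign_exponent_def by (auto simp: minus_one_power_iff simp del: of_nat_sum)
    ultimately show ?thesis by (simp only: mult.assoc)
  qed
  define \<epsilon> :: real where "\<epsilon> = (-1) ^ (n choose 2)"
  have e2: "\<epsilon> * \<epsilon> = 1" by (simp add: \<epsilon>_def flip: power_add)
  have e: "\<kappa> * \<kappa> * F {} {} = \<epsilon> * sg (s {} {}) * Z {}"
    "\<kappa> * \<kappa> * F {x, y, w, v} {y, v} = \<epsilon> * sg (s {x, y, w, v} {y, v}) * Z {x, y, w, v}"
    "\<kappa> * \<kappa> * F {x, y} {y} = \<epsilon> * sg (s {x, y} {y}) * Z {x, y}"
    "\<kappa> * \<kappa> * F {w, v} {v} = \<epsilon> * sg (s {w, v} {v}) * Z {w, v}"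
    "\<kappa> * \<kappa> * F {x, v} {v} = \<epsilon> * sg (s {x, v} {v}) * Z {x, v}"
    "\<kappa> * \<kappa> * F {w, y} {y} = \<epsilon> * sg (s {w, y} {y}) * Z {w, y}"
    unfolding \<epsilon>_def by (rule expand; use ne in auto)+
  have prod: "\<epsilon> * sg a * p * (\<epsilon> * sg b * q) = sg (a + b) * (p * q)" for a b p q
  proof -
    have "\<epsilon> * sg a * p * (\<epsilon> * sg b * q) = (\<epsilon> * \<epsilon>) * (sg a * sg b) * (p * q)" by (simp only: mult_ac)
    then show ?thesis by (simp only: e2 sgm mult_1)
  qed
  \<comment> \<open>Multiplying the relation by the fourth power of \<open>\<kappa>\<close> instead
    of dividing the expansions by \<open>\<kappa> * \<kappa>\<close> includes the case of vanishing
    \<open>\<kappa>\<close>.\<close>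
  have "(\<kappa> * \<kappa> * F {} {}) * (\<kappa> * \<kappa> * F {x, y, w, v} {y, v}) =
      (\<kappa> * \<kappa> * F {x, y} {y}) * (\<kappa> * \<kappa> * F {w, v} {v}) + (\<kappa> * \<kappa> * F {x, v} {v}) * (\<kappa> * \<kappa> * F {w, y} {y})"
  proof -
    have "\<kappa> * \<kappa> * a * (\<kappa> * \<kappa> * b) = \<kappa> * \<kappa> * (\<kappa> * \<kappa>) * (a * b)" for a b by (simp only: mult_ac)
    then show ?thesis by (simp only: cond distrib_left)
  qed
  then have "sg (s {} {} + s {x, y, w, v} {y, v}) * (Z {} * Z {x, y, w, v}) =
      sg (s {} {} + s {x, y, w, v} {y, v}) * (Z {x, y} * Z {w, v} + Z {x, v} * Z {w, y})"
    unfolding e prod distrib_left using par by simp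
  then show ?thesis by (simp add: sg_def split: if_splits)
qed

theorem mainTheorem1:
  fixes V1 V2 :: "'v set" and E :: "('v \<times> 'v) set" and wt :: "('v \<times> 'v) \<Rightarrow> real"
    and n :: nat and node :: "nat \<Rightarrow> 'v" and col :: "nat \<Rightarrow> rgb" and x y w v :: nat
  assumes "finite V1" "finite V2" "V1 \<inter> V2 = {}" "E \<subseteq> V1 \<times> V2"
    and "disk_embedding (V1 \<union> V2) E (2 * n) node"
    and "inj_on node {1..2 * n}" "node ` {1..2 * n} \<subseteq> V1 \<union> V2"
    and "card {i \<in> {1..2 * n}. node i \<in> V1} = n"
    and "\<forall>c. circ_contig (2 * n) {i \<in> {1..2 * n}. col i = c}"
    and "card {i \<in> {1..2 * n}. col i = Red} \<le> card {i \<in> {1..2 * n}. col i = Green} + card {i \<in> {1..2 * n}. col i = Blue}"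
    and "card {i \<in> {1..2 * n}. col i = Green} \<le> card {i \<in> {1..2 * n}. col i = Red} + card {i \<in> {1..2 * n}. col i = Blue}"
    and "card {i \<in> {1..2 * n}. col i = Blue} \<le> card {i \<in> {1..2 * n}. col i = Red} + card {i \<in> {1..2 * n}. col i = Green}"
    and "x \<in> {1..2 * n}" "y \<in> {1..2 * n}" "w \<in> {1..2 * n}" "v \<in> {1..2 * n}"
    and "(x < y \<and> y < w \<and> w < v) \<or> (y < w \<and> w < v \<and> v < x) \<or>
         (w < v \<and> v < x \<and> x < y) \<or> (v < x \<and> x < y \<and> y < w)"
    and "col ` {x, y, w, v} = UNIV"
    and "node x \<in> V1" "node w \<in> V1" "node y \<in> V2" "node v \<in> V2"
  shows "Ztrip V1 V2 E wt node col {1..2 * n} * Ztrip V1 V2 E wt node col ({1..2 * n} - {x, y, w, v})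
       = Ztrip V1 V2 E wt node col ({1..2 * n} - {x, y}) * Ztrip V1 V2 E wt node col ({1..2 * n} - {w, v})
       + Ztrip V1 V2 E wt node col ({1..2 * n} - {x, v}) * Ztrip V1 V2 E wt node col ({1..2 * n} - {w, y})"
proof -
  interpret bipartite_graph V1 V2 E
    by unfold_locales (use assms(1-4) in auto)
  have EV: "E \<subseteq> (V1 \<union> V2) \<times> (V1 \<union> V2)" using assms(4) by auto
  interpret dimer_nodes V1 V2 E wt "2 * n" node
  proof
    show "inj_on node {1..2 * n}" "node ` {1..2 * n} \<subseteq> V1 \<union> V2" by (rule assms)+
    show "edge_conn H (node i) (node j)"
      if "H \<subseteq> E" "1 \<le> i" "i < j" "j < k" "k < l" "l \<le> 2 * n"
        "edge_conn H (node i) (node k)" "edge_conn H (node j) (node l)" for H i j k l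
      by (rule disk_embedding_noncrossing[OF assms(5) EV assms(7) that])
  qed
  let ?Z = "\<lambda>U. Ztrip V1 V2 E wt node col ({1..2 * n} - U)"
  have "?Z {} * ?Z {x, y, w, v} = ?Z {x, y} * ?Z {w, v} + ?Z {x, v} * ?Z {w, y}"
  proof (cases "x < y \<and> y < w \<and> w < v \<or> y < w \<and> w < v \<and> v < x")
    case True
    show ?thesis
      by (rule ztrip_condensation[OF refl assms(9,13-16) True assms(18-22)])
  next
    case False
    \<comment> \<open>Exchanging \<open>x\<close> with \<open>w\<close> and \<open>y\<close> with
      \<open>v\<close> preserves the identity and turns the two remaining cyclic orders into those
      already treated.\<close>
    then have ord: "w < v \<and> v < x \<and> x < y \<or> v < x \<and> x < y \<and> y < w" using assms(17) by blast
    have s: "{w, v, x, y} = {x, y, w, v}" "{w, y} = {y, w}" "{x, v} = {v, x}" by auto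
    have cols: "col ` {w, v, x, y} = UNIV" using assms(18) by (simp only: s)
    have "?Z {} * ?Z {w, v, x, y} = ?Z {w, v} * ?Z {x, y} + ?Z {w, y} * ?Z {x, v}"
      by (rule ztrip_condensation[OF refl assms(9,15,16,13,14) ord cols assms(20,19,22,21)])
    then show ?thesis unfolding s(1) by (simp only: mult.commute add.commute)
  qed
  then show ?thesis by simp
qed

end
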